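(* Let $N\ge1$. Assume $f\in C^0([0,\infty))\cap C^2((0,\infty))$ is nondecreasing and convex, $f>0$ in $(0,\infty)$, and let $\overline{q_0}=\limsup_{u\to0^+}q(u)$ and $\underline{q_0}=\liminf_{u\to0^+}q(u)$ in $\overline{\mathbb{R}}$. Assume $u\in C^2(\mathbb{R}^N)$ is a bounded, nonnegative, stable solution of $-\Delta u=f(u)$ in $\mathbb{R}^N$. Then $u\equiv0$ if any of the following conditions holds: 1. $N\ge3$ and $\underline{q_0}>\frac N2$; 2. $1\le N\le 6$ and $\overline{q_0}<\infty$; 3. $N\ge1$ and $\dfrac{4}{N-2}\left(1+\dfrac1{\sqrt{\overline{q_0}}}\right)>\dfrac1{\underline{q_0}}$.
   Context: For $u>0$, $q(u)=\dfrac{f'(u)^2}{f(u)f''(u)}$ if $f(u)f''(u)\ne0$, and $q(u)=+\infty$ otherwise. Conventions: $1/(+\infty)=0$, $1/0=+\infty$, and for $N=2$ the factor $\frac{4}{N-2}$ is read as $+\infty$. A solution $u\in C^2(\mathbb{R}^N)$ of $-\Delta u=f(u)$ in $\mathbb{R}^N$ is stable if for all $\varphi\in C^1_c(\mathbb{R}^N)$, $\int_{\mathbb{R}^N} f'(u)\varphi^2\,dx\le\int_{\mathbb{R}^N}|\nabla\varphi|^2\,dx$; here $f'(0)$ denotes the right derivative of $f$ at $0$ (which exists and is finite by convexity and monotonicity). *)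

theory Defs
  imports "HOL-Analysis.Analysis"
begin

definition C2_on_pos :: "(real \<Rightarrow> real) \<Rightarrow> bool" where
  "C2_on_pos f \<longleftrightarrow>
     (\<forall>s>0. f differentiable (at s)) \<and>
     (\<forall>s>0. deriv f differentiable (at s)) \<and>
     continuous_on {0<..} (deriv (deriv f))"

text \<open>The derivative of \<open>f\<close> on \<open>[0,\<infinity>)\<close>. The value at \<open>0\<close> is the right derivative;
  values of \<open>f\<close> at negative arguments play no role.\<close>

definition deriv_halfline :: "(real \<Rightarrow> real) \<Rightarrow> real \<Rightarrow> real" where
  "deriv_halfline f s =
     (if s = 0 then Lim (at_right 0) (\<lambda>h. (f h - f 0) / h) else deriv f s)"

definition q_quot :: "(real \<Rightarrow> real) \<Rightarrow> real \<Rightarrow> ereal" where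
  "q_quot f s =
     (if f s * deriv (deriv f) s \<noteq> 0
      then ereal ((deriv f s)\<^sup>2 / (f s * deriv (deriv f) s))
      else \<infinity>)"

definition q0_upper :: "(real \<Rightarrow> real) \<Rightarrow> ereal" where
  "q0_upper f = Limsup (at_right 0) (q_quot f)"

definition q0_lower :: "(real \<Rightarrow> real) \<Rightarrow> ereal" where
  "q0_lower f = Liminf (at_right 0) (q_quot f)"

text \<open>Square root on \<open>[0,\<infinity>]\<close>; only nonnegative arguments are relevant, as \<open>q_quot f\<close> is
  nonnegative for convex \<open>f > 0\<close>.\<close>

definition sqrt_ereal :: "ereal \<Rightarrow> ereal" where
  "sqrt_ereal x = (if \<bar>x\<bar> = \<infinity> then x else ereal (sqrt (real_of_ereal x)))"

definition four_over_N_minus_2 :: "nat \<Rightarrow> ereal" where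
  "four_over_N_minus_2 N = (if N = 2 then \<infinity> else ereal (4 / (real N - 2)))"

definition partial_deriv :: "'a \<Rightarrow> ('a::euclidean_space \<Rightarrow> real) \<Rightarrow> 'a \<Rightarrow> real" where
  "partial_deriv b v x = frechet_derivative v (at x) b"

definition C1 :: "('a::euclidean_space \<Rightarrow> real) \<Rightarrow> bool" where
  "C1 v \<longleftrightarrow>
     (\<forall>x. v differentiable (at x)) \<and>
     (\<forall>b\<in>Basis. continuous_on UNIV (partial_deriv b v))"

definition C2 :: "('a::euclidean_space \<Rightarrow> real) \<Rightarrow> bool" where
  "C2 v \<longleftrightarrow> C1 v \<and> (\<forall>b\<in>Basis. C1 (partial_deriv b v))"

definition C1_compact_support :: "('a::euclidean_space \<Rightarrow> real) \<Rightarrow> bool" where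
  "C1_compact_support v \<longleftrightarrow> C1 v \<and> compact (closure {x. v x \<noteq> 0})"

definition gradient :: "('a::euclidean_space \<Rightarrow> real) \<Rightarrow> 'a \<Rightarrow> 'a" where
  "gradient v x = (\<Sum>b\<in>Basis. partial_deriv b v x *\<^sub>R b)"

definition laplacian :: "('a::euclidean_space \<Rightarrow> real) \<Rightarrow> 'a \<Rightarrow> real" where
  "laplacian v x = (\<Sum>b\<in>Basis. partial_deriv b (partial_deriv b v) x)"

definition is_stable :: "(real \<Rightarrow> real) \<Rightarrow> ('a::euclidean_space \<Rightarrow> real) \<Rightarrow> bool" where
  "is_stable f u \<longleftrightarrow>
     (\<forall>\<phi>. C1_compact_support \<phi> \<longrightarrow>
        (LINT x|lborel. deriv_halfline f (u x) * (\<phi> x)\<^sup>2)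
          \<le> (LINT x|lborel. (norm (gradient \<phi> x))\<^sup>2))"

end

theory Submission
  imports Defs
begin

text \<open>
  Either \<open>u\<close> vanishes identically or \<open>u > 0\<close>, by the mean value inequality for superharmonic functions.

  For \<open>N \<le> 9\<close> no growth condition is needed. Spherical means of a bounded superharmonic function tend
  to its infimum, hence the Dirichlet energy of \<open>u\<close> on balls of radius \<open>R\<close> is \<open>o(R\<^bsup>N-2\<^esup>)\<close>. Testing
  stability with \<open>x \<bullet> \<nabla>u\<close> times a cut-off, combined with a Pohozaev identity, then gives \<open>x \<bullet> \<nabla>u = 0\<close>.

  For \<open>N \<ge> 10\<close> the second condition is void and the first and third one yield \<open>Q\<close> below the lower
  limit of \<open>q\<close> with \<open>4 Q + 4 \<surd>Q > N - 2\<close>; only this bound is used. Let \<open>F = f'\<close> and test stability with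
  \<open>\<psi>(u) \<eta>\<close>, \<open>\<psi> = f F\<^bsup>\<mu>\<^esup>\<close>, where \<open>\<mu>\<^sup>2 < Q\<close>. The resulting estimate is coercive on all levels of \<open>u\<close>
  except those below which \<open>F\<close> is almost constant. There superharmonicity forces the averages of \<open>u\<close> on
  balls of radius \<open>F\<^bsup>-1/2\<^esup>\<close> to be small compared with the level, so that a Poincare inequality with a
  small constant applies. Altogether the integral of \<open>F \<psi>\<^sup>2\<close> over a ball of radius \<open>R\<close> is bounded by
  \<open>R\<^bsup>-2\<^esup>\<close> times that of \<open>\<psi>\<^sup>2\<close> over the doubled ball. As \<open>\<psi>\<^sup>2\<close> is at most a multiple of
  \<open>F\<^bsup>2Q+2\<mu>\<^esup>\<close>, it is of order \<open>R\<^bsup>-4Q-4\<mu>\<^esup>\<close> where \<open>F\<close> is below \<open>R\<^bsup>-2\<^esup>\<close>, and the rest is absorbed;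
  letting \<open>R \<rightarrow> \<infinity>\<close> contradicts \<open>u > 0\<close>.
\<close>

section \<open>Integration by parts\<close>

text \<open>What stability really controls is the function \<open>B\<close>, and \<open>B\<close>
  grows only together with \<open>F\<close>: its derivative is \<open>f F'' \<chi>^2\<close> times
  \<open>1 - \<mu>^2 / q\<close> up to the flattening of the weight, whence
  \<open>\<mu>^2 < Q\<close>. Where \<open>F\<close> is locally constant \<open>B\<close> is
  constant as well, so stability is silent there; this obstacle forces the separate treatment of
  such levels. The exponent condition is a count of scales: \<open>R^N\<close> for the volume,
  \<open>R^(-2)\<close> from the estimate and \<open>R^(-4Q-4\<mu>)\<close> for
  \<open>\<psi>^2\<close> at slope \<open>R^(-2)\<close> must have a vanishing product, with
  \<open>\<mu>\<close> as close to \<open>sqrt Q\<close> as desired. The dimension 10 is where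
  \<open>4 Q + 4 sqrt Q > N - 2\<close> begins to force \<open>Q > 1\<close>; then
  \<open>f / F\<close> is at least \<open>(1 - 1/Q) v\<close> near 0, which yields the doubling
  properties of \<open>f\<close> and \<open>F\<close> on which all comparisons between levels rest.
  Since \<open>u\<close> need not decay, every local estimate loses a doubling of the radius; it is
  recovered by a supremum over all centres, which is why all bounds are uniform in the
  centre.\<close>

definition bounded_support :: "('a::real_normed_vector \<Rightarrow> 'b::zero) \<Rightarrow> bool" where
  "bounded_support v \<longleftrightarrow> (\<exists>r. \<forall>x. norm x > r \<longrightarrow> v x = 0)"

lemma bounded_supportI: "(\<And>x. norm x > r \<Longrightarrow> v x = 0) \<Longrightarrow> bounded_support v"
  by (auto simp: bounded_support_def)

lemma bounded_support_subset:
  assumes "bounded_support v" "\<And>x. v x = 0 \<Longrightarrow> w x = 0"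
  shows "bounded_support w"
  using assms by (auto simp: bounded_support_def)

lemma bounded_support_common:
  assumes "bounded_support v" "bounded_support w" "\<And>x. v x = 0 \<Longrightarrow> w x = 0 \<Longrightarrow> z x = 0"
  shows "bounded_support z"
proof -
  obtain r s where "\<And>x. norm x > r \<Longrightarrow> v x = 0" "\<And>x. norm x > s \<Longrightarrow> w x = 0"
    using assms(1,2) by (auto simp: bounded_support_def)
  then show ?thesis
    using assms(3) by (intro bounded_supportI[of "max r s"]) auto
qed

lemma integrable_bounded_support:
  fixes g :: "'a::euclidean_space \<Rightarrow> 'b::{banach, second_countable_topology}"
  assumes "continuous_on UNIV g" "bounded_support g"
  shows "integrable lborel g"
proof -
  obtain r where r: "\<And>x. norm x > r \<Longrightarrow> g x = 0"
    using assms(2) by (auto simp: bounded_support_def)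
  have "integrable lborel (\<lambda>x. indicator (cball 0 r) x *\<^sub>R g x)"
    by (rule borel_integrable_compact) (use assms(1) continuous_on_subset in auto)
  also have "(\<lambda>x. indicator (cball 0 r) x *\<^sub>R g x) = g"
  proof
    fix x show "indicator (cball 0 r) x *\<^sub>R g x = g x"
      using r[of x] by (cases "norm x \<le> r") (auto simp: indicator_def)
  qed
  finally show ?thesis .
qed

lemma lborel_integral_eq_cbox:
  fixes g :: "'a::euclidean_space \<Rightarrow> real"
  assumes "continuous_on UNIV g" "\<And>x. x \<notin> cbox a b \<Longrightarrow> g x = 0"
  shows "(LINT x|lborel. g x) = integral (cbox a b) g"
proof -
  obtain r where r: "\<And>x. x \<in> cbox a b \<Longrightarrow> norm x \<le> r"
    using bounded_cbox[of a b] by (auto simp: bounded_iff)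
  then have "bounded_support g"
    using assms(2) by (intro bounded_supportI[of r]) (metis not_le)
  then have "(LINT x|lborel. g x) = integral UNIV g"
    using integrable_bounded_support[OF assms(1)] integral_lborel by metis
  also have "\<dots> = integral UNIV (\<lambda>x. if x \<in> cbox a b then g x else 0)"
    by (rule arg_cong[where f = "integral UNIV"]) (use assms(2) in auto)
  also have "\<dots> = integral (cbox a b) g" by (rule integral_restrict_UNIV)
  finally show ?thesis .
qed

text \<open>All the functions vanish outside one box, so this is Leibniz's rule on a compact box.
  \<open>s0\<close> is an interior point because the derivative is two-sided.\<close>

lemma has_real_derivative_lborel_integral:
  fixes \<Phi> \<Phi>' :: "real \<Rightarrow> 'a::euclidean_space \<Rightarrow> real"
  assumes deriv: "\<And>s x. s \<in> {a..b} \<Longrightarrow> ((\<lambda>s. \<Phi> s x) has_real_derivative \<Phi>' s x) (at s)"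
    and cont: "\<And>s. s \<in> {a..b} \<Longrightarrow> continuous_on UNIV (\<Phi> s)"
    and cont': "continuous_on ({a..b} \<times> UNIV) (\<lambda>(s, x). \<Phi>' s x)"
    and supp: "\<And>s x. s \<in> {a..b} \<Longrightarrow> norm x > r \<Longrightarrow> \<Phi> s x = 0"
    and s0: "s0 \<in> {a<..<b}"
  shows "((\<lambda>s. LINT x|lborel. \<Phi> s x) has_real_derivative (LINT x|lborel. \<Phi>' s0 x)) (at s0)"
proof -
  obtain d :: 'a where cd: "cball 0 r \<subseteq> cbox (- d) d"
    using bounded_subset_cbox_symmetric[of "cball (0::'a) r"] by auto
  define c where "c = - d"
  note cd = cd[folded c_def]
  have out: "\<Phi> s x = 0" if "s \<in> {a..b}" "x \<notin> cbox c d" for s x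
    using cd that supp[of s x] by (cases "norm x \<le> r") auto
  \<comment> \<open>Outside the box \<open>\<Phi> s x\<close> is zero for all \<open>s\<close> near
    \<open>s0\<close>, so \<open>\<Phi>'\<close> inherits the support.\<close>
  have out': "\<Phi>' s0 x = 0" if "x \<notin> cbox c d" for x
  proof -
    have "((\<lambda>s. \<Phi> s x) has_real_derivative \<Phi>' s0 x) (at s0)"
      using deriv[of s0] s0 by auto
    moreover have "((\<lambda>s. \<Phi> s x) has_real_derivative 0) (at s0)"
      by (rule has_field_derivative_transform_within_open[of "\<lambda>_. 0" 0 s0 "{a<..<b}"])
        (use s0 out that in auto)
    ultimately show ?thesis using DERIV_unique by blast
  qed
  have c0: "continuous_on UNIV (\<Phi>' s0)"
  proof -
    have "continuous_on UNIV (\<lambda>x. (\<lambda>(s, x). \<Phi>' s x) (s0, x))"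
      by (rule continuous_on_compose2[OF cont']) (use s0 in \<open>auto intro!: continuous_intros\<close>)
    then show ?thesis by simp
  qed
  have "((\<lambda>s. integral (cbox c d) (\<Phi> s)) has_real_derivative integral (cbox c d) (\<Phi>' s0))
      (at s0 within {a..b})"
  proof (rule leibniz_rule_field_derivative)
    show "\<Phi> s integrable_on cbox c d" if "s \<in> {a..b}" for s
      using cont[OF that] by (meson continuous_on_subset integrable_continuous subset_UNIV)
    show "continuous_on ({a..b} \<times> cbox c d) (\<lambda>(s, x). \<Phi>' s x)"
      using cont' by (rule continuous_on_subset) auto
    show "((\<lambda>s. \<Phi> s x) has_real_derivative \<Phi>' s x) (at s within {a..b})" if "s \<in> {a..b}" for s x
      using deriv[OF that] by (rule has_field_derivative_at_within)
  qed (use s0 in auto)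
  then have "((\<lambda>s. integral (cbox c d) (\<Phi> s)) has_real_derivative integral (cbox c d) (\<Phi>' s0))
      (at s0)"
    using at_within_interior[of s0 "{a..b}"] s0 by auto
  then have "((\<lambda>s. integral (cbox c d) (\<Phi> s)) has_real_derivative (LINT x|lborel. \<Phi>' s0 x)) (at s0)"
    using lborel_integral_eq_cbox[OF c0, of c d] out' by auto
  then show ?thesis
    by (rule has_field_derivative_transform_within_open[of _ _ _ "{a<..<b}"])
      (use s0 lborel_integral_eq_cbox[OF cont, of _ c d] out in auto)
qed

lemma lborel_integral_translate:
  fixes g :: "'a::euclidean_space \<Rightarrow> real"
  assumes [measurable]: "g \<in> borel_measurable borel"
  shows "(LINT x|lborel. g (c + x)) = (LINT x|lborel. g x)"
proof -
  have "(LINT x|lborel. g x) = (LINT x|distr lborel borel ((+) c). g x)"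
    by (simp add: lborel_distr_plus)
  also have "\<dots> = (LINT x|lborel. g (c + x))"
    by (rule integral_distr) auto
  finally show ?thesis by simp
qed

lemma lborel_integral_scale:
  fixes g :: "'a::euclidean_space \<Rightarrow> real"
  assumes [measurable]: "g \<in> borel_measurable borel" and "R > 0"
  shows "R ^ DIM('a) * (LINT x|lborel. g (p + R *\<^sub>R x)) = (LINT x|lborel. g x)"
proof -
  let ?T = "\<lambda>x::'a. p + R *\<^sub>R x"
  have "(LINT x|lborel. g x) = (LINT x|density (distr lborel borel ?T) (\<lambda>_. \<bar>R\<bar> ^ DIM('a)). g x)"
    using lborel_affine[of R p] assms(2) by simp
  also have "\<dots> = (LINT x|distr lborel borel ?T. R ^ DIM('a) * g x)"
    using assms(2) by (subst integral_density) auto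
  also have "\<dots> = R ^ DIM('a) * (LINT x|lborel. g (p + R *\<^sub>R x))"
    by (subst integral_distr) auto
  finally show ?thesis by simp
qed

text \<open>The integral of \<open>g\<close> does not change under translation by
  \<open>s *\<^sub>R b\<close>; differentiating under the integral at \<open>s = 0\<close> gives the
  claim.\<close>

lemma lborel_integral_directional_derivative_eq_0:
  fixes g D :: "'a::euclidean_space \<Rightarrow> real"
  assumes deriv: "\<And>x. ((\<lambda>t. g (x + t *\<^sub>R b)) has_real_derivative D x) (at 0)"
    and cont: "continuous_on UNIV g" "continuous_on UNIV D"
    and supp: "bounded_support g"
  shows "(LINT x|lborel. D x) = 0"
proof -
  obtain r where r: "\<And>x. norm x > r \<Longrightarrow> g x = 0"
    using supp by (auto simp: bounded_support_def)
  let ?\<Phi> = "\<lambda>s x. g (s *\<^sub>R b + x)" and ?\<Phi>' = "\<lambda>s x. D (s *\<^sub>R b + x)"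
  have "((\<lambda>s. LINT x|lborel. ?\<Phi> s x) has_real_derivative (LINT x|lborel. ?\<Phi>' 0 x)) (at 0)"
  proof (rule has_real_derivative_lborel_integral)
    fix s x
    have "((\<lambda>t. g ((s *\<^sub>R b + x) + (t - s) *\<^sub>R b)) has_real_derivative D (s *\<^sub>R b + x)) (at s)"
      by (rule DERIV_chain2[where g = "\<lambda>t. t - s" and x = s and Db = 1
          and f = "\<lambda>t. g ((s *\<^sub>R b + x) + t *\<^sub>R b)", simplified])
        (use deriv[of "s *\<^sub>R b + x"] in \<open>auto intro!: derivative_eq_intros\<close>)
    moreover have "(\<lambda>t. g ((s *\<^sub>R b + x) + (t - s) *\<^sub>R b)) = (\<lambda>t. g (t *\<^sub>R b + x))"
      by (auto simp: algebra_simps)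
    ultimately show "((\<lambda>s. g (s *\<^sub>R b + x)) has_real_derivative D (s *\<^sub>R b + x)) (at s)" by simp
  next
    show "continuous_on UNIV (\<lambda>x. g (s *\<^sub>R b + x))" for s
      by (intro continuous_on_compose2[OF cont(1)] continuous_intros) auto
    show "continuous_on ({-1..1} \<times> UNIV) (\<lambda>(s, x). D (s *\<^sub>R b + x))"
      unfolding case_prod_beta
      by (intro continuous_on_compose2[OF cont(2)] continuous_intros) auto
    show "g (s *\<^sub>R b + x) = 0" if "s \<in> {-1..1}" "r + norm b < norm x" for s x
    proof -
      have "norm x \<le> norm (s *\<^sub>R b + x) + norm (s *\<^sub>R b)"
        using norm_triangle_ineq4[of "s *\<^sub>R b + x" "s *\<^sub>R b"] by simp
      moreover have "norm (s *\<^sub>R b) \<le> norm b"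
        using that(1) by (auto intro!: mult_left_le_one_le)
      ultimately show ?thesis using that(2) r by auto
    qed
  qed auto
  moreover have "(LINT x|lborel. ?\<Phi> s x) = (LINT x|lborel. g x)" for s
    by (rule lborel_integral_translate) (use cont borel_measurable_continuous_onI in blast)
  ultimately have "((\<lambda>s. LINT x|lborel. g x) has_real_derivative (LINT x|lborel. D x)) (at 0)"
    by simp
  then show ?thesis using DERIV_const DERIV_unique by blast
qed

text \<open>Continuously differentiable functions paired with an explicit gradient field, so that
  the product and chain rules produce the formulas which enter the integral identities.\<close>

definition has_grad :: "('a::euclidean_space \<Rightarrow> real) \<Rightarrow> ('a \<Rightarrow> 'a) \<Rightarrow> bool" where
  "has_grad v g \<longleftrightarrow> (\<forall>x. (v has_derivative (\<lambda>h. g x \<bullet> h)) (at x)) \<and> continuous_on UNIV g"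

lemma has_gradD:
  assumes "has_grad v g"
  shows "(v has_derivative (\<lambda>h. g x \<bullet> h)) (at x)" "continuous_on UNIV g" "continuous_on UNIV v"
proof -
  show d: "(v has_derivative (\<lambda>h. g x \<bullet> h)) (at x)" for x
    using assms by (auto simp: has_grad_def)
  show "continuous_on UNIV g" using assms by (auto simp: has_grad_def)
  show "continuous_on UNIV v"
    by (rule has_derivative_continuous_on) (rule has_derivative_at_withinI[OF d])
qed

lemma has_grad_const: "has_grad (\<lambda>x. c) (\<lambda>x. 0)"
  by (auto simp: has_grad_def)

lemma has_grad_mult:
  assumes "has_grad v g" "has_grad w k"
  shows "has_grad (\<lambda>x. v x * w x) (\<lambda>x. w x *\<^sub>R g x + v x *\<^sub>R k x)"
  unfolding has_grad_def
proof (intro conjI allI)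
  fix x
  show "((\<lambda>x. v x * w x) has_derivative (\<lambda>h. (w x *\<^sub>R g x + v x *\<^sub>R k x) \<bullet> h)) (at x)"
    using has_derivative_mult[OF has_gradD(1)[OF assms(1)] has_gradD(1)[OF assms(2)]]
    by (rule has_derivative_eq_rhs) (auto simp: algebra_simps)
qed (intro continuous_intros has_gradD[OF assms(1)] has_gradD[OF assms(2)])

lemma has_grad_diff:
  assumes "has_grad v g" "has_grad w k"
  shows "has_grad (\<lambda>x. v x - w x) (\<lambda>x. g x - k x)"
  unfolding has_grad_def
proof (intro conjI allI)
  fix x
  show "((\<lambda>x. v x - w x) has_derivative (\<lambda>h. (g x - k x) \<bullet> h)) (at x)"
    using has_derivative_diff[OF has_gradD(1)[OF assms(1)] has_gradD(1)[OF assms(2)]]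
    by (rule has_derivative_eq_rhs) (auto simp: algebra_simps)
qed (intro continuous_intros has_gradD[OF assms(1)] has_gradD[OF assms(2)])

lemma has_grad_compose:
  assumes "has_grad v g" "\<And>x. (\<phi> has_real_derivative \<phi>' (v x)) (at (v x))"
    "continuous_on (range v) \<phi>'"
  shows "has_grad (\<lambda>x. \<phi> (v x)) (\<lambda>x. \<phi>' (v x) *\<^sub>R g x)"
  unfolding has_grad_def
proof (intro conjI allI)
  fix x
  have "(\<phi> has_derivative (\<lambda>h. \<phi>' (v x) * h)) (at (v x))"
    using assms(2)[of x] by (simp add: has_field_derivative_def)
  from has_derivative_compose[OF has_gradD(1)[OF assms(1)] this]
  show "((\<lambda>x. \<phi> (v x)) has_derivative (\<lambda>h. (\<phi>' (v x) *\<^sub>R g x) \<bullet> h)) (at x)"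
    by (rule has_derivative_eq_rhs) auto
next
  show "continuous_on UNIV (\<lambda>x. \<phi>' (v x) *\<^sub>R g x)"
    by (intro continuous_intros has_gradD[OF assms(1)] continuous_on_compose2[OF assms(3)]) auto
qed

section \<open>Gradients of compactly supported functions and the link to \<open>C1\<close>\<close>

lemma has_derivative_0_outside_ball:
  fixes v :: "'a::real_normed_vector \<Rightarrow> real"
  assumes "\<And>y. norm y > r \<Longrightarrow> v y = 0" "norm x > r" "(v has_derivative v') (at x)"
  shows "v' h = 0"
proof -
  have "open {y::'a. norm y > r}"
    by (intro open_Collect_less continuous_intros)
  then have "((\<lambda>_. 0) has_derivative v') (at x)"
    by (rule has_derivative_transform_within_open[OF assms(3)]) (use assms(1,2) in blast)+
  then have "v' = (\<lambda>h. 0)"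
    using has_derivative_unique has_derivative_const by blast
  then show ?thesis by simp
qed

lemma has_grad_zero_outside:
  assumes "has_grad v g" "\<And>x. norm x > r \<Longrightarrow> v x = 0" "norm x > r"
  shows "g x = 0"
  using has_derivative_0_outside_ball[OF assms(2,3) has_gradD(1)[OF assms(1)], of "g x"] by simp

lemma bounded_support_grad:
  assumes "has_grad v g" "bounded_support v"
  shows "bounded_support g"
  using assms has_grad_zero_outside[OF assms(1)] unfolding bounded_support_def by metis

lemma has_grad_imp:
  assumes "has_grad v g"
  shows "partial_deriv b v x = g x \<bullet> b" "gradient v x = g x" "C1 v"
proof -
  have fd: "frechet_derivative v (at x) = (\<lambda>h. g x \<bullet> h)" for x
    using frechet_derivative_at[OF has_gradD(1)[OF assms]] by simp
  show "partial_deriv b v x = g x \<bullet> b" by (simp add: partial_deriv_def fd)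
  show "gradient v x = g x"
    by (simp add: gradient_def partial_deriv_def fd euclidean_representation)
  have "v differentiable at x" for x
    using has_gradD(1)[OF assms] by (auto simp: differentiable_def)
  moreover have "continuous_on UNIV (partial_deriv b v)" for b
    unfolding partial_deriv_def fd by (intro continuous_intros has_gradD[OF assms])
  ultimately show "C1 v" by (auto simp: C1_def)
qed

lemma C1_has_grad:
  assumes "C1 v"
  shows "has_grad v (gradient v)"
  unfolding has_grad_def
proof (intro conjI allI)
  fix x
  have d: "(v has_derivative frechet_derivative v (at x)) (at x)"
    using assms frechet_derivative_works by (auto simp: C1_def)
  then interpret linear "frechet_derivative v (at x)" by (rule has_derivative_linear)
  have "frechet_derivative v (at x) h = gradient v x \<bullet> h" for h
  proof -
    have "frechet_derivative v (at x) h = frechet_derivative v (at x) (\<Sum>b\<in>Basis. (h \<bullet> b) *\<^sub>R b)"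
      by (simp add: euclidean_representation)
    also have "\<dots> = (\<Sum>b\<in>Basis. (h \<bullet> b) * frechet_derivative v (at x) b)"
      by (simp add: sum scale)
    also have "\<dots> = gradient v x \<bullet> h"
      by (simp add: gradient_def partial_deriv_def inner_sum_left inner_commute[of h] mult.commute)
    finally show ?thesis .
  qed
  then have "frechet_derivative v (at x) = (\<lambda>h. gradient v x \<bullet> h)" by blast
  then show "(v has_derivative (\<lambda>h. gradient v x \<bullet> h)) (at x)" using d by simp
next
  show "continuous_on UNIV (gradient v)"
    unfolding gradient_def using assms by (intro continuous_intros) (auto simp: C1_def)
qed

lemma has_grad_C1_compact_support:
  assumes "has_grad v g" "bounded_support v"
  shows "C1_compact_support v"
proof -
  obtain r where r: "\<And>x. norm x > r \<Longrightarrow> v x = 0"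
    using assms(2) by (auto simp: bounded_support_def)
  then have "{x. v x \<noteq> 0} \<subseteq> cball 0 r" using not_le by fastforce
  then have "bounded {x. v x \<noteq> 0}" using bounded_cball bounded_subset by blast
  then show ?thesis using has_grad_imp(3)[OF assms(1)]
    by (simp add: C1_compact_support_def compact_closure)
qed

text \<open>The derivative is hidden behind an existential since integration by parts sees only its
  trace. Continuity is stated on basis vectors; by linearity it extends to all directions.\<close>

definition has_div :: "('a::euclidean_space \<Rightarrow> 'a) \<Rightarrow> ('a \<Rightarrow> real) \<Rightarrow> bool" where
  "has_div W d \<longleftrightarrow> (\<exists>W'. (\<forall>x. (W has_derivative W' x) (at x)) \<and>
     (\<forall>b\<in>Basis. continuous_on UNIV (\<lambda>x. W' x b)) \<and> (\<forall>x. d x = (\<Sum>b\<in>Basis. W' x b \<bullet> b)))"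

lemma has_divD:
  assumes "has_div W d"
  shows "continuous_on UNIV W" "continuous_on UNIV d"
proof -
  obtain W' where W': "\<And>x. (W has_derivative W' x) (at x)"
    "\<And>b. b \<in> Basis \<Longrightarrow> continuous_on UNIV (\<lambda>x. W' x b)" "\<And>x. d x = (\<Sum>b\<in>Basis. W' x b \<bullet> b)"
    using assms by (auto simp: has_div_def)
  show "continuous_on UNIV W"
    using W'(1) by (meson differentiableI differentiable_imp_continuous_on differentiable_at_imp_differentiable_on)
  have "d = (\<lambda>x. \<Sum>b\<in>Basis. W' x b \<bullet> b)" using W'(3) by auto
  then show "continuous_on UNIV d" using W'(2) by (auto intro!: continuous_intros)
qed

text \<open>The divergence of \<open>v W\<close> is the sum over the basis of the directional
  derivatives \<open>D b\<close>, each with vanishing integral. Only the product is required to have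
  bounded support, so the cut-off may sit in either factor.\<close>

theorem green:
  fixes v :: "'a::euclidean_space \<Rightarrow> real"
  assumes v: "has_grad v g" and W: "has_div W d" and supp: "bounded_support (\<lambda>x. v x *\<^sub>R W x)"
  shows "(LINT x|lborel. v x * d x + g x \<bullet> W x) = 0"
    and "integrable lborel (\<lambda>x. v x * d x + g x \<bullet> W x)"
proof -
  obtain W' where W': "\<And>x. (W has_derivative W' x) (at x)"
    "\<And>b. b \<in> Basis \<Longrightarrow> continuous_on UNIV (\<lambda>x. W' x b)" "\<And>x. d x = (\<Sum>b\<in>Basis. W' x b \<bullet> b)"
    using W by (auto simp: has_div_def)
  define D where "D b x = v x * (W' x b \<bullet> b) + (g x \<bullet> b) * (W x \<bullet> b)" for b x
  have dd: "((\<lambda>y. v y * (W y \<bullet> b)) has_derivative (\<lambda>h. v x * (W' x h \<bullet> b) + (g x \<bullet> h) * (W x \<bullet> b))) (at x)"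
    for b x
    by (auto intro!: derivative_eq_intros has_gradD(1)[OF v] W'(1))
  have dl: "((\<lambda>t. v (x + t *\<^sub>R b) * (W (x + t *\<^sub>R b) \<bullet> b)) has_real_derivative D b x) (at 0)" for b x
  proof -
    have l: "((\<lambda>t. x + t *\<^sub>R b) has_derivative (\<lambda>t. t *\<^sub>R b)) (at 0)"
      by (auto intro!: derivative_eq_intros)
    have "((\<lambda>t. v (x + t *\<^sub>R b) * (W (x + t *\<^sub>R b) \<bullet> b)) has_derivative
      (\<lambda>t. v x * (W' x (t *\<^sub>R b) \<bullet> b) + (g x \<bullet> (t *\<^sub>R b)) * (W x \<bullet> b))) (at 0)"
      by (rule has_derivative_compose[OF l, of "\<lambda>y. v y * (W y \<bullet> b)", simplified, OF dd])
    moreover have "W' x (t *\<^sub>R b) = t *\<^sub>R W' x b" for t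
      using has_derivative_linear[OF W'(1)] linear_scale by blast
    ultimately show ?thesis
      by (auto simp: has_field_derivative_def D_def algebra_simps elim!: has_derivative_eq_rhs)
  qed
  have c1: "continuous_on UNIV (\<lambda>y. v y * (W y \<bullet> b))" for b
    by (intro continuous_intros has_gradD[OF v] has_divD[OF W])
  have c2: "continuous_on UNIV (D b)" if "b \<in> Basis" for b
    unfolding D_def by (intro continuous_intros has_gradD[OF v] has_divD[OF W] W'(2) that)
  have s1: "bounded_support (\<lambda>y. v y * (W y \<bullet> b))" for b
    by (rule bounded_support_subset[OF supp]) auto
  have z: "(LINT x|lborel. D b x) = 0" if "b \<in> Basis" for b
    by (rule lborel_integral_directional_derivative_eq_0[OF dl c1 c2[OF that] s1])
  have i: "integrable lborel (D b)" if "b \<in> Basis" for b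
  proof (rule integrable_bounded_support[OF c2[OF that]])
    obtain r where r: "\<And>x. norm x > r \<Longrightarrow> v x * (W x \<bullet> b) = 0"
      using s1[of b] by (auto simp: bounded_support_def)
    show "bounded_support (D b)"
    proof (rule bounded_supportI)
      fix x :: 'a assume x: "norm x > r"
      show "D b x = 0"
        using has_derivative_0_outside_ball[OF r x dd, where h = b] by (simp add: D_def)
    qed
  qed
  have eq: "(\<lambda>x. v x * d x + g x \<bullet> W x) = (\<lambda>x. \<Sum>b\<in>Basis. D b x)"
    by (rule ext)
      (simp add: D_def W'(3) sum.distrib sum_distrib_left euclidean_inner[of "g _" "W _"])
  show "integrable lborel (\<lambda>x. v x * d x + g x \<bullet> W x)"
    unfolding eq by (intro Bochner_Integration.integrable_sum i)
  show "(LINT x|lborel. v x * d x + g x \<bullet> W x) = 0"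
    unfolding eq using z i by (subst Bochner_Integration.integral_sum) auto
qed

section \<open>Cut-off functions\<close>

text \<open>A truncated paraboloid: its powers with exponent at least 2 are continuously
  differentiable, and their derivatives are explicit polynomials in \<open>bump\<close> and
  \<open>x - p\<close>.\<close>

definition bump :: "'a::euclidean_space \<Rightarrow> real \<Rightarrow> 'a \<Rightarrow> real" where
  "bump p R x = max 0 (1 - (norm (x - p))\<^sup>2 / R\<^sup>2)"

lemma bump_bounds: "0 \<le> bump p R x" "bump p R x \<le> 1"
  by (auto simp: bump_def)

lemma bump_pow_bounds: "0 \<le> bump p R x ^ n" "bump p R x ^ n \<le> 1"
  using bump_bounds[of p R x] by (auto intro: power_le_one)

lemma bump_eq_0: "R > 0 \<Longrightarrow> norm (x - p) \<ge> R \<Longrightarrow> bump p R x = 0"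
  by (auto simp: bump_def divide_simps power2_eq_square intro!: max_absorb1 mult_mono)

lemma bump_scale: "R > 0 \<Longrightarrow> bump p R (p + R *\<^sub>R x) = bump 0 1 x"
  by (simp add: bump_def power_mult_distrib)

lemma bump_translate: "bump p R (p + x) = bump 0 R x"
  by (simp add: bump_def)

lemma bump_ge:
  assumes "R > 0" "norm (x - p) \<le> a * R" "0 \<le> a"
  shows "1 - a\<^sup>2 \<le> bump p R x"
proof -
  have "(norm (x - p))\<^sup>2 \<le> (a * R)\<^sup>2" using assms by (intro power_mono) auto
  then have "(norm (x - p))\<^sup>2 / R\<^sup>2 \<le> a\<^sup>2" using assms by (simp add: divide_simps power_mult_distrib)
  then show ?thesis by (auto simp: bump_def)
qed

lemma max_power_deriv:
  assumes "n \<ge> 1"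
  shows "((\<lambda>s::real. max 0 s ^ Suc n) has_real_derivative real (Suc n) * max 0 s ^ n) (at s)"
proof -
  consider "s < 0" | "s = 0" | "s > 0" by linarith
  then show ?thesis
  proof cases
    case 1
    have "((\<lambda>s::real. max 0 s ^ Suc n) has_real_derivative 0) (at s)"
      by (rule has_field_derivative_transform_within_open[of "\<lambda>_. 0" _ _ "{..<0}"])
        (use 1 in auto)
    moreover have "max 0 s = 0" using 1 by simp
    ultimately show ?thesis using assms by (simp del: power_Suc add: power_0_left)
  next
    case 3
    have "((\<lambda>s::real. max 0 s ^ Suc n) has_real_derivative real (Suc n) * s ^ n) (at s)"
      by (rule has_field_derivative_transform_within_open[of "\<lambda>s. s ^ Suc n" _ _ "{0<..}"])
        (use 3 DERIV_pow[of "Suc n" s] in \<open>auto simp del: power_Suc\<close>)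
    then show ?thesis using 3 by (simp add: max_def)
  next
    case 2
    have "((\<lambda>h. (max 0 (0 + h) ^ Suc n - max 0 (0::real) ^ Suc n) / h) \<longlongrightarrow> 0) (at 0)"
    proof (rule Lim_null_comparison)
      show "\<forall>\<^sub>F h in at (0::real). norm ((max 0 (0 + h) ^ Suc n - max 0 (0::real) ^ Suc n) / h) \<le> \<bar>h\<bar> ^ n"
      proof (rule always_eventually, rule allI)
        fix h :: real
        show "norm ((max 0 (0 + h) ^ Suc n - max 0 (0::real) ^ Suc n) / h) \<le> \<bar>h\<bar> ^ n"
          by (cases "h \<le> 0") auto
      qed
      show "((\<lambda>h::real. \<bar>h\<bar> ^ n) \<longlongrightarrow> 0) (at 0)"
        using assms by (auto intro!: tendsto_eq_intros)
    qed
    then show ?thesis using 2 assms by (simp add: DERIV_def power_0_left)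
  qed
qed

lemma has_derivative_norm_power2:
  "((\<lambda>x::'a::euclidean_space. (norm (x - p))\<^sup>2) has_derivative (\<lambda>h. 2 * ((x - p) \<bullet> h))) (at x)"
  unfolding power2_norm_eq_inner
  by (auto intro!: derivative_eq_intros simp: inner_commute)

lemma continuous_on_bump [continuous_intros]: "continuous_on A (bump p R)"
  unfolding bump_def by (cases "R = 0") (auto intro!: continuous_intros)

lemma has_grad_bump_power:
  assumes "n \<ge> 1"
  shows "has_grad (\<lambda>x. bump p R x ^ Suc n)
    (\<lambda>x. (- (2 * real (Suc n) / R\<^sup>2) * bump p R x ^ n) *\<^sub>R (x - p))"
proof -
  let ?s = "\<lambda>x. 1 - (norm (x - p))\<^sup>2 / R\<^sup>2"
  have "has_grad ?s (\<lambda>x. (- 2 / R\<^sup>2) *\<^sub>R (x - p))"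
    unfolding has_grad_def
  proof (intro conjI allI)
    fix x
    show "(?s has_derivative (\<lambda>h. ((- 2 / R\<^sup>2) *\<^sub>R (x - p)) \<bullet> h)) (at x)"
      by (rule has_derivative_eq_rhs[OF has_derivative_diff[OF has_derivative_const
            bounded_linear.has_derivative[OF bounded_linear_divide has_derivative_norm_power2]]]) auto
  qed (intro continuous_intros)
  then have "has_grad (\<lambda>x. max 0 (?s x) ^ Suc n)
      (\<lambda>x. (real (Suc n) * max 0 (?s x) ^ n) *\<^sub>R ((- 2 / R\<^sup>2) *\<^sub>R (x - p)))"
    by (rule has_grad_compose) (intro max_power_deriv assms continuous_intros)+
  moreover have "(real (Suc n) * max 0 (?s x) ^ n) *\<^sub>R ((- 2 / R\<^sup>2) *\<^sub>R (x - p)) =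
      (- (2 * real (Suc n) / R\<^sup>2) * bump p R x ^ n) *\<^sub>R (x - p)" for x
    by (simp add: bump_def)
  ultimately show ?thesis by (simp only: bump_def)
qed

section \<open>The cut-offs \<open>xi\<close> and \<open>eta\<close> with their derivatives\<close>

definition xi :: "'a::euclidean_space \<Rightarrow> real \<Rightarrow> 'a \<Rightarrow> real" where
  "xi p R x = bump p R x ^ 6"

definition grad_xi :: "'a::euclidean_space \<Rightarrow> real \<Rightarrow> 'a \<Rightarrow> 'a" where
  "grad_xi p R x = (- (12 / R\<^sup>2) * bump p R x ^ 5) *\<^sub>R (x - p)"

definition lap_xi :: "'a::euclidean_space \<Rightarrow> real \<Rightarrow> 'a \<Rightarrow> real" where
  "lap_xi p R x = (120 / R ^ 4) * bump p R x ^ 4 * (norm (x - p))\<^sup>2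
     - (12 / R\<^sup>2) * real DIM('a) * bump p R x ^ 5"

text \<open>The exponents 6 and 3 make \<open>xi\<close> the square of \<open>eta\<close>: stability
  is tested with a multiple of \<open>eta\<close>, which leaves the weight \<open>xi\<close>, and
  the exponent 6 still allows two derivatives.\<close>

definition eta :: "'a::euclidean_space \<Rightarrow> real \<Rightarrow> 'a \<Rightarrow> real" where
  "eta p R x = bump p R x ^ 3"

definition grad_eta :: "'a::euclidean_space \<Rightarrow> real \<Rightarrow> 'a \<Rightarrow> 'a" where
  "grad_eta p R x = (- (6 / R\<^sup>2) * bump p R x ^ 2) *\<^sub>R (x - p)"

lemma xi_eq_eta: "xi p R x = (eta p R x)\<^sup>2" "grad_xi p R x = (2 * eta p R x) *\<^sub>R grad_eta p R x"
  by (auto simp: xi_def eta_def grad_xi_def grad_eta_def eval_nat_numeral)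

lemma has_grad_xi: "has_grad (xi p R) (grad_xi p R)"
  using has_grad_bump_power[of 5 p R] by (simp add: xi_def[abs_def] grad_xi_def[abs_def])

lemma has_grad_eta: "has_grad (eta p R) (grad_eta p R)"
  using has_grad_bump_power[of 2 p R] by (simp add: eta_def[abs_def] grad_eta_def[abs_def])

lemma has_div_grad_xi: "has_div (grad_xi p R) (lap_xi p R)"
proof -
  define W' where "W' x h = (- (12 / R\<^sup>2)) *\<^sub>R
    (bump p R x ^ 5 *\<^sub>R h + ((- (10 / R\<^sup>2) * bump p R x ^ 4) * ((x - p) \<bullet> h)) *\<^sub>R (x - p))"
    for x h :: 'a
  have b5: "((\<lambda>x. bump p R x ^ 5) has_derivative (\<lambda>h. ((- (10 / R\<^sup>2) * bump p R x ^ 4) *\<^sub>R (x - p)) \<bullet> h)) (at x)"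
    for x :: 'a
    using has_gradD(1)[OF has_grad_bump_power[of 4 p R]] by simp
  have "(grad_xi p R has_derivative W' x) (at x)" for x :: 'a
    unfolding grad_xi_def[abs_def] W'_def[abs_def]
    by (rule has_derivative_eq_rhs[OF has_derivative_scaleR[OF has_derivative_mult_right[OF b5]
          has_derivative_diff[OF has_derivative_ident has_derivative_const]]])
      (simp only: fun_eq_iff inner_scaleR_left scaleR_add_right scaleR_scaleR diff_zero mult.assoc simp_thms)
  moreover have "continuous_on UNIV (\<lambda>x. W' x b)" for b
    unfolding W'_def by (intro continuous_intros)
  moreover have "lap_xi p R x = (\<Sum>b\<in>Basis. W' x b \<bullet> b)" for x :: 'a
  proof -
    define y c k where "y = x - p" and "c = - (12 / R\<^sup>2)" and "k = - (10 / R\<^sup>2) * bump p R x ^ 4"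
    have "W' x b \<bullet> b = c * bump p R x ^ 5 + c * k * ((y \<bullet> b) * (y \<bullet> b))" if "b \<in> Basis" for b
      unfolding W'_def y_def[symmetric] c_def[symmetric] k_def[symmetric]
      using that by (simp add: algebra_simps)
    then have "(\<Sum>b\<in>Basis. W' x b \<bullet> b) = real DIM('a) * (c * bump p R x ^ 5) + c * k * (y \<bullet> y)"
      by (simp add: sum.distrib sum_distrib_left[symmetric] euclidean_inner[of y y])
    also have "\<dots> = lap_xi p R x"
      by (simp add: lap_xi_def y_def c_def k_def dot_square_norm power4_eq_xxxx power2_eq_square mult.assoc)
    finally show ?thesis by simp
  qed
  ultimately show ?thesis unfolding has_div_def by metis
qed

lemma xi_bounds: "0 \<le> xi p R x" "xi p R x \<le> 1"
  by (auto simp: xi_def bump_pow_bounds)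

lemma xi_eq_0: "R > 0 \<Longrightarrow> norm (x - p) \<ge> R \<Longrightarrow> xi p R x = 0"
  by (simp add: xi_def bump_eq_0)

lemma bounded_support_bump:
  fixes v :: "'a::euclidean_space \<Rightarrow> 'b::zero"
  assumes "R > 0" "\<And>x. bump p R x = 0 \<Longrightarrow> v x = 0"
  shows "bounded_support v"
proof (rule bounded_supportI[of "norm p + R"])
  fix x :: 'a assume "norm p + R < norm x"
  then show "v x = 0"
    using norm_triangle_ineq2[of x p] by (intro assms(2) bump_eq_0 assms(1)) auto
qed

lemma bounded_support_xi:
  assumes "R > 0"
  shows "bounded_support (xi p R)" "bounded_support (grad_xi p R)" "bounded_support (lap_xi p R)"
    "bounded_support (eta p R)" "bounded_support (grad_eta p R)"
  by (rule bounded_support_bump[OF assms, of p];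
      simp add: xi_def grad_xi_def lap_xi_def eta_def grad_eta_def)+

lemma continuous_on_xi [continuous_intros]:
  "continuous_on A (xi p R)" "continuous_on A (grad_xi p R)" "continuous_on A (lap_xi p R)"
  "continuous_on A (eta p R)" "continuous_on A (grad_eta p R)"
  unfolding xi_def[abs_def] grad_xi_def[abs_def] lap_xi_def[abs_def] eta_def[abs_def] grad_eta_def[abs_def]
  by (intro continuous_intros continuous_on_bump)+

lemma integrable_xi:
  assumes "R > 0" "continuous_on UNIV g"
  shows "integrable lborel (\<lambda>x. g x * xi p R x)"
  by (intro integrable_bounded_support continuous_intros assms(2))
    (rule bounded_support_subset[OF bounded_support_xi(1)[OF assms(1)]], auto)

text \<open>On the half ball \<open>bump\<close> is at least \<open>3/4\<close>, and
  \<open>(3/4)^6 > 1/6\<close>. Derivatives of a cut-off have lower powers of \<open>bump\<close>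
  and are not bounded by the cut-off itself; this is how they are bounded by the one of doubled
  radius.\<close>

lemma one_le_xi_double:
  assumes "R > 0" "norm (x - p) \<le> R"
  shows "1 \<le> 6 * xi p (2 * R) x"
proof -
  have "1 - (1/2)\<^sup>2 \<le> bump p (2 * R) x" by (rule bump_ge) (use assms in auto)
  then have "(3/4) ^ 6 \<le> bump p (2 * R) x ^ 6" by (intro power_mono) (auto simp: power2_eq_square)
  then show ?thesis by (simp add: xi_def power_divide)
qed

text \<open>Inside the ball the two terms are at most \<open>120 / R\<^sup>2\<close> and
  \<open>12 / R\<^sup>2\<close> times the dimension; the remaining factor 6 is that of
  \<open>one_le_xi_double\<close>. The constant 216 in \<open>grad_eta_bound\<close> is likewise 6
  times 36.\<close>

lemma lap_xi_bound:
  fixes p :: "'a::euclidean_space"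
  assumes "R > 0"
  shows "\<bar>lap_xi p R x\<bar> \<le> (72 * real DIM('a) + 720) / R\<^sup>2 * xi p (2 * R) x"
proof (cases "norm (x - p) \<le> R")
  case True
  have n: "(norm (x - p))\<^sup>2 \<le> R\<^sup>2" using True by (intro power_mono) auto
  have "\<bar>lap_xi p R x\<bar> \<le> (120 / R ^ 4) * (bump p R x ^ 4 * (norm (x - p))\<^sup>2)
      + (12 / R\<^sup>2) * real DIM('a) * bump p R x ^ 5"
    unfolding lap_xi_def using assms bump_pow_bounds(1)[of p R x]
      abs_of_nonneg[OF bump_pow_bounds(1)[of p R x 5]]
    by (intro order_trans[OF abs_triangle_ineq4] add_mono) (simp_all add: abs_mult mult.assoc abs_of_nonneg)
  also have "\<dots> \<le> (120 / R ^ 4) * (1 * R\<^sup>2) + (12 / R\<^sup>2) * real DIM('a) * 1"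
    using assms bump_pow_bounds[of p R x] bump_bounds(1)[of p R x] n by (intro add_mono mult_mono) auto
  also have "\<dots> = (12 * real DIM('a) + 120) / R\<^sup>2"
    using assms by (simp add: field_simps power4_eq_xxxx power2_eq_square)
  also have "\<dots> \<le> (12 * real DIM('a) + 120) / R\<^sup>2 * (6 * xi p (2 * R) x)"
    using mult_left_mono[OF one_le_xi_double[OF assms True], of "(12 * real DIM('a) + 120) / R\<^sup>2"] by simp
  also have "\<dots> = (72 * real DIM('a) + 720) / R\<^sup>2 * xi p (2 * R) x" by (simp add: algebra_simps)
  finally show ?thesis .
next
  case False
  then show ?thesis using assms xi_bounds[of p "2 * R" x] by (simp add: lap_xi_def bump_eq_0)
qed

lemma grad_eta_bound:
  assumes "R > 0"
  shows "(norm (grad_eta p R x))\<^sup>2 \<le> 216 / R\<^sup>2 * xi p (2 * R) x"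
proof (cases "norm (x - p) \<le> R")
  case True
  have n: "(norm (x - p))\<^sup>2 \<le> R\<^sup>2" using True by (intro power_mono) auto
  have "(norm (grad_eta p R x))\<^sup>2 = (36 / R ^ 4) * (bump p R x ^ 4 * (norm (x - p))\<^sup>2)"
    by (simp add: grad_eta_def power_mult_distrib power_divide flip: power_mult)
  also have "\<dots> \<le> (36 / R ^ 4) * (1 * R\<^sup>2)"
    using assms bump_pow_bounds[of p R x] n by (intro mult_mono) auto
  also have "\<dots> = 36 / R\<^sup>2"
    using assms by (simp add: field_simps power4_eq_xxxx power2_eq_square)
  also have "\<dots> \<le> 36 / R\<^sup>2 * (6 * xi p (2 * R) x)"
    using one_le_xi_double[OF assms True] by (intro mult_le_cancel_left1[THEN iffD2]) auto
  finally show ?thesis by (simp add: algebra_simps)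
next
  case False
  then show ?thesis using assms xi_bounds[of p "2 * R" x] by (simp add: grad_eta_def bump_eq_0)
qed

section \<open>Integrals of the cut-offs and the doubling of the radius\<close>

lemma integral_xi:
  fixes p :: "'a::euclidean_space"
  assumes "R > 0"
  shows "(LINT x|lborel. xi p R x) = R ^ DIM('a) * (LINT x|lborel. xi (0::'a) 1 x)"
  using lborel_integral_scale[of "xi p R" R p] assms
    borel_measurable_continuous_onI[OF continuous_on_xi(1)[of UNIV p R]]
  by (simp add: xi_def bump_scale)

lemma integral_xi_pos: "0 < (LINT x|lborel. xi (0::'a::euclidean_space) 1 x)"
proof -
  let ?B = "ball (0::'a) (1/2)"
  have b: "xi 0 1 x \<ge> 1/6 * indicator ?B x" for x :: 'a
  proof (cases "x \<in> ?B")
    case True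
    then have "1 - (1/2)\<^sup>2 \<le> bump 0 1 x" by (intro bump_ge) auto
    then have "(3/4) ^ 6 \<le> bump 0 1 x ^ 6" by (intro power_mono) (auto simp: power2_eq_square)
    then show ?thesis by (simp add: xi_def power_divide indicator_def)
  qed (simp add: xi_bounds)
  have "0 < 1/6 * measure lborel ?B"
    using content_ball_pos[of "1/2" "0::'a"] by simp
  also have "\<dots> = (LINT x|lborel. 1/6 * indicator ?B x)" by simp
  also have "\<dots> \<le> (LINT x|lborel. xi (0::'a) 1 x)"
    using b integrable_xi[of 1 "\<lambda>_. 1" "0::'a"] emeasure_lborel_ball_finite[of "0::'a" "1/2"]
    by (intro integral_mono integrable_mult_right integrable_real_indicator) auto
  finally show ?thesis .
qed

text \<open>Finitely many balls of radius \<open>1/2\<close> cover \<open>cball 0 2\<close>, and on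
  each of them the unit cut-off around its centre is at least \<open>1/6\<close>. Translation and
  scaling make one family of centres serve all \<open>p\<close> and \<open>R\<close>.\<close>

lemma xi_double_covering:
  "\<exists>Q::'a::euclidean_space set. finite Q \<and>
     (\<forall>p R x. R > 0 \<longrightarrow> xi p (2 * R) x \<le> 6 * (\<Sum>q\<in>Q. xi (p + R *\<^sub>R q) R x))"
proof -
  have "cball (0::'a) 2 \<subseteq> (\<Union>q\<in>cball 0 2. ball q (1/2))" by force
  then obtain Q where Q: "Q \<subseteq> cball 0 2" "finite Q" "cball (0::'a) 2 \<subseteq> (\<Union>q\<in>Q. ball q (1/2))"
    using compactE_image[OF compact_cball[of "0::'a" 2], of "cball 0 2" "\<lambda>q. ball q (1/2)"] by auto
  have "xi p (2 * R) x \<le> 6 * (\<Sum>q\<in>Q. xi (p + R *\<^sub>R q) R x)" if R: "R > 0" for p x :: 'a and R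
  proof (cases "norm (x - p) \<le> 2 * R")
    case True
    let ?y = "(1/R) *\<^sub>R (x - p)"
    have "?y \<in> cball 0 2" using True R by (simp add: divide_simps)
    then obtain q where "q \<in> Q" "?y \<in> ball q (1/2)" using Q(3) by blast
    then have q: "q \<in> Q" "dist q ?y < 1/2" by (auto simp only: mem_ball)
    have "x - (p + R *\<^sub>R q) = R *\<^sub>R (?y - q)" using R by (simp add: algebra_simps)
    then have "norm (x - (p + R *\<^sub>R q)) \<le> 1/2 * R"
      using q(2) R by (simp add: dist_norm norm_minus_commute[of q])
    then have "1 - (1/2)\<^sup>2 \<le> bump (p + R *\<^sub>R q) R x" using R by (intro bump_ge) auto
    then have "(3/4) ^ 6 \<le> bump (p + R *\<^sub>R q) R x ^ 6" by (intro power_mono) (auto simp: power2_eq_square)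
    then have "1 \<le> 6 * xi (p + R *\<^sub>R q) R x" by (simp add: xi_def power_divide)
    also have "\<dots> \<le> 6 * (\<Sum>q\<in>Q. xi (p + R *\<^sub>R q) R x)"
      using member_le_sum[OF q(1), of "\<lambda>q. xi (p + R *\<^sub>R q) R x"] Q(2) by (simp add: xi_bounds)
    finally show ?thesis using xi_bounds(2)[of p "2 * R" x] by linarith
  next
    case False
    then show ?thesis using R by (simp add: xi_eq_0 xi_bounds sum_nonneg)
  qed
  then show ?thesis using Q(2) by blast
qed

text \<open>Six times the size of one fixed cover; it depends on the dimension alone, hence the type
  argument.\<close>

definition doubling_const :: "'a::euclidean_space itself \<Rightarrow> real" where
  "doubling_const _ = 6 * real (card (SOME Q::'a set. finite Q \<and>
     (\<forall>p R x. R > 0 \<longrightarrow> xi p (2 * R) x \<le> 6 * (\<Sum>q\<in>Q. xi (p + R *\<^sub>R q) R x))))"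

lemma integral_xi_double_le:
  fixes g :: "'a::euclidean_space \<Rightarrow> real"
  assumes g: "continuous_on UNIV g" "\<And>x. 0 \<le> g x" and R: "R > 0"
    and S: "\<And>q. (LINT x|lborel. g x * xi q R x) \<le> S"
  shows "(LINT x|lborel. g x * xi p (2 * R) x) \<le> doubling_const TYPE('a) * S"
proof -
  let ?P = "\<lambda>Q::'a set. finite Q \<and>
     (\<forall>p R x. R > 0 \<longrightarrow> xi p (2 * R) x \<le> 6 * (\<Sum>q\<in>Q. xi (p + R *\<^sub>R q) R x))"
  define Q where "Q = (SOME Q. ?P Q)"
  have "?P Q" unfolding Q_def by (rule someI_ex[OF xi_double_covering])
  then have Q: "finite Q" "\<And>p x. xi p (2 * R) x \<le> 6 * (\<Sum>q\<in>Q. xi (p + R *\<^sub>R q) R x)"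
    using R by blast+
  have int: "integrable lborel (\<lambda>x. g x * xi q R x)" for q
    by (rule integrable_xi[OF R g(1)])
  have "(LINT x|lborel. g x * xi p (2 * R) x) \<le> (LINT x|lborel. 6 * (\<Sum>q\<in>Q. g x * xi (p + R *\<^sub>R q) R x))"
  proof (rule integral_mono)
    show "integrable lborel (\<lambda>x. g x * xi p (2 * R) x)" using R by (intro integrable_xi g(1)) auto
    show "integrable lborel (\<lambda>x. 6 * (\<Sum>q\<in>Q. g x * xi (p + R *\<^sub>R q) R x))"
      using int by auto
    show "g x * xi p (2 * R) x \<le> 6 * (\<Sum>q\<in>Q. g x * xi (p + R *\<^sub>R q) R x)" for x
      using mult_left_mono[OF Q(2)[of p x] g(2)[of x]] by (simp add: sum_distrib_left mult_ac)
  qed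
  also have "\<dots> = 6 * (\<Sum>q\<in>Q. LINT x|lborel. g x * xi (p + R *\<^sub>R q) R x)"
    using int by simp
  also have "\<dots> \<le> 6 * (\<Sum>q\<in>Q. S)"
    by (intro mult_left_mono sum_mono S) auto
  also have "\<dots> = doubling_const TYPE('a) * S"
    by (simp add: doubling_const_def Q_def)
  finally show ?thesis .
qed

lemma doubling_const_pos: "doubling_const TYPE('a::euclidean_space) > 0"
proof -
  have "(LINT x|lborel. xi (0::'a) 1 x) > 0" by (rule integral_xi_pos)
  moreover have "(LINT x|lborel. 1 * xi (0::'a) (2 * 1) x)
      \<le> doubling_const TYPE('a) * (LINT x|lborel. xi (0::'a) 1 x)"
  proof (rule integral_xi_double_le)
    show "(LINT x|lborel. 1 * xi (q::'a) 1 x) \<le> (LINT x|lborel. xi (0::'a) 1 x)" for q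
      using integral_xi[of 1 q] by simp
  qed auto
  moreover have "(LINT x|lborel. xi (0::'a) 2 x) > 0"
    using integral_xi[of 2 "0::'a"] integral_xi_pos[where 'a = 'a] by simp
  ultimately have "0 < doubling_const TYPE('a) * (LINT x|lborel. xi (0::'a) 1 x)" by simp
  then show ?thesis using integral_xi_pos[where 'a = 'a] by (rule zero_less_mult_pos2)
qed

text \<open>Taking the supremum over all centres turns an estimate on a ball by the ball of twice the
  radius into an absolute one.\<close>

lemma absorb_doubled_ball:
  fixes g :: "'a::euclidean_space \<Rightarrow> real"
  assumes g: "continuous_on UNIV g" "\<And>x. 0 \<le> g x" "\<And>x. g x \<le> G" and R: "R > 0"
    and a: "0 \<le> a" "a * doubling_const TYPE('a) \<le> 1/2"
    and ineq: "\<And>p. (LINT x|lborel. g x * xi p R x) \<le> a * (LINT x|lborel. g x * xi p (2 * R) x) + b"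
  shows "(LINT x|lborel. g x * xi p R x) \<le> 2 * b"
proof -
  define I where "I p = (LINT x|lborel. g x * xi p R x)" for p
  have bound: "I p \<le> G * (R ^ DIM('a) * (LINT x|lborel. xi (0::'a) 1 x))" for p
  proof -
    have "I p \<le> (LINT x|lborel. G * xi p R x)"
      unfolding I_def using R g integrable_xi[OF R continuous_on_const, of G p]
      by (intro integral_mono integrable_xi) (auto intro!: mult_right_mono xi_bounds)
    then show ?thesis using integral_xi[OF R, of p] by simp
  qed
  \<comment> \<open>The upper bound on \<open>g\<close> makes the supremum finite; otherwise
    \<open>S \<le> S / 2 + b\<close> would carry no information.\<close>
  then have bdd: "bdd_above (range I)" by (intro bdd_aboveI2[OF bound])
  define S where "S = (SUP p. I p)"
  have S: "I p \<le> S" for p unfolding S_def by (rule cSUP_upper[OF _ bdd]) auto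
  have I0: "0 \<le> I p" for p unfolding I_def by (intro integral_nonneg_AE) (auto simp: g xi_bounds)
  then have S0: "0 \<le> S" using S order_trans by blast
  have "I p \<le> S / 2 + b" for p
  proof -
    have "a * (LINT x|lborel. g x * xi p (2 * R) x) \<le> a * (doubling_const TYPE('a) * S)"
      using integral_xi_double_le[OF g(1,2) R] S a(1) by (intro mult_left_mono) (auto simp: I_def)
    also have "\<dots> \<le> 1/2 * S" using mult_right_mono[OF a(2) S0] by (simp add: mult_ac)
    finally show ?thesis using ineq[of p] by (simp add: I_def)
  qed
  then have "S \<le> S / 2 + b" unfolding S_def by (intro cSUP_least) auto
  then show ?thesis using S[of p] by (simp add: I_def)
qed

section \<open>A Poincare inequality\<close>

lemma lborel_pair_integrable_compact:
  fixes \<Theta> :: "'a::euclidean_space \<times> 'b::euclidean_space \<Rightarrow> real"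
  assumes "compact A" "continuous_on A \<Theta>" "\<And>z. z \<notin> A \<Longrightarrow> \<Psi> z = 0" "\<And>z. z \<in> A \<Longrightarrow> \<Psi> z = \<Theta> z"
  shows "integrable (lborel \<Otimes>\<^sub>M lborel) \<Psi>"
proof -
  have "integrable lborel (\<lambda>z. indicator A z *\<^sub>R \<Theta> z)"
    by (rule borel_integrable_compact[OF assms(1,2)])
  also have "(\<lambda>z. indicator A z *\<^sub>R \<Theta> z) = \<Psi>"
    using assms(3,4) by (auto simp: indicator_def)
  finally show ?thesis by (simp add: lborel_prod)
qed

text \<open>Jensen's inequality: \<open>f'\<close> has mean \<open>f 1 - f 0\<close> on the unit
  interval, and its variance is nonnegative.\<close>

lemma power2_diff_le_integral:
  fixes f f' :: "real \<Rightarrow> real"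
  assumes "\<And>s. (f has_real_derivative f' s) (at s)" "continuous_on UNIV f'"
  shows "(f 1 - f 0)\<^sup>2 \<le> (LINT s|lborel. indicator {0..1} s * (f' s)\<^sup>2)"
proof -
  let ?m = "f 1 - f 0"
  have c: "continuous_on {0..1} f'" using assms(2) continuous_on_subset by blast
  have i: "integrable lborel (\<lambda>s. indicator {0..1} s *\<^sub>R g s)" if "continuous_on {0..1} g" for g :: "real \<Rightarrow> real"
    by (rule borel_integrable_compact) (use that in auto)
  have m: "(LINT s|lborel. indicator {0..1} s *\<^sub>R f' s) = ?m"
    by (rule integral_FTC_atLeastAtMost)
      (use assms(1) c in \<open>auto simp: has_real_derivative_iff_has_vector_derivative intro: has_vector_derivative_at_within\<close>)
  have "0 \<le> (LINT s|lborel. indicator {0..1} s *\<^sub>R (f' s - ?m)\<^sup>2)"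
    by (intro integral_nonneg_AE) auto
  also have "\<dots> = (LINT s|lborel. (indicator {0..1} s *\<^sub>R (f' s)\<^sup>2 - 2 * ?m * (indicator {0..1} s *\<^sub>R f' s))
      + indicator {0..1} s *\<^sub>R ?m\<^sup>2)"
    by (intro Bochner_Integration.integral_cong) (auto simp: indicator_def power2_eq_square algebra_simps)
  also have "\<dots> = (LINT s|lborel. indicator {0..1} s *\<^sub>R (f' s)\<^sup>2) - 2 * ?m * ?m + ?m\<^sup>2"
  proof -
    have 1: "integrable lborel (\<lambda>s. indicator {0..1} s *\<^sub>R (f' s)\<^sup>2)"
      by (intro i continuous_intros c)
    have 2: "integrable lborel (\<lambda>s. 2 * ?m * (indicator {0..1} s *\<^sub>R f' s))"
      by (intro integrable_mult_right i c)
    have 3: "integrable lborel (\<lambda>s::real. indicator {0..1} s *\<^sub>R ?m\<^sup>2)"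
      by (rule i) (rule continuous_on_const)
    show ?thesis
      by (subst Bochner_Integration.integral_add[OF Bochner_Integration.integrable_diff[OF 1 2] 3],
          subst Bochner_Integration.integral_diff[OF 1 2])
        (simp only: integral_mult_right_zero m, simp)
  qed
  finally show ?thesis by (simp add: power2_eq_square algebra_simps)
qed

text \<open>The squared increment is at most the integral of \<open>(g \<bullet> h)\<^sup>2\<close>
  along the segment from \<open>x\<close> to \<open>x + h\<close>. After exchanging the integrals
  every slice is a translate of the same integral.\<close>

lemma integral_translate_diff_power2:
  fixes z :: "'a::euclidean_space \<Rightarrow> real"
  assumes z: "has_grad z g" and supp: "bounded_support z"
  shows "(LINT x|lborel. (z (x + h) - z x)\<^sup>2) \<le> (norm h)\<^sup>2 * (LINT x|lborel. (norm (g x))\<^sup>2)"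
proof -
  obtain r where r: "\<And>x. norm x > r \<Longrightarrow> z x = 0" using supp by (auto simp: bounded_support_def)
  have gr: "g x = 0" if "norm x > r" for x by (rule has_grad_zero_outside[OF z r that])
  note cont = has_gradD(2,3)[OF z]
  define \<Theta> where "\<Theta> x s = (g (x + s *\<^sub>R h) \<bullet> h)\<^sup>2" for x and s :: real
  let ?\<Psi> = "\<lambda>x s. indicator {0..1} s * \<Theta> x s"
  have c\<Theta>: "continuous_on UNIV (\<lambda>(x, s). \<Theta> x s)"
    unfolding \<Theta>_def case_prod_beta
    by (intro continuous_intros continuous_on_compose2[OF cont(1)]) auto
  have out: "norm (x + s *\<^sub>R h) > r" if "norm x > r + norm h" "s \<in> {0..1}" for x s
  proof -
    have "norm (s *\<^sub>R h) \<le> norm h" using that(2) by (auto intro!: mult_left_le_one_le)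
    then show ?thesis using that(1) norm_triangle_ineq4[of "x + s *\<^sub>R h" "s *\<^sub>R h"] by simp
  qed
  have int: "integrable (lborel \<Otimes>\<^sub>M lborel) (\<lambda>(x, s). ?\<Psi> x s)"
  proof (rule lborel_pair_integrable_compact)
    show "compact (cball (0::'a) (r + norm h) \<times> {0..1::real})" by (intro compact_Times) auto
    show "continuous_on (cball (0::'a) (r + norm h) \<times> {0..1::real}) (\<lambda>(x, s). \<Theta> x s)"
      using c\<Theta> continuous_on_subset by blast
    fix y :: "'a \<times> real"
    show "(case y of (x, s) \<Rightarrow> ?\<Psi> x s) = 0" if "y \<notin> cball 0 (r + norm h) \<times> {0..1}"
    proof (cases "snd y \<in> {0..1}")
      case True
      then have "norm (fst y) > r + norm h" using that by (cases y) auto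
      then have "g (fst y + snd y *\<^sub>R h) = 0" using gr out[OF _ True] by blast
      then show ?thesis by (cases y) (simp add: \<Theta>_def)
    qed (cases y, simp)
    show "(case y of (x, s) \<Rightarrow> ?\<Psi> x s) = (case y of (x, s) \<Rightarrow> \<Theta> x s)" if "y \<in> cball 0 (r + norm h) \<times> {0..1}"
      using that by (cases y) (auto simp: indicator_def)
  qed
  have "(LINT x|lborel. (z (x + h) - z x)\<^sup>2) \<le> (LINT x|lborel. LINT s|lborel. ?\<Psi> x s)"
  proof (rule integral_mono)
    show "integrable lborel (\<lambda>x. (z (x + h) - z x)\<^sup>2)"
    proof (rule integrable_bounded_support)
      show "continuous_on UNIV (\<lambda>x. (z (x + h) - z x)\<^sup>2)"
        by (intro continuous_intros continuous_on_compose2[OF cont(2)]) auto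
      show "bounded_support (\<lambda>x. (z (x + h) - z x)\<^sup>2)"
      proof (rule bounded_supportI[of "r + norm h"])
        fix x :: 'a assume "norm x > r + norm h"
        moreover from this have "norm x > r" using norm_ge_zero[of h] by linarith
        ultimately show "(z (x + h) - z x)\<^sup>2 = 0" using out[of x 1] r by auto
      qed
    qed
    show "integrable lborel (\<lambda>x. LINT s|lborel. ?\<Psi> x s)"
      using lborel_pair.integrable_fst[OF int[simplified case_prod_beta]] by simp
    fix x
    have "(z (x + 1 *\<^sub>R h) - z (x + 0 *\<^sub>R h))\<^sup>2 \<le> (LINT s|lborel. indicator {0..1} s * (g (x + s *\<^sub>R h) \<bullet> h)\<^sup>2)"
    proof (rule power2_diff_le_integral[of "\<lambda>s. z (x + s *\<^sub>R h)"])
      show "((\<lambda>s. z (x + s *\<^sub>R h)) has_real_derivative g (x + s *\<^sub>R h) \<bullet> h) (at s)" for s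
      proof -
        have "((\<lambda>s. x + s *\<^sub>R h) has_derivative (\<lambda>t. t *\<^sub>R h)) (at s)"
          by (auto intro!: derivative_eq_intros)
        from has_derivative_compose[OF this has_gradD(1)[OF z]]
        show ?thesis by (auto simp: has_field_derivative_def mult.commute elim!: has_derivative_eq_rhs)
      qed
      show "continuous_on UNIV (\<lambda>s. g (x + s *\<^sub>R h) \<bullet> h)"
        by (intro continuous_intros continuous_on_compose2[OF cont(1)]) auto
    qed
    then show "(z (x + h) - z x)\<^sup>2 \<le> (LINT s|lborel. ?\<Psi> x s)" by (simp add: \<Theta>_def)
  qed
  also have "\<dots> = (LINT s|lborel. LINT x|lborel. ?\<Psi> x s)"
    using lborel_pair.Fubini_integral[of ?\<Psi>] int by simp
  also have "\<dots> = (LINT s::real|lborel. indicator {0..1} s * (LINT x|lborel. (g x \<bullet> h)\<^sup>2))"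
  proof (intro Bochner_Integration.integral_cong refl)
    fix s :: real
    have "(\<lambda>x. (g x \<bullet> h)\<^sup>2) \<in> borel_measurable borel"
      by (intro borel_measurable_continuous_onI continuous_intros cont)
    from lborel_integral_translate[OF this, of "s *\<^sub>R h"]
    show "(LINT x|lborel. ?\<Psi> x s) = indicator {0..1} s * (LINT x|lborel. (g x \<bullet> h)\<^sup>2)"
      by (simp add: \<Theta>_def add.commute)
  qed
  also have "\<dots> = (LINT x|lborel. (g x \<bullet> h)\<^sup>2)" by simp
  also have "\<dots> \<le> (LINT x|lborel. (norm h)\<^sup>2 * (norm (g x))\<^sup>2)"
  proof (rule integral_mono)
    have bg: "bounded_support g" by (rule bounded_supportI[OF gr])
    show "integrable lborel (\<lambda>x. (g x \<bullet> h)\<^sup>2)" "integrable lborel (\<lambda>x. (norm h)\<^sup>2 * (norm (g x))\<^sup>2)"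
      by (intro integrable_bounded_support continuous_intros cont bounded_support_subset[OF bg]; simp)+
    show "(g x \<bullet> h)\<^sup>2 \<le> (norm h)\<^sup>2 * (norm (g x))\<^sup>2" for x
      using power_mono[OF Cauchy_Schwarz_ineq2[of "g x" h] abs_ge_zero, of 2]
      by (simp add: power_mult_distrib mult.commute)
  qed
  finally show ?thesis by simp
qed

text \<open>Since \<open>z\<close> vanishes where \<open>\<omega>\<close> does not, \<open>z(x)\<^sup>2 \<omega>(y) \<le> (z(x) - z(y))\<^sup>2\<close>; this replaces
  a condition on the measure of the zero set of \<open>z\<close> by one on averages of \<open>\<omega>\<close>.\<close>

lemma poincare_vanishing:
  fixes z \<omega> :: "'a::euclidean_space \<Rightarrow> real"
  assumes z: "has_grad z g" and supp: "bounded_support z" and R: "R > 0"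
    and \<omega>: "continuous_on UNIV \<omega>" "\<And>x. 0 \<le> \<omega> x" "\<And>x. \<omega> x \<le> 1" "\<And>x. z x * \<omega> x = 0"
    and avg: "\<And>x. (LINT y|lborel. \<omega> y * xi x R y) \<ge> 1/2 * (LINT y|lborel. xi x R y)"
  shows "(LINT x|lborel. (z x)\<^sup>2) \<le> 2 * R\<^sup>2 * (LINT x|lborel. (norm (g x))\<^sup>2)"
proof -
  obtain r where r: "\<And>x. norm x > r \<Longrightarrow> z x = 0" using supp by (auto simp: bounded_support_def)
  note cont = has_gradD(2,3)[OF z]
  let ?k = "xi (0::'a) R"
  define c where "c = (LINT h|lborel. ?k h)"
  have c0: "c > 0" unfolding c_def integral_xi[OF R] using integral_xi_pos R by (intro mult_pos_pos) auto
  \<comment> \<open>The double integral of \<open>\<Psi>\<close> is evaluated in both orders: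
    integrating over \<open>h\<close> first, \<open>avg\<close> bounds it below by
    \<open>c / 2\<close> times \<open>(z x)\<^sup>2\<close>; integrating over \<open>x\<close>
    first, each slice is bounded by the increment of \<open>z\<close> under the translation by
    \<open>h\<close>.\<close>
  define \<Psi> where "\<Psi> x h = (z x)\<^sup>2 * \<omega> (x + h) * ?k h" for x h
  define \<Theta> where "\<Theta> x h = (z (x + h) - z x)\<^sup>2" for x h
  have xt: "xi x R (x + h) = ?k h" for x h by (simp add: xi_def bump_translate)
  have k0: "?k h = 0" if "norm h > R" for h using that R by (intro xi_eq_0) auto
  have "continuous_on UNIV (\<lambda>(x, h). \<Psi> x h)"
    unfolding \<Psi>_def case_prod_beta
    by (intro continuous_intros continuous_on_compose2[OF cont(2)] continuous_on_compose2[OF \<omega>(1)]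
        continuous_on_compose2[OF continuous_on_xi(1)[of UNIV 0 R]]) auto
  moreover have r': "norm x \<le> r \<or> z x = 0" and k': "norm h \<le> R \<or> ?k h = 0" for x h
    using r k0 not_le by blast+
  ultimately have "continuous_on (cball 0 r \<times> cball 0 R) (\<lambda>(x, h). \<Psi> x h)"
    using continuous_on_subset by blast
  then have int: "integrable (lborel \<Otimes>\<^sub>M lborel) (\<lambda>(x, h). \<Psi> x h)"
  proof (rule lborel_pair_integrable_compact[of "cball 0 r \<times> cball 0 R", rotated])
    fix y :: "'a \<times> 'a" assume "y \<notin> cball 0 r \<times> cball 0 R"
    then show "(case y of (x, h) \<Rightarrow> \<Psi> x h) = 0"
      using r'[of "fst y"] k'[of "snd y"] by (cases y) (auto simp: \<Psi>_def)
  qed (auto intro!: compact_Times)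
  have E0: "0 \<le> (LINT x|lborel. (norm (g x))\<^sup>2)" by (intro integral_nonneg_AE) auto
  have z2: "integrable lborel (\<lambda>x. (z x)\<^sup>2)"
    by (intro integrable_bounded_support continuous_intros cont) (rule bounded_support_subset[OF supp], simp)
  have "c / 2 * (LINT x|lborel. (z x)\<^sup>2) = (LINT x|lborel. (c / 2) * (z x)\<^sup>2)" by simp
  also have "\<dots> \<le> (LINT x|lborel. LINT h|lborel. \<Psi> x h)"
  proof (rule integral_mono)
    show "integrable lborel (\<lambda>x. (c / 2) * (z x)\<^sup>2)" using z2 by auto
    show "integrable lborel (\<lambda>x. LINT h|lborel. \<Psi> x h)"
      using lborel_pair.integrable_fst[OF int[simplified case_prod_beta]] by simp
    fix x
    have "(\<lambda>y. \<omega> y * xi x R y) \<in> borel_measurable borel"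
      by (intro borel_measurable_continuous_onI continuous_intros \<omega>)
    then have "(LINT h|lborel. \<omega> (x + h) * ?k h) = (LINT y|lborel. \<omega> y * xi x R y)"
      using lborel_integral_translate[of "\<lambda>y. \<omega> y * xi x R y" x] by (simp add: xt)
    moreover have "(LINT y|lborel. xi x R y) = c"
      unfolding c_def using integral_xi[OF R, of x] integral_xi[OF R, of "0::'a"] by simp
    ultimately have "c / 2 \<le> (LINT h|lborel. \<omega> (x + h) * ?k h)" using avg[of x] by simp
    then have "(z x)\<^sup>2 * (c / 2) \<le> (z x)\<^sup>2 * (LINT h|lborel. \<omega> (x + h) * ?k h)"
      by (intro mult_left_mono) auto
    also have "\<dots> = (LINT h|lborel. \<Psi> x h)"
      unfolding \<Psi>_def by (simp only: mult.assoc integral_mult_right_zero)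
    finally show "(c / 2) * (z x)\<^sup>2 \<le> (LINT h|lborel. \<Psi> x h)"
      by (simp add: mult.commute)
  qed
  also have "\<dots> = (LINT h|lborel. LINT x|lborel. \<Psi> x h)"
    using lborel_pair.Fubini_integral[of \<Psi>] int by simp
  also have "\<dots> \<le> (LINT h|lborel. (R\<^sup>2 * (LINT x|lborel. (norm (g x))\<^sup>2)) * ?k h)"
  proof (rule integral_mono)
    show "integrable lborel (\<lambda>h. LINT x|lborel. \<Psi> x h)"
      using lborel_pair.integrable_snd[OF int] by simp
    show "integrable lborel (\<lambda>h. (R\<^sup>2 * (LINT x|lborel. (norm (g x))\<^sup>2)) * ?k h)"
      by (rule integrable_xi[OF R continuous_on_const])
    fix h
    show "(LINT x|lborel. \<Psi> x h) \<le> (R\<^sup>2 * (LINT x|lborel. (norm (g x))\<^sup>2)) * ?k h"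
    proof (cases "norm h > R")
      case True
      then show ?thesis using k0 by (simp add: \<Psi>_def)
    next
      case False
      have s: "bounded_support (\<lambda>x. (z (x + h) - z x)\<^sup>2)"
      proof (rule bounded_supportI[of "r + norm h"])
        fix x :: 'a assume x: "norm x > r + norm h"
        then have "norm (x + h) > r" "norm x > r"
          using norm_triangle_ineq4[of "x + h" h] norm_ge_zero[of h]
          by (simp, linarith)
        then show "(z (x + h) - z x)\<^sup>2 = 0" using r by auto
      qed
      have i: "integrable lborel (\<lambda>x. ?k h * (z (x + h) - z x)\<^sup>2)"
        by (intro integrable_mult_right integrable_bounded_support s continuous_intros
            continuous_on_compose2[OF cont(2)]) auto
      have "(LINT x|lborel. \<Psi> x h) \<le> (LINT x|lborel. ?k h * (z (x + h) - z x)\<^sup>2)"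
      proof (rule integral_mono[OF _ i])
        show "integrable lborel (\<lambda>x. \<Psi> x h)"
          unfolding \<Psi>_def
          by (intro integrable_bounded_support continuous_intros cont
              continuous_on_compose2[OF \<omega>(1)] bounded_support_subset[OF supp]) auto
        fix x
        have "(z x)\<^sup>2 * \<omega> (x + h) \<le> (z (x + h) - z x)\<^sup>2"
        proof (cases "\<omega> (x + h) = 0")
          case False
          then have "z (x + h) = 0" using \<omega>(4)[of "x + h"] by simp
          then show ?thesis using mult_left_le[OF \<omega>(3), of "(z x)\<^sup>2"] by simp
        qed simp
        from mult_right_mono[OF this xi_bounds(1)[of 0 R h]]
        show "\<Psi> x h \<le> ?k h * (z (x + h) - z x)\<^sup>2"
          unfolding \<Psi>_def by (simp add: mult.commute)
      qed
      also have "\<dots> = ?k h * (LINT x|lborel. (z (x + h) - z x)\<^sup>2)" by simp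
      also have "\<dots> \<le> ?k h * ((norm h)\<^sup>2 * (LINT x|lborel. (norm (g x))\<^sup>2))"
        by (intro mult_left_mono integral_translate_diff_power2[OF z supp] xi_bounds)
      also have "\<dots> \<le> ?k h * (R\<^sup>2 * (LINT x|lborel. (norm (g x))\<^sup>2))"
        using False by (intro mult_left_mono mult_right_mono power_mono E0 xi_bounds) auto
      finally show ?thesis by (simp add: mult.commute)
    qed
  qed
  also have "\<dots> = c * (R\<^sup>2 * (LINT x|lborel. (norm (g x))\<^sup>2))" by (simp add: c_def)
  finally have "c * ((LINT x|lborel. (z x)\<^sup>2) / 2) \<le> c * (R\<^sup>2 * (LINT x|lborel. (norm (g x))\<^sup>2))"
    by simp
  then have "(LINT x|lborel. (z x)\<^sup>2) / 2 \<le> R\<^sup>2 * (LINT x|lborel. (norm (g x))\<^sup>2)"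
    using c0 mult_le_cancel_left_pos by blast
  then show ?thesis by simp
qed

section \<open>Bounded superharmonic functions\<close>

abbreviation lap_const :: "'a::euclidean_space itself \<Rightarrow> real" where
  "lap_const _ \<equiv> 72 * real DIM('a) + 720"

lemma integral_grad_inner_grad_xi:
  assumes v: "has_grad v g" and R: "R > 0"
  shows "(LINT x|lborel. g x \<bullet> grad_xi p R x) = - (LINT x|lborel. v x * lap_xi p R x)"
proof -
  note cont = has_gradD(2,3)[OF v]
  have i: "integrable lborel (\<lambda>x. v x * lap_xi p R x)"
    by (intro integrable_bounded_support continuous_intros cont
        bounded_support_subset[OF bounded_support_xi(3)[OF R, of p]]) auto
  have j: "integrable lborel (\<lambda>x. g x \<bullet> grad_xi p R x)"
    by (intro integrable_bounded_support continuous_intros cont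
        bounded_support_subset[OF bounded_support_xi(2)[OF R, of p]]) auto
  have "bounded_support (\<lambda>x. v x *\<^sub>R grad_xi p R x)"
    by (rule bounded_support_subset[OF bounded_support_xi(2)[OF R, of p]]) auto
  from green(1)[OF v has_div_grad_xi this]
  show ?thesis using Bochner_Integration.integral_add[OF i j] by simp
qed

lemma integral_mult_lap_xi_le:
  fixes v :: "'a::euclidean_space \<Rightarrow> real"
  assumes v: "continuous_on UNIV v" and w: "continuous_on UNIV w" "\<And>x. \<bar>v x\<bar> \<le> w x" and R: "R > 0"
  shows "\<bar>LINT x|lborel. v x * lap_xi p R x\<bar>
    \<le> lap_const TYPE('a) / R\<^sup>2 * (LINT x|lborel. w x * xi p (2 * R) x)"
proof -
  have "\<bar>LINT x|lborel. v x * lap_xi p R x\<bar> \<le> (LINT x|lborel. \<bar>v x * lap_xi p R x\<bar>)"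
    by (rule integral_abs_bound)
  also have "\<dots> \<le> (LINT x|lborel. lap_const TYPE('a) / R\<^sup>2 * (w x * xi p (2 * R) x))"
  proof (rule integral_mono)
    show "integrable lborel (\<lambda>x. \<bar>v x * lap_xi p R x\<bar>)"
      by (intro integrable_abs integrable_bounded_support continuous_intros v
          bounded_support_subset[OF bounded_support_xi(3)[OF R, of p]]) auto
    show "integrable lborel (\<lambda>x. lap_const TYPE('a) / R\<^sup>2 * (w x * xi p (2 * R) x))"
      using R by (intro integrable_mult_right integrable_xi w) auto
    show "\<bar>v x * lap_xi p R x\<bar> \<le> lap_const TYPE('a) / R\<^sup>2 * (w x * xi p (2 * R) x)" for x
    proof -
      have "\<bar>v x\<bar> * \<bar>lap_xi p R x\<bar> \<le> w x * (lap_const TYPE('a) / R\<^sup>2 * xi p (2 * R) x)"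
        by (intro mult_mono w lap_xi_bound R order_trans[OF abs_ge_zero w(2)]) auto
      then show ?thesis by (simp add: abs_mult mult_ac)
    qed
  qed
  finally show ?thesis by simp
qed

text \<open>The zero set is closed and has full measure, hence is the whole space.\<close>

lemma continuous_integral_eq_0:
  fixes g :: "'a::euclidean_space \<Rightarrow> real"
  assumes "continuous_on UNIV g" "bounded_support g" "\<And>x. 0 \<le> g x" "(LINT x|lborel. g x) \<le> 0"
  shows "g x = 0"
proof -
  have "(LINT x|lborel. g x) = 0"
    using assms(3,4) by (intro antisym integral_nonneg_AE) auto
  then have "AE x in lborel. g x = 0"
    using integral_nonneg_eq_0_iff_AE[OF integrable_bounded_support[OF assms(1,2)]] assms(3) by simp
  then have "AE x in lebesgue. x \<in> {x. g x = 0}"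
    by (simp add: AE_completion)
  moreover have "closed {x. g x = 0}"
    by (intro closed_Collect_eq assms(1) continuous_intros)
  ultimately show ?thesis using mem_closed_if_AE_lebesgue by blast
qed

text \<open>The source is a function \<open>fu\<close> of the point and not of the value of
  \<open>u\<close>, so that the locale is stable under subtraction of constants, see
  \<open>minus_const\<close>.\<close>

locale bounded_superharmonic =
  fixes u :: "'a::euclidean_space \<Rightarrow> real" and gu :: "'a \<Rightarrow> 'a" and fu :: "'a \<Rightarrow> real" and M :: real
  assumes grad_u: "has_grad u gu" and div_gu: "has_div gu (\<lambda>x. - fu x)"
    and fu_nonneg: "\<And>x. 0 \<le> fu x" and u_nonneg: "\<And>x. 0 \<le> u x" and u_le: "\<And>x. u x \<le> M"
begin

lemma cont_u: "continuous_on UNIV u" and cont_gu: "continuous_on UNIV gu"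
  and cont_fu: "continuous_on UNIV fu"
  using has_gradD[OF grad_u] continuous_on_minus[OF has_divD(2)[OF div_gu]] by auto

lemma weak_equation:
  assumes "has_grad \<phi> g" "bounded_support \<phi>"
  shows "(LINT x|lborel. fu x * \<phi> x) = (LINT x|lborel. gu x \<bullet> g x)"
proof -
  note cont = has_gradD(2,3)[OF assms(1)]
  have i: "integrable lborel (\<lambda>x. fu x * \<phi> x)"
    by (intro integrable_bounded_support continuous_intros cont cont_fu
        bounded_support_subset[OF assms(2)]) auto
  have j: "integrable lborel (\<lambda>x. gu x \<bullet> g x)"
    by (intro integrable_bounded_support continuous_intros cont cont_gu
        bounded_support_subset[OF bounded_support_grad[OF assms]]) auto
  have "bounded_support (\<lambda>x. \<phi> x *\<^sub>R gu x)" by (rule bounded_support_subset[OF assms(2)]) auto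
  from green(1)[OF assms(1) div_gu this]
  have "(LINT x|lborel. gu x \<bullet> g x - fu x * \<phi> x) = 0" by (simp add: inner_commute algebra_simps)
  then show ?thesis using Bochner_Integration.integral_diff[OF j i] by simp
qed

text \<open>A shift of \<open>u\<close> by a constant leaves the gradient unchanged, so
  \<open>m\<close> is free. Taking it to be the infimum of \<open>u\<close> is what produces the
  decay of the energy.\<close>

lemma integral_fu_xi:
  assumes "R > 0"
  shows "(LINT x|lborel. fu x * xi p R x) = - (LINT x|lborel. (u x - m) * lap_xi p R x)"
proof -
  have "has_grad (\<lambda>x. u x - m) (\<lambda>x. gu x - 0)" by (rule has_grad_diff[OF grad_u has_grad_const])
  then have "has_grad (\<lambda>x. u x - m) gu" by simp
  from integral_grad_inner_grad_xi[OF this assms]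
  show ?thesis using weak_equation[OF has_grad_xi bounded_support_xi(1)[OF assms]] by simp
qed

lemma integral_fu_xi_le:
  assumes "R > 0" "\<And>x. m \<le> u x"
  shows "(LINT x|lborel. fu x * xi p R x)
    \<le> lap_const TYPE('a) / R\<^sup>2 * (LINT x|lborel. (u x - m) * xi p (2 * R) x)"
proof -
  have c: "continuous_on UNIV (\<lambda>x. u x - m)" by (intro continuous_intros cont_u)
  have "\<bar>LINT x|lborel. (u x - m) * lap_xi p R x\<bar>
    \<le> lap_const TYPE('a) / R\<^sup>2 * (LINT x|lborel. (u x - m) * xi p (2 * R) x)"
    by (rule integral_mult_lap_xi_le[OF c c _ assms(1)]) (use assms(2) in simp)
  then show ?thesis unfolding integral_fu_xi[OF assms(1), of p m] by linarith
qed

text \<open>The weighted average over the ball of radius \<open>s\<close> is nonincreasing in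
  \<open>s\<close>; it is compared at \<open>s = R\<close> and at \<open>s = 0\<close>, where it is
  a multiple of \<open>u p\<close>.\<close>

lemma mean_value:
  assumes R: "R > 0"
  shows "(LINT x|lborel. u x * xi p R x) \<le> u p * (R ^ DIM('a) * (LINT x|lborel. xi (0::'a) 1 x))"
proof -
  let ?k = "xi (0::'a) 1"
  define A where "A s = (LINT x|lborel. u (p + s *\<^sub>R x) * ?k x)" for s
  define A' where "A' s = (LINT x|lborel. (gu (p + s *\<^sub>R x) \<bullet> x) * ?k x)" for s
  \<comment> \<open>The interval exceeds \<open>{0..R}\<close> on both sides, so that the derivative
    is two-sided at both ends.\<close>
  have "(A has_real_derivative A' s) (at s)" if "s \<in> {-1<..<R+1}" for s
    unfolding A_def A'_def
  proof (rule has_real_derivative_lborel_integral[OF _ _ _ _ that])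
    fix s x
    have "((\<lambda>s. p + s *\<^sub>R x) has_derivative (\<lambda>t. t *\<^sub>R x)) (at s)"
      by (auto intro!: derivative_eq_intros)
    from has_derivative_compose[OF this has_gradD(1)[OF grad_u]]
    have "((\<lambda>s. u (p + s *\<^sub>R x)) has_real_derivative (gu (p + s *\<^sub>R x) \<bullet> x)) (at s)"
      by (auto simp: has_field_derivative_def mult.commute elim!: has_derivative_eq_rhs)
    then show "((\<lambda>s. u (p + s *\<^sub>R x) * ?k x) has_real_derivative (gu (p + s *\<^sub>R x) \<bullet> x) * ?k x) (at s)"
      by (rule DERIV_cmult_right)
  next
    show "continuous_on UNIV (\<lambda>x. u (p + s *\<^sub>R x) * ?k x)" for s
      by (intro continuous_intros continuous_on_compose2[OF cont_u]) auto
    show "continuous_on ({-1..R+1} \<times> UNIV) (\<lambda>(s, x). (gu (p + s *\<^sub>R x) \<bullet> x) * ?k x)"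
      unfolding case_prod_beta
      by (intro continuous_intros continuous_on_compose2[OF cont_gu]
          continuous_on_compose2[OF continuous_on_xi(1)[of UNIV 0 1]]) auto
    show "u (p + s *\<^sub>R x) * ?k x = 0" if "norm x > 1" for s x
      using that xi_eq_0[of 1 x 0] by simp
  qed
  moreover have "A' s \<le> 0" if "s \<ge> 0" for s
  proof -
    \<comment> \<open>The field \<open>?k x *\<^sub>R x\<close> is, up to the factor
      \<open>- 14\<close>, the gradient of the seventh power of \<open>bump\<close>. Green's formula
      therefore turns \<open>A'\<close> into an integral of \<open>- fu\<close> against a
      nonnegative function.\<close>
    let ?h = "\<lambda>x. bump (0::'a) 1 x ^ 7"
    have h: "has_grad ?h (\<lambda>x. (- 14 * ?k x) *\<^sub>R x)"
      using has_grad_bump_power[of 6 "0::'a" 1] by (simp add: xi_def)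
    obtain H where H: "\<And>x. (gu has_derivative H x) (at x)"
      "\<And>b. b \<in> Basis \<Longrightarrow> continuous_on UNIV (\<lambda>x. H x b)" "\<And>x. - fu x = (\<Sum>b\<in>Basis. H x b \<bullet> b)"
      using div_gu by (auto simp: has_div_def)
    have W: "has_div (\<lambda>x. gu (p + s *\<^sub>R x)) (\<lambda>x. s * - fu (p + s *\<^sub>R x))"
      unfolding has_div_def
    proof (intro exI conjI allI ballI)
      show "((\<lambda>x. gu (p + s *\<^sub>R x)) has_derivative (\<lambda>h. H (p + s *\<^sub>R x) (s *\<^sub>R h))) (at x)" for x
        by (rule has_derivative_compose[OF _ H(1), of "\<lambda>x. p + s *\<^sub>R x"])
          (auto intro!: derivative_eq_intros)
      have l: "H y (s *\<^sub>R b) = s *\<^sub>R H y b" for y b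
        using has_derivative_linear[OF H(1)] linear_scale by blast
      show "continuous_on UNIV (\<lambda>x. H (p + s *\<^sub>R x) (s *\<^sub>R b))" if "b \<in> Basis" for b
        unfolding l by (intro continuous_intros continuous_on_compose2[OF H(2)[OF that]]) auto
      show "s * - fu (p + s *\<^sub>R x) = (\<Sum>b\<in>Basis. H (p + s *\<^sub>R x) (s *\<^sub>R b) \<bullet> b)" for x
        unfolding l H(3) by (simp add: sum_distrib_left)
    qed
    have sh: "bounded_support ?h" by (rule bounded_support_bump[of 1 0]) auto
    have sW: "bounded_support (\<lambda>x. ?h x *\<^sub>R gu (p + s *\<^sub>R x))"
      by (rule bounded_support_subset[OF sh]) auto
    have c: "continuous_on UNIV (\<lambda>x. gu (p + s *\<^sub>R x))" "continuous_on UNIV (\<lambda>x. fu (p + s *\<^sub>R x))"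
      by (intro continuous_on_compose2[OF cont_gu] continuous_on_compose2[OF cont_fu] continuous_intros; simp)+
    have i: "integrable lborel (\<lambda>x. ?h x * (s * fu (p + s *\<^sub>R x)))"
      by (intro integrable_bounded_support continuous_intros continuous_on_bump c
          bounded_support_subset[OF sh]) auto
    have j: "integrable lborel (\<lambda>x. 14 * ((gu (p + s *\<^sub>R x) \<bullet> x) * ?k x))"
      by (intro integrable_mult_right integrable_xi continuous_intros c) auto
    have "0 = (LINT x|lborel. - (?h x * (s * fu (p + s *\<^sub>R x))) - 14 * ((gu (p + s *\<^sub>R x) \<bullet> x) * ?k x))"
      using green(1)[OF h W sW] by (simp add: inner_commute mult_ac)
    also have "\<dots> = - (LINT x|lborel. ?h x * (s * fu (p + s *\<^sub>R x))) - 14 * A' s"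
      unfolding A'_def using i j by simp
    finally have "14 * A' s = - (LINT x|lborel. ?h x * (s * fu (p + s *\<^sub>R x)))" by simp
    moreover have "0 \<le> (LINT x|lborel. ?h x * (s * fu (p + s *\<^sub>R x)))"
      using that by (intro integral_nonneg_AE AE_I2 mult_nonneg_nonneg bump_pow_bounds fu_nonneg) auto
    ultimately show ?thesis by simp
  qed
  ultimately have "\<exists>y. (A has_real_derivative y) (at s) \<and> y \<le> 0" if "0 \<le> s" "s \<le> R" for s
    using that by (intro exI[of _ "A' s"]) auto
  then have "A R \<le> A 0"
    using R by (intro DERIV_nonpos_imp_nonincreasing[of 0 R A]) auto
  moreover have "R ^ DIM('a) * A R = (LINT x|lborel. u x * xi p R x)"
    using lborel_integral_scale[of "\<lambda>x. u x * xi p R x" R p] R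
    by (simp add: A_def xi_def bump_scale borel_measurable_continuous_onI continuous_intros cont_u continuous_on_bump)
  moreover have "A 0 = u p * (LINT x|lborel. ?k x)" by (simp add: A_def)
  ultimately show ?thesis
    using mult_left_mono[of "A R" "A 0" "R ^ DIM('a)"] R by (simp add: mult_ac)
qed

lemma bdd_below_u: "bdd_below (range u)"
  using u_nonneg by (intro bdd_belowI2[of UNIV 0])

lemma minus_const: "m \<le> Inf (range u) \<Longrightarrow> bounded_superharmonic (\<lambda>x. u x - m) gu fu (M - m)"
proof
  assume m: "m \<le> Inf (range u)"
  show "has_grad (\<lambda>x. u x - m) gu"
    using has_grad_diff[OF grad_u has_grad_const[of m]] by simp
  show "0 \<le> u x - m" for x using m cInf_lower[OF rangeI bdd_below_u, of x] by simp
qed (use div_gu fu_nonneg u_le in auto)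

text \<open>Strong maximum principle: around a zero \<open>p\<close> the average of the nonnegative
  function \<open>u\<close> is at most 0, on balls of any size.\<close>

lemma positive_or_zero:
  assumes "u p = 0"
  shows "u x = 0"
proof (rule ccontr)
  assume "u x \<noteq> 0"
  define R where "R = norm (x - p) + 1"
  have R: "R > 0" "norm (x - p) < R" unfolding R_def by (auto intro: add_nonneg_pos)
  have "u x * xi p R x = 0"
  proof (rule continuous_integral_eq_0[of "\<lambda>y. u y * xi p R y"])
    show "(LINT y|lborel. u y * xi p R y) \<le> 0" using mean_value[OF R(1), of p] assms by simp
    show "bounded_support (\<lambda>y. u y * xi p R y)"
      by (rule bounded_support_subset[OF bounded_support_xi(1)[OF R(1), of p]]) simp
    show "0 \<le> u y * xi p R y" for y by (intro mult_nonneg_nonneg u_nonneg xi_bounds)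
  qed (intro continuous_intros cont_u)
  moreover have "xi p R x > 0"
  proof -
    have "(norm (x - p))\<^sup>2 < R\<^sup>2" using R(2) by (intro power_strict_mono) auto
    then have "bump p R x > 0" using R(1) by (simp add: bump_def divide_simps)
    then show ?thesis by (simp add: xi_def)
  qed
  ultimately show False using \<open>u x \<noteq> 0\<close> by simp
qed

text \<open>Pick \<open>p\<close> where \<open>u\<close> almost attains its infimum. By the mean
  value inequality the averages around \<open>p\<close> are no larger than \<open>u p\<close>, and
  for large \<open>R\<close> the ball around 0 lies well inside the ball of radius
  \<open>2 * R\<close> around \<open>p\<close>.\<close>

lemma average_tendsto_Inf:
  assumes "\<epsilon> > 0"
  shows "\<exists>R0>0. \<forall>R\<ge>R0. (LINT x|lborel. (u x - Inf (range u)) * xi 0 R x) \<le> \<epsilon> * R ^ DIM('a)"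
proof -
  define m where "m = Inf (range u)"
  interpret v: bounded_superharmonic "\<lambda>x. u x - m" gu fu "M - m"
    by (rule minus_const) (simp add: m_def)
  define c where "c = (LINT x|lborel. xi (0::'a) 1 x)"
  have c: "c > 0" unfolding c_def by (rule integral_xi_pos)
  define \<delta> where "\<delta> = \<epsilon> / (150 * 2 ^ DIM('a) * c)"
  have "\<delta> > 0" using assms c by (simp add: \<delta>_def)
  then obtain p where p: "u p < m + \<delta>"
    using cInf_lessD[of "range u" "m + \<delta>"] by (auto simp: m_def)
  have "(LINT x|lborel. (u x - m) * xi 0 R x) \<le> \<epsilon> * R ^ DIM('a)" if R: "R \<ge> 2 * norm p + 1" for R
  proof -
    have R0: "R > 0" using R norm_ge_zero[of p] by linarith
    \<comment> \<open>With \<open>norm p \<le> R / 2\<close> the ball of radius \<open>R\<close>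
      around 0 stays within \<open>3/4\<close> of the radius \<open>2 * R\<close> around
      \<open>p\<close>; there \<open>bump\<close> is at least \<open>7/16\<close>, and
      \<open>(16/7)^6 < 150\<close>.\<close>
    have le: "xi 0 R x \<le> 150 * xi p (2 * R) x" for x
    proof (cases "norm x \<le> R")
      case True
      then have "norm (x - p) \<le> (3/4) * (2 * R)"
        using norm_triangle_ineq4[of x p] R by linarith
      then have "1 - (3/4)\<^sup>2 \<le> bump p (2 * R) x" using R0 by (intro bump_ge) auto
      then have "(7/16) ^ 6 \<le> bump p (2 * R) x ^ 6" by (intro power_mono) (auto simp: power2_eq_square)
      then have "1 \<le> 150 * xi p (2 * R) x" by (simp add: xi_def power_divide)
      then show ?thesis using xi_bounds(2)[of 0 R x] by linarith
    qed (use R0 in \<open>simp add: xi_eq_0 xi_bounds\<close>)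
    have "(LINT x|lborel. (u x - m) * xi 0 R x) \<le> (LINT x|lborel. 150 * ((u x - m) * xi p (2 * R) x))"
    proof (rule integral_mono)
      show "(u x - m) * xi 0 R x \<le> 150 * ((u x - m) * xi p (2 * R) x)" for x
        using mult_left_mono[OF le v.u_nonneg[of x]] by (simp add: mult_ac)
    qed (use R0 in \<open>auto intro!: integrable_mult_right integrable_xi v.cont_u\<close>)
    also have "\<dots> = 150 * (LINT x|lborel. (u x - m) * xi p (2 * R) x)" by simp
    also have "\<dots> \<le> 150 * ((u p - m) * ((2 * R) ^ DIM('a) * c))"
      unfolding c_def using R0 by (intro mult_left_mono v.mean_value) auto
    also have "\<dots> \<le> 150 * (\<delta> * ((2 * R) ^ DIM('a) * c))"
      using R0 c p by (intro mult_left_mono mult_right_mono) auto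
    also have "\<dots> = \<epsilon> * R ^ DIM('a)" using c by (simp add: \<delta>_def power_mult_distrib)
    finally show ?thesis .
  qed
  then show ?thesis
    unfolding m_def[symmetric]
    by (intro exI[of _ "2 * norm p + 1"] conjI allI impI) (auto intro: add_nonneg_pos)
qed

text \<open>Test the equation with \<open>(u - m) xi\<close>. The cross term pairs the gradient of
  \<open>(u - m)\<^sup>2 / 2\<close> with \<open>grad_xi\<close> and so moves to
  \<open>lap_xi\<close>. The source contributes the factor \<open>M\<close>, the cross term
  \<open>M / 2\<close>.\<close>

lemma energy_le:
  assumes R: "R > 0" and m: "0 \<le> m" "\<And>x. m \<le> u x"
  shows "(LINT x|lborel. (norm (gu x))\<^sup>2 * xi p R x)
    \<le> 3/2 * M * (lap_const TYPE('a) / R\<^sup>2 * (LINT x|lborel. (u x - m) * xi p (2 * R) x))"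
proof -
  define v where "v x = u x - m" for x
  have v: "has_grad v gu" using has_grad_diff[OF grad_u has_grad_const[of m]] by (simp add: v_def[abs_def])
  note cont = cont_gu cont_fu has_gradD(3)[OF v]
  have vb: "0 \<le> v x" "v x \<le> M" for x using m u_le[of x] by (auto simp: v_def intro: order_trans)
  have M: "0 \<le> M" using vb[of 0] by simp
  have v2: "has_grad (\<lambda>x. (v x)\<^sup>2 / 2) (\<lambda>x. v x *\<^sub>R gu x)"
    by (rule has_grad_compose[OF v, of "\<lambda>s. s\<^sup>2 / 2" "\<lambda>s. s"]) (auto intro!: derivative_eq_intros continuous_intros)
  have sx: "bounded_support (\<lambda>x. v x * xi p R x)"
    by (rule bounded_support_subset[OF bounded_support_xi(1)[OF R, of p]]) simp
  have i1: "integrable lborel (\<lambda>x. (norm (gu x))\<^sup>2 * xi p R x)"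
    by (intro integrable_xi R continuous_intros cont)
  have i2: "integrable lborel (\<lambda>x. (v x *\<^sub>R gu x) \<bullet> grad_xi p R x)"
    by (intro integrable_bounded_support continuous_intros cont
        bounded_support_subset[OF bounded_support_xi(2)[OF R, of p]]) auto
  have "(LINT x|lborel. fu x * (v x * xi p R x))
      = (LINT x|lborel. (norm (gu x))\<^sup>2 * xi p R x + (v x *\<^sub>R gu x) \<bullet> grad_xi p R x)"
    unfolding weak_equation[OF has_grad_mult[OF v has_grad_xi] sx]
    by (simp add: power2_norm_eq_inner algebra_simps)
  also have "\<dots> = (LINT x|lborel. (norm (gu x))\<^sup>2 * xi p R x) + (LINT x|lborel. (v x *\<^sub>R gu x) \<bullet> grad_xi p R x)"
    by (rule Bochner_Integration.integral_add[OF i1 i2])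
  finally have "(LINT x|lborel. (norm (gu x))\<^sup>2 * xi p R x)
      = (LINT x|lborel. fu x * (v x * xi p R x)) + (LINT x|lborel. (v x)\<^sup>2 / 2 * lap_xi p R x)"
    using integral_grad_inner_grad_xi[OF v2 R, of p] by simp
  also have "(LINT x|lborel. fu x * (v x * xi p R x)) \<le> (LINT x|lborel. M * (fu x * xi p R x))"
  proof (rule integral_mono)
    show "fu x * (v x * xi p R x) \<le> M * (fu x * xi p R x)" for x
      using mult_right_mono[OF vb(2)[of x], of "fu x * xi p R x"] fu_nonneg[of x] xi_bounds(1)[of p R x]
      by (simp add: mult_ac)
    show "integrable lborel (\<lambda>x. fu x * (v x * xi p R x))"
      by (intro integrable_bounded_support continuous_intros cont bounded_support_subset[OF sx]) auto
    show "integrable lborel (\<lambda>x. M * (fu x * xi p R x))"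
      by (intro integrable_mult_right integrable_xi R cont)
  qed
  also have "(LINT x|lborel. M * (fu x * xi p R x))
      \<le> M * (lap_const TYPE('a) / R\<^sup>2 * (LINT x|lborel. v x * xi p (2 * R) x))"
    unfolding v_def using mult_left_mono[OF integral_fu_xi_le[OF R m(2), of p] M] by simp
  also have "(LINT x|lborel. (v x)\<^sup>2 / 2 * lap_xi p R x)
      \<le> lap_const TYPE('a) / R\<^sup>2 * (LINT x|lborel. (M / 2 * v x) * xi p (2 * R) x)"
  proof (rule order_trans[OF abs_ge_self integral_mult_lap_xi_le])
    show "\<bar>(v x)\<^sup>2 / 2\<bar> \<le> M / 2 * v x" for x
      using mult_right_mono[OF vb(2)[of x] vb(1)[of x]] by (simp add: power2_eq_square)
  qed (auto intro!: continuous_intros cont R)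
  also have "(LINT x|lborel. (M / 2 * v x) * xi p (2 * R) x) = M / 2 * (LINT x|lborel. v x * xi p (2 * R) x)"
    by (simp add: mult.assoc)
  finally show ?thesis by (simp add: v_def algebra_simps)
qed

lemma energy_decay:
  assumes "\<epsilon> > 0"
  shows "\<exists>R0>0. \<forall>R\<ge>R0. (LINT x|lborel. (norm (gu x))\<^sup>2 * xi 0 R x) \<le> \<epsilon> * R ^ DIM('a) / R\<^sup>2"
proof -
  let ?m = "Inf (range u)"
  define K where "K = 3/2 * M * lap_const TYPE('a) * 2 ^ DIM('a)"
  have m: "0 \<le> ?m" "?m \<le> u x" for x
    using u_nonneg cInf_lower[OF rangeI bdd_below_u] by (auto intro: cInf_greatest)
  have M: "0 \<le> M" using u_nonneg[of 0] u_le[of 0] by linarith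
  have K: "K \<ge> 0" using M by (simp add: K_def)
  then have "K + 1 > 0" by linarith
  \<comment> \<open>\<open>K\<close> is only known to be nonnegative, hence \<open>K + 1\<close> in
    the denominator.\<close>
  then have "\<epsilon> / (K + 1) > 0" using assms by (intro divide_pos_pos)
  from average_tendsto_Inf[OF this]
  obtain R0 where R0: "R0 > 0"
    "\<And>R. R \<ge> R0 \<Longrightarrow> (LINT x|lborel. (u x - ?m) * xi 0 R x) \<le> \<epsilon> / (K + 1) * R ^ DIM('a)"
    by blast
  have "(LINT x|lborel. (norm (gu x))\<^sup>2 * xi 0 R x) \<le> \<epsilon> * R ^ DIM('a) / R\<^sup>2" if "R \<ge> R0" for R
  proof -
    have R: "R > 0" using that R0(1) by simp
    have "(LINT x|lborel. (norm (gu x))\<^sup>2 * xi 0 R x)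
      \<le> 3/2 * M * (lap_const TYPE('a) / R\<^sup>2 * (LINT x|lborel. (u x - ?m) * xi 0 (2 * R) x))"
      by (rule energy_le[OF R m])
    also have "\<dots> \<le> 3/2 * M * (lap_const TYPE('a) / R\<^sup>2 * (\<epsilon> / (K + 1) * (2 * R) ^ DIM('a)))"
      using R0(2)[of "2 * R"] that R M by (intro mult_left_mono) auto
    also have "\<dots> = (K / (K + 1)) * (\<epsilon> * R ^ DIM('a) / R\<^sup>2)"
    proof -
      have "(a * L * t) / D * (e * r / s) = a * (L / s * (e / D * (t * r)))" for a L t D e r s :: real
        by (simp add: mult_ac)
      from this[of "3/2 * M" "lap_const TYPE('a)" "2 ^ DIM('a)" "K + 1" \<epsilon> "R ^ DIM('a)" "R\<^sup>2"]
      show ?thesis by (simp only: K_def[symmetric] power_mult_distrib)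
    qed
    also have "\<dots> \<le> 1 * (\<epsilon> * R ^ DIM('a) / R\<^sup>2)"
      using K assms R by (intro mult_right_mono) (auto simp: divide_simps)
    finally show ?thesis by simp
  qed
  then show ?thesis using R0(1) by blast
qed

end

section \<open>Stable solutions in dimension at most nine\<close>

text \<open>The C1 quadratic spline rising from 0 at 0 to 1 at 1, whose derivative is a tent of
  height 2. As a combination of truncated powers it is differentiated by
  \<open>max_power_deriv\<close>.\<close>

definition smoothstep :: "real \<Rightarrow> real" where
  "smoothstep s = 2 * ((max 0 s)\<^sup>2 - 2 * (max 0 (s - 1/2))\<^sup>2 + (max 0 (s - 1))\<^sup>2)"

definition smoothstep' :: "real \<Rightarrow> real" where
  "smoothstep' s = 4 * (max 0 s - 2 * max 0 (s - 1/2) + max 0 (s - 1))"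

lemma has_real_derivative_smoothstep: "(smoothstep has_real_derivative smoothstep' s) (at s)"
proof -
  have p: "((\<lambda>s::real. (max 0 (s - c))\<^sup>2) has_real_derivative 2 * max 0 (s - c)) (at s)" for c
  proof -
    have "((\<lambda>s::real. (max 0 s)\<^sup>2) has_real_derivative 2 * max 0 (s - c)) (at (s - c))"
      using max_power_deriv[of 1 "s - c"] by (simp add: numeral_2_eq_2)
    then have "((\<lambda>s. (max 0 (s - c))\<^sup>2) has_real_derivative (2 * max 0 (s - c)) * 1) (at s)"
      by (rule DERIV_chain2) (auto intro!: derivative_eq_intros)
    then show ?thesis by simp
  qed
  show ?thesis
    unfolding smoothstep_def[abs_def] smoothstep'_def
    using DERIV_cmult[OF DERIV_add[OF DERIV_diff[OF p[of 0] DERIV_cmult[OF p[of "1/2"], of 2]] p[of 1]], of 2]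
    by simp
qed

lemma continuous_on_smoothstep' [continuous_intros]:
  "continuous_on A v \<Longrightarrow> continuous_on A (\<lambda>x. smoothstep' (v x))"
  unfolding smoothstep'_def by (intro continuous_intros)

lemma continuous_on_smoothstep [continuous_intros]:
  "continuous_on A v \<Longrightarrow> continuous_on A (\<lambda>x. smoothstep (v x))"
  unfolding smoothstep_def by (intro continuous_intros)

lemma smoothstep'_bounds: "0 \<le> smoothstep' s" "smoothstep' s \<le> 2"
  by (auto simp: smoothstep'_def max_def)

lemma smoothstep'_eq_0: "s \<le> 0 \<or> s \<ge> 1 \<Longrightarrow> smoothstep' s = 0"
  by (auto simp: smoothstep'_def max_def)

lemma smoothstep_eq_0: "s \<le> 0 \<Longrightarrow> smoothstep s = 0"
  by (simp add: smoothstep_def)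

lemma smoothstep_eq_1: "s \<ge> 1 \<Longrightarrow> smoothstep s = 1"
  by (simp add: smoothstep_def power2_eq_square algebra_simps)

lemma smoothstep_mono: "s \<le> t \<Longrightarrow> smoothstep s \<le> smoothstep t"
  by (rule DERIV_nonneg_imp_nondecreasing[of s t smoothstep])
    (use has_real_derivative_smoothstep smoothstep'_bounds in auto)

lemma smoothstep_bounds: "0 \<le> smoothstep s" "smoothstep s \<le> 1"
  using smoothstep_mono[of "min s 0" s] smoothstep_mono[of s "max s 1"]
  by (auto simp: smoothstep_eq_0 smoothstep_eq_1)

lemma second_difference_mvt:
  fixes u :: "'a::euclidean_space \<Rightarrow> real"
  assumes u: "has_grad u g" and g: "\<And>x. (g has_derivative H x) (at x)" and h: "h > 0"
  shows "\<exists>y. norm (y - x) \<le> h * (norm a + norm b) \<and>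
    u (x + h *\<^sub>R a + h *\<^sub>R b) - u (x + h *\<^sub>R a) - u (x + h *\<^sub>R b) + u x = h\<^sup>2 * (H y b \<bullet> a)"
proof -
  let ?k = "\<lambda>s. u (x + s *\<^sub>R a + h *\<^sub>R b) - u (x + s *\<^sub>R a)"
  have l: "((\<lambda>s. c + s *\<^sub>R d) has_derivative (\<lambda>t. t *\<^sub>R d)) (at s)" for c d :: 'a and s
    by (auto intro!: derivative_eq_intros)
  have du: "((\<lambda>s. u (c + s *\<^sub>R a)) has_real_derivative g (c + s *\<^sub>R a) \<bullet> a) (at s)" for c s
    using has_derivative_compose[OF l[of c a s] has_gradD(1)[OF u]]
    by (auto simp: has_field_derivative_def mult.commute elim!: has_derivative_eq_rhs)
  have "(?k has_real_derivative (g (x + s *\<^sub>R a + h *\<^sub>R b) \<bullet> a - g (x + s *\<^sub>R a) \<bullet> a)) (at s)" for s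
    using DERIV_diff[OF du[of "x + h *\<^sub>R b" s] du[of x s]] by (simp add: algebra_simps)
  from MVT2[OF h this]
  obtain \<sigma> where \<sigma>: "0 < \<sigma>" "\<sigma> < h"
    "?k h - ?k 0 = h * (g (x + \<sigma> *\<^sub>R a + h *\<^sub>R b) \<bullet> a - g (x + \<sigma> *\<^sub>R a) \<bullet> a)" by auto
  have dg: "((\<lambda>t. g (x + \<sigma> *\<^sub>R a + t *\<^sub>R b) \<bullet> a) has_real_derivative H (x + \<sigma> *\<^sub>R a + t *\<^sub>R b) b \<bullet> a) (at t)" for t
  proof -
    have "((\<lambda>t. g (x + \<sigma> *\<^sub>R a + t *\<^sub>R b) \<bullet> a) has_derivative
        (\<lambda>s. H (x + \<sigma> *\<^sub>R a + t *\<^sub>R b) (s *\<^sub>R b) \<bullet> a)) (at t)"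
      by (intro has_derivative_inner_left has_derivative_compose[OF l g])
    moreover have "H y (s *\<^sub>R b) = s *\<^sub>R H y b" for y s
      using has_derivative_linear[OF g] linear_scale by blast
    ultimately show ?thesis by (simp add: has_field_derivative_def mult_commute_abs)
  qed
  from MVT2[OF h dg]
  obtain \<tau> where \<tau>: "0 < \<tau>" "\<tau> < h" "g (x + \<sigma> *\<^sub>R a + h *\<^sub>R b) \<bullet> a - g (x + \<sigma> *\<^sub>R a) \<bullet> a
      = h * (H (x + \<sigma> *\<^sub>R a + \<tau> *\<^sub>R b) b \<bullet> a)" by auto
  have "norm (\<sigma> *\<^sub>R a + \<tau> *\<^sub>R b) \<le> h * norm a + h * norm b"
    using \<sigma> \<tau> by (intro norm_triangle_le add_mono) (auto intro!: mult_right_mono)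
  then show ?thesis
    using \<sigma>(3) \<tau>(3)
    by (intro exI[of _ "x + \<sigma> *\<^sub>R a + \<tau> *\<^sub>R b"]) (auto simp: algebra_simps power2_eq_square)
qed

text \<open>The second difference is symmetric in \<open>a\<close> and \<open>b\<close>; applying
  the mean value theorem in either order identifies it with both mixed derivatives, at points that
  converge to \<open>x\<close>.\<close>

lemma symmetric_hessian:
  fixes u :: "'a::euclidean_space \<Rightarrow> real"
  assumes u: "has_grad u g" and g: "\<And>x. (g has_derivative H x) (at x)"
    and cont: "continuous_on UNIV (\<lambda>x. H x a)" "continuous_on UNIV (\<lambda>x. H x b)"
  shows "H x a \<bullet> b = H x b \<bullet> a"
proof -
  define K where "K = norm a + norm b + 1"
  have K: "K > 0" unfolding K_def by (intro add_nonneg_pos) auto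
  define h where "h n = inverse (real (Suc n))" for n
  have h: "h n > 0" for n by (simp add: h_def)
  have "\<exists>y z. norm (y - x) \<le> h n * K \<and> norm (z - x) \<le> h n * K \<and> H y b \<bullet> a = H z a \<bullet> b" for n
  proof -
    obtain y where y: "norm (y - x) \<le> h n * (norm a + norm b)"
      "u (x + h n *\<^sub>R a + h n *\<^sub>R b) - u (x + h n *\<^sub>R a) - u (x + h n *\<^sub>R b) + u x = (h n)\<^sup>2 * (H y b \<bullet> a)"
      using second_difference_mvt[OF u g h] by blast
    obtain z where z: "norm (z - x) \<le> h n * (norm b + norm a)"
      "u (x + h n *\<^sub>R b + h n *\<^sub>R a) - u (x + h n *\<^sub>R b) - u (x + h n *\<^sub>R a) + u x = (h n)\<^sup>2 * (H z a \<bullet> b)"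
      using second_difference_mvt[OF u g h] by blast
    have "(h n)\<^sup>2 * (H y b \<bullet> a) = (h n)\<^sup>2 * (H z a \<bullet> b)"
      using y(2) z(2) by (simp add: algebra_simps)
    then have "H y b \<bullet> a = H z a \<bullet> b" using h[of n] by simp
    moreover have hK: "h n * (norm a + norm b) \<le> h n * K" using h[of n] by (simp add: K_def)
    moreover have "norm (y - x) \<le> h n * K" "norm (z - x) \<le> h n * K"
      using order_trans[OF y(1) hK] order_trans[OF z(1)[unfolded add.commute[of "norm b"]] hK] .
    ultimately have "norm (y - x) \<le> h n * K" "norm (z - x) \<le> h n * K" "H y b \<bullet> a = H z a \<bullet> b"
      by blast+
    then show ?thesis by blast
  qed
  then obtain y z where yz: "\<And>n. norm (y n - x) \<le> h n * K" "\<And>n. norm (z n - x) \<le> h n * K"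
    "\<And>n. H (y n) b \<bullet> a = H (z n) a \<bullet> b" by metis
  have "(\<lambda>n. h n * K) \<longlonglongrightarrow> 0 * K"
    unfolding h_def by (intro tendsto_mult LIMSEQ_inverse_real_of_nat tendsto_const)
  then have hK: "(\<lambda>n. h n * K) \<longlonglongrightarrow> 0" by simp
  have lim: "w \<longlonglongrightarrow> x" if "\<And>n. norm (w n - x) \<le> h n * K" for w
  proof -
    have "(\<lambda>n. w n - x) \<longlonglongrightarrow> 0"
      by (rule Lim_null_comparison[OF _ hK]) (use that in auto)
    then show ?thesis using LIM_zero_iff by blast
  qed
  have "(\<lambda>n. H (y n) b \<bullet> a) \<longlonglongrightarrow> H x b \<bullet> a"
    using continuous_on_tendsto_compose[OF cont(2) lim[OF yz(1)]] by (intro tendsto_intros) auto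
  moreover have "(\<lambda>n. H (z n) a \<bullet> b) \<longlonglongrightarrow> H x a \<bullet> b"
    using continuous_on_tendsto_compose[OF cont(1) lim[OF yz(2)]] by (intro tendsto_intros) auto
  ultimately show ?thesis using yz(3) LIMSEQ_unique by auto
qed

text \<open>\<open>F\<close> is the derivative of \<open>f\<close> on the positive half line. As
  \<open>u\<close> is positive, the one-sided derivative at 0 is avoided; stability is phrased for
  test functions with an explicit gradient.\<close>

locale stable_solution = bounded_superharmonic u gu "\<lambda>x. f (u x)" M
  for u :: "'a::euclidean_space \<Rightarrow> real" and gu :: "'a \<Rightarrow> 'a" and f :: "real \<Rightarrow> real" and M :: real +
  fixes F :: "real \<Rightarrow> real"
  assumes u_pos: "\<And>x. 0 < u x"
    and f_deriv: "\<And>s. 0 < s \<Longrightarrow> (f has_real_derivative F s) (at s)"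
    and F_cont: "continuous_on {0<..} F"
    and stable: "\<And>\<phi> g. has_grad \<phi> g \<Longrightarrow> bounded_support \<phi> \<Longrightarrow>
      (LINT x|lborel. F (u x) * (\<phi> x)\<^sup>2) \<le> (LINT x|lborel. (norm (g x))\<^sup>2)"
begin

lemma cont_compose: "continuous_on {0<..} h \<Longrightarrow> continuous_on UNIV (\<lambda>x. h (u x))"
  by (rule continuous_on_compose2[OF _ cont_u]) (use u_pos in auto)

lemma cont_Fu: "continuous_on UNIV (\<lambda>x. F (u x))"
  by (rule cont_compose[OF F_cont])

end

locale stable_solution_C2 = stable_solution u gu f M F
  for u :: "'a::euclidean_space \<Rightarrow> real" and gu :: "'a \<Rightarrow> 'a" and f :: "real \<Rightarrow> real" and M :: real
    and F :: "real \<Rightarrow> real" +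
  fixes H :: "'a \<Rightarrow> 'a \<Rightarrow> 'a"
  assumes hess: "\<And>x. (gu has_derivative H x) (at x)"
    and hess_cont: "\<And>b. b \<in> Basis \<Longrightarrow> continuous_on UNIV (\<lambda>x. H x b)"
    and hess_trace: "\<And>x. (\<Sum>b\<in>Basis. H x b \<bullet> b) = - f (u x)"
begin

lemma hess_linear: "linear (H x)"
  using has_derivative_linear[OF hess] .

lemma hess_expand: "H x h = (\<Sum>b\<in>Basis. (h \<bullet> b) *\<^sub>R H x b)"
proof -
  interpret linear "H x" by (rule hess_linear)
  have "H x h = H x (\<Sum>b\<in>Basis. (h \<bullet> b) *\<^sub>R b)" by (simp add: euclidean_representation)
  then show ?thesis by (simp add: sum scale)
qed

lemma hess_cont2:
  assumes "continuous_on A y" "continuous_on A h"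
  shows "continuous_on A (\<lambda>x. H (y x) (h x))"
  unfolding hess_expand[of _ "h _"]
  by (intro continuous_intros assms continuous_on_compose2[OF hess_cont assms(1)]) auto

lemma hess_sym: "H x a \<bullet> b = H x b \<bullet> a"
  by (rule symmetric_hessian[OF grad_u hess]) (intro hess_cont2 continuous_intros)+

text \<open>The generator of dilations: the derivative of \<open>u (l *\<^sub>R x)\<close> with
  respect to \<open>l\<close> at \<open>l = 1\<close>.\<close>

definition w :: "'a \<Rightarrow> real" where "w x = x \<bullet> gu x"

definition gw :: "'a \<Rightarrow> 'a" where "gw x = gu x + H x x"

lemma has_grad_w: "has_grad w gw"
  unfolding has_grad_def
proof (intro conjI allI)
  fix x
  have "(w has_derivative (\<lambda>h. x \<bullet> H x h + h \<bullet> gu x)) (at x)"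
    unfolding w_def[abs_def] by (auto intro!: derivative_eq_intros hess)
  moreover have "x \<bullet> H x h + h \<bullet> gu x = gw x \<bullet> h" for h
    using hess_sym[of x x h] by (simp add: gw_def inner_add_left inner_add_right inner_commute)
  ultimately show "(w has_derivative (\<lambda>h. gw x \<bullet> h)) (at x)" by simp
next
  show "continuous_on UNIV gw"
    unfolding gw_def[abs_def] by (intro continuous_intros cont_gu hess_cont2)
qed

text \<open>Weak form of \<open>- \<Delta> w = f'(u) w + 2 f(u)\<close>. The gradient of
  \<open>u\<close> is only C1, so \<open>w\<close> has no second derivatives at hand; instead the
  weak equation of the dilated functions is differentiated with respect to the dilation
  factor.\<close>

lemma linearized_equation:
  assumes \<phi>: "has_grad \<phi> g" "bounded_support \<phi>"
  shows "(LINT x|lborel. gw x \<bullet> g x - (F (u x) * w x + 2 * f (u x)) * \<phi> x) = 0"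
proof -
  obtain r where r: "\<And>x. norm x > r \<Longrightarrow> \<phi> x = 0" using \<phi>(2) by (auto simp: bounded_support_def)
  have gr: "g x = 0" if "norm x > r" for x by (rule has_grad_zero_outside[OF \<phi>(1) r that])
  note cont = has_gradD(2,3)[OF \<phi>(1)]
  define \<Phi> where "\<Phi> l x = l * (gu (l *\<^sub>R x) \<bullet> g x) - l\<^sup>2 * f (u (l *\<^sub>R x)) * \<phi> x" for l x
  define \<Phi>' where "\<Phi>' l x = gu (l *\<^sub>R x) \<bullet> g x + l * (H (l *\<^sub>R x) x \<bullet> g x)
    - (2 * l * f (u (l *\<^sub>R x)) + l\<^sup>2 * (F (u (l *\<^sub>R x)) * (gu (l *\<^sub>R x) \<bullet> x))) * \<phi> x" for l x
  \<comment> \<open>The dilated function \<open>u (l *\<^sub>R x)\<close> solves the equation with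
    right-hand side multiplied by \<open>l\<^sup>2\<close>.\<close>
  have zero: "(LINT x|lborel. \<Phi> l x) = 0" for l
  proof -
    have "has_div (\<lambda>x. l *\<^sub>R gu (l *\<^sub>R x)) (\<lambda>x. - (l\<^sup>2 * f (u (l *\<^sub>R x))))"
      unfolding has_div_def
    proof (intro exI conjI allI ballI)
      show "((\<lambda>x. l *\<^sub>R gu (l *\<^sub>R x)) has_derivative (\<lambda>h. l *\<^sub>R H (l *\<^sub>R x) (l *\<^sub>R h))) (at x)" for x
        by (intro has_derivative_scaleR_right has_derivative_compose[OF _ hess, of "\<lambda>x. l *\<^sub>R x"])
          (auto intro!: derivative_eq_intros)
      show "continuous_on UNIV (\<lambda>x. l *\<^sub>R H (l *\<^sub>R x) (l *\<^sub>R b))" for b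
        by (intro continuous_intros hess_cont2)
      have "H y (l *\<^sub>R b) = l *\<^sub>R H y b" for y b
        using hess_linear linear_scale by blast
      then show "- (l\<^sup>2 * f (u (l *\<^sub>R x))) = (\<Sum>b\<in>Basis. (l *\<^sub>R H (l *\<^sub>R x) (l *\<^sub>R b)) \<bullet> b)" for x
        using hess_trace[of "l *\<^sub>R x"] by (simp add: power2_eq_square sum_distrib_left[symmetric])
    qed
    moreover have "bounded_support (\<lambda>x. \<phi> x *\<^sub>R (l *\<^sub>R gu (l *\<^sub>R x)))"
      by (rule bounded_support_subset[OF \<phi>(2)]) auto
    ultimately have "(LINT x|lborel. \<phi> x * - (l\<^sup>2 * f (u (l *\<^sub>R x))) + g x \<bullet> (l *\<^sub>R gu (l *\<^sub>R x))) = 0"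
      by (rule green(1)[OF \<phi>(1)])
    moreover have "\<phi> x * - (l\<^sup>2 * f (u (l *\<^sub>R x))) + g x \<bullet> (l *\<^sub>R gu (l *\<^sub>R x)) = \<Phi> l x" for x
      by (simp add: \<Phi>_def inner_commute)
    ultimately show ?thesis by simp
  qed
  have "((\<lambda>l. LINT x|lborel. \<Phi> l x) has_real_derivative (LINT x|lborel. \<Phi>' 1 x)) (at 1)"
  proof (rule has_real_derivative_lborel_integral[of 0 2])
    fix l :: real and x :: 'a
    have s: "((\<lambda>l. l *\<^sub>R x) has_derivative (\<lambda>t. t *\<^sub>R x)) (at l)"
      by (auto intro!: derivative_eq_intros)
    have du: "((\<lambda>l. u (l *\<^sub>R x)) has_real_derivative gu (l *\<^sub>R x) \<bullet> x) (at l)"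
      using has_derivative_compose[OF s has_gradD(1)[OF grad_u]]
      by (auto simp: has_field_derivative_def mult.commute elim!: has_derivative_eq_rhs)
    have df: "((\<lambda>l. f (u (l *\<^sub>R x))) has_real_derivative F (u (l *\<^sub>R x)) * (gu (l *\<^sub>R x) \<bullet> x)) (at l)"
      by (rule DERIV_chain2[OF f_deriv du]) (rule u_pos)
    have dg: "((\<lambda>l. gu (l *\<^sub>R x) \<bullet> g x) has_real_derivative H (l *\<^sub>R x) x \<bullet> g x) (at l)"
    proof -
      have "H y (t *\<^sub>R x) = t *\<^sub>R H y x" for y t
        using hess_linear linear_scale by blast
      moreover have "((\<lambda>l. gu (l *\<^sub>R x) \<bullet> g x) has_derivative (\<lambda>t. H (l *\<^sub>R x) (t *\<^sub>R x) \<bullet> g x)) (at l)"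
        by (intro has_derivative_inner_left has_derivative_compose[OF s hess])
      ultimately show ?thesis
        by (simp add: has_field_derivative_def mult_commute_abs)
    qed
    show "((\<lambda>l. \<Phi> l x) has_real_derivative \<Phi>' l x) (at l)"
      unfolding \<Phi>_def \<Phi>'_def
      by (rule derivative_eq_intros df dg refl)+ (simp add: algebra_simps power2_eq_square)
  next
    have cf: "continuous_on UNIV (\<lambda>x. f (u x))" by (rule cont_fu)
    show "continuous_on UNIV (\<Phi> l)" for l
      unfolding \<Phi>_def[abs_def]
      by (intro continuous_intros cont continuous_on_compose2[OF cf] continuous_on_compose2[OF cont_gu]) auto
    show "continuous_on ({0..2} \<times> UNIV) (\<lambda>(l, x). \<Phi>' l x)"
      unfolding \<Phi>'_def case_prod_beta
      by (intro continuous_intros hess_cont2 continuous_on_compose2[OF cf] continuous_on_compose2[OF cont_gu]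
          continuous_on_compose2[OF cont(1)] continuous_on_compose2[OF cont(2)] continuous_on_compose2[OF cont_Fu]) auto
    show "\<Phi> l x = 0" if "norm x > r" for l x
      using r[OF that] gr[OF that] by (simp add: \<Phi>_def)
  qed auto
  then have "((\<lambda>l. 0) has_real_derivative (LINT x|lborel. \<Phi>' 1 x)) (at 1)"
    by (simp add: zero)
  then have "(LINT x|lborel. \<Phi>' 1 x) = 0"
    using DERIV_unique DERIV_const by blast
  then show ?thesis by (simp add: \<Phi>'_def gw_def w_def inner_add_left inner_commute algebra_simps)
qed

text \<open>Stability tested with \<open>w \<eta>\<close>, freed of all second derivatives of
  \<open>u\<close> and of all terms in \<open>f\<close> and \<open>F\<close>. What remains is
  quadratic in the gradient of \<open>u\<close>.\<close>

lemma pohozaev_stability: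
  assumes \<eta>: "has_grad \<eta> g" "bounded_support \<eta>"
  shows "0 \<le> (LINT x|lborel. (w x)\<^sup>2 * (norm (g x))\<^sup>2 + (2 - real DIM('a)) * (norm (gu x))\<^sup>2 * (\<eta> x)\<^sup>2
    + 4 * w x * \<eta> x * (g x \<bullet> gu x) - 2 * (norm (gu x))\<^sup>2 * \<eta> x * (g x \<bullet> x))"
proof -
  note cont = has_gradD(2,3)[OF \<eta>(1)] has_gradD(2,3)[OF has_grad_w] cont_gu cont_u cont_Fu cont_fu
  note bs = bounded_support_common[OF \<eta>(2) bounded_support_grad[OF \<eta>]]
  have gx: "has_grad (\<lambda>x. (\<eta> x)\<^sup>2) (\<lambda>x. (2 * \<eta> x) *\<^sub>R g x)"
    by (rule has_grad_compose[OF \<eta>(1), of "\<lambda>s. s\<^sup>2" "\<lambda>s. 2 * s"])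
      (auto intro!: derivative_eq_intros continuous_intros)
  define g\<phi> where "g\<phi> x = (\<eta> x)\<^sup>2 *\<^sub>R gw x + w x *\<^sub>R ((2 * \<eta> x) *\<^sub>R g x)" for x
  have \<phi>: "has_grad (\<lambda>x. w x * (\<eta> x)\<^sup>2) g\<phi>"
    using has_grad_mult[OF has_grad_w gx] by (simp add: g\<phi>_def[abs_def])
  define g\<psi> where "g\<psi> x = \<eta> x *\<^sub>R gw x + w x *\<^sub>R g x" for x
  have \<psi>: "has_grad (\<lambda>x. w x * \<eta> x) g\<psi>"
    using has_grad_mult[OF has_grad_w \<eta>(1)] by (simp add: g\<psi>_def[abs_def])
  have ee: "has_grad (\<lambda>x. gu x \<bullet> gu x) (\<lambda>x. 2 *\<^sub>R H x (gu x))"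
    unfolding has_grad_def
  proof (intro conjI allI)
    fix x
    have "((\<lambda>x. gu x \<bullet> gu x) has_derivative (\<lambda>h. gu x \<bullet> H x h + H x h \<bullet> gu x)) (at x)"
      by (auto intro!: derivative_eq_intros hess)
    moreover have "gu x \<bullet> H x h + H x h \<bullet> gu x = (2 *\<^sub>R H x (gu x)) \<bullet> h" for h
      using hess_sym[of x "gu x" h] by (simp add: inner_commute)
    ultimately show "((\<lambda>x. gu x \<bullet> gu x) has_derivative (\<lambda>h. (2 *\<^sub>R H x (gu x)) \<bullet> h)) (at x)"
      by simp
  qed (intro continuous_intros hess_cont2 cont_gu)
  define ge where "ge x = (\<eta> x)\<^sup>2 *\<^sub>R (2 *\<^sub>R H x (gu x)) + (gu x \<bullet> gu x) *\<^sub>R ((2 * \<eta> x) *\<^sub>R g x)" for x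
  have e\<xi>: "has_grad (\<lambda>x. (gu x \<bullet> gu x) * (\<eta> x)\<^sup>2) ge"
    using has_grad_mult[OF ee gx] by (simp add: ge_def[abs_def])
  have idd: "has_div (\<lambda>x::'a. x) (\<lambda>x. real DIM('a))"
    unfolding has_div_def by (intro exI[of _ "\<lambda>x h. h"]) (auto intro!: continuous_intros)
  \<comment> \<open>\<open>T1\<close> is stability for \<open>w \<eta>\<close>, \<open>T2\<close>
    the linearized equation with \<open>w \<eta>^2\<close>, \<open>T3\<close> the equation itself
    with \<open>w \<eta>^2\<close>, and \<open>T4\<close> the divergence of
    \<open>|\<nabla>u|^2 \<eta>^2 x\<close>. The difference \<open>T1 - T2\<close> leaves
    \<open>w^2 |\<nabla>\<eta>|^2 + 2 f w \<eta>^2\<close>; \<open>2 T3\<close> trades the term in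
    \<open>f\<close> for gradients, and \<open>T4\<close> removes the Hessian this
    introduces.\<close>
  define T1 where "T1 x = (norm (g\<psi> x))\<^sup>2 - F (u x) * (w x * \<eta> x)\<^sup>2" for x
  define T2 where "T2 x = gw x \<bullet> g\<phi> x - (F (u x) * w x + 2 * f (u x)) * (w x * (\<eta> x)\<^sup>2)" for x
  define T3 where "T3 x = w x * (\<eta> x)\<^sup>2 * - f (u x) + g\<phi> x \<bullet> gu x" for x
  define T4 where "T4 x = (gu x \<bullet> gu x) * (\<eta> x)\<^sup>2 * real DIM('a) + ge x \<bullet> x" for x
  have i1: "integrable lborel (\<lambda>x. (norm (g\<psi> x))\<^sup>2)" "integrable lborel (\<lambda>x. F (u x) * (w x * \<eta> x)\<^sup>2)"
    unfolding g\<psi>_def by (intro integrable_bounded_support continuous_intros cont bs; simp)+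
  then have I1: "integrable lborel T1" unfolding T1_def by simp
  have "0 \<le> (LINT x|lborel. T1 x)"
    using stable[OF \<psi>] bounded_support_subset[OF \<eta>(2), of "\<lambda>x. w x * \<eta> x"] i1
    unfolding T1_def by simp
  moreover have "(LINT x|lborel. T2 x) = 0"
    unfolding T2_def by (rule linearized_equation[OF \<phi>]) (rule bounded_support_subset[OF \<eta>(2)], simp)
  moreover have I2: "integrable lborel T2"
    unfolding T2_def g\<phi>_def by (intro integrable_bounded_support continuous_intros cont bs) simp
  moreover have "(LINT x|lborel. T3 x) = 0"
    unfolding T3_def by (rule green(1)[OF \<phi> div_gu]) (rule bounded_support_subset[OF \<eta>(2)], simp)
  moreover have I3: "integrable lborel T3"
    unfolding T3_def g\<phi>_def by (intro integrable_bounded_support continuous_intros cont bs) simp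
  moreover have "(LINT x|lborel. T4 x) = 0"
    unfolding T4_def by (rule green(1)[OF e\<xi> idd]) (rule bounded_support_subset[OF \<eta>(2)], simp)
  moreover have I4: "integrable lborel T4"
    unfolding T4_def ge_def by (intro integrable_bounded_support continuous_intros cont hess_cont2 bs) simp
  ultimately have "0 \<le> (LINT x|lborel. ((T1 x - T2 x) + 2 * T3 x) - T4 x)"
    using I1 by simp
  also have "(\<lambda>x. ((T1 x - T2 x) + 2 * T3 x) - T4 x) = (\<lambda>x. (w x)\<^sup>2 * (norm (g x))\<^sup>2
      + (2 - real DIM('a)) * (norm (gu x))\<^sup>2 * (\<eta> x)\<^sup>2
      + 4 * w x * \<eta> x * (g x \<bullet> gu x) - 2 * (norm (gu x))\<^sup>2 * \<eta> x * (g x \<bullet> x))"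
  proof
    fix x
    have h: "gu x \<bullet> H x x = x \<bullet> H x (gu x)"
      using hess_sym[of x x "gu x"] by (simp add: inner_commute)
    show "((T1 x - T2 x) + 2 * T3 x) - T4 x = (w x)\<^sup>2 * (norm (g x))\<^sup>2
      + (2 - real DIM('a)) * (norm (gu x))\<^sup>2 * (\<eta> x)\<^sup>2
      + 4 * w x * \<eta> x * (g x \<bullet> gu x) - 2 * (norm (gu x))\<^sup>2 * \<eta> x * (g x \<bullet> x)"
      unfolding T1_def T2_def T3_def T4_def g\<phi>_def g\<psi>_def ge_def power2_norm_eq_inner
      by (simp add: inner_add_left inner_add_right h gw_def inner_commute power2_eq_square algebra_simps)
  qed
  finally show ?thesis .
qed

lemma w_power2_le: "(w x)\<^sup>2 \<le> (norm x)\<^sup>2 * (norm (gu x))\<^sup>2"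
  using power_mono[OF Cauchy_Schwarz_ineq2[of x "gu x"] abs_ge_zero, of 2]
  by (simp add: w_def power_mult_distrib)

text \<open>The test function is \<open>w\<close> times a cut-off of \<open>(1 + |x|\<^sup>2)\<^bsup>-a/4\<^esup>\<close>, \<open>a = N - 2\<close>; this
  exponent makes the coefficient of \<open>|\<nabla>u|\<^sup>2\<close> in the Pohozaev identity vanish up to a good sign,
  and the remaining coefficient of \<open>w\<^sup>2\<close> is positive precisely when \<open>N < 10\<close>.\<close>

lemma radial_derivative_estimate:
  fixes a :: real
  assumes a: "a = real DIM('a) - 2" "0 \<le> a" and R: "R > 0"
  shows "(2 * a - a\<^sup>2 / 4) * (LINT x|lborel. (1 + (norm x)\<^sup>2) powr (- a / 2 - 1) * (w x)\<^sup>2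
      * (smoothstep (2 - (norm x)\<^sup>2 / R\<^sup>2))\<^sup>2)
    \<le> (80 + 8 * a) * 64 * R powr (- a) * (LINT x|lborel. (norm (gu x))\<^sup>2 * xi 0 (2 * R) x)"
proof -
  define q where "q x = 1 + (norm x)\<^sup>2" for x :: 'a
  define \<zeta> where "\<zeta> x = smoothstep (2 - (norm x)\<^sup>2 / R\<^sup>2)" for x :: 'a
  define \<tau> where "\<tau> x = 2 * smoothstep' (2 - (norm x)\<^sup>2 / R\<^sup>2) / R\<^sup>2" for x :: 'a
  define e where "e x = q x powr (- a / 4)" for x :: 'a
  \<comment> \<open>\<open>- e x * k x\<close> is the coefficient of \<open>x\<close> in the
    gradient of the test function: the first summand stems from the power, \<open>\<tau>\<close>
    from the cut-off and is nonzero only for \<open>R^2 < |x|^2 < 2 R^2\<close>.\<close>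
  define k where "k x = (a / 2) * \<zeta> x / q x + \<tau> x" for x :: 'a
  have q1: "q x \<ge> 1" for x by (simp add: q_def)
  have q0: "q x > 0" for x using q1[of x] by linarith
  have dq: "has_grad q (\<lambda>x. 2 *\<^sub>R x)"
    unfolding has_grad_def q_def
    using has_derivative_norm_power2[of 0] by (auto intro!: derivative_eq_intros continuous_intros)
  have de: "has_grad e (\<lambda>x. (- a / 4 * q x powr (- a / 4 - 1)) *\<^sub>R (2 *\<^sub>R x))"
    unfolding e_def
    by (rule has_grad_compose[OF dq]) (use q0 in \<open>auto intro!: derivative_eq_intros continuous_intros simp: less_imp_neq[symmetric]\<close>)
  have ds: "has_grad (\<lambda>x::'a. 2 - (norm x)\<^sup>2 / R\<^sup>2) (\<lambda>x. (- 2 / R\<^sup>2) *\<^sub>R x)"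
    unfolding has_grad_def
  proof (intro conjI allI)
    fix x :: 'a
    have "((\<lambda>x::'a. (norm x)\<^sup>2) has_derivative (\<lambda>h. 2 * (x \<bullet> h))) (at x)"
      using has_derivative_norm_power2[of 0 x] by simp
    from has_derivative_diff[OF has_derivative_const[of 2] bounded_linear.has_derivative[OF bounded_linear_divide[of "R\<^sup>2"] this]]
    show "((\<lambda>x::'a. 2 - (norm x)\<^sup>2 / R\<^sup>2) has_derivative (\<lambda>h. ((- 2 / R\<^sup>2) *\<^sub>R x) \<bullet> h)) (at x)"
      by (rule has_derivative_eq_rhs) auto
  qed (intro continuous_intros)
  have d\<zeta>: "has_grad \<zeta> (\<lambda>x. smoothstep' (2 - (norm x)\<^sup>2 / R\<^sup>2) *\<^sub>R ((- 2 / R\<^sup>2) *\<^sub>R x))"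
    unfolding \<zeta>_def
    by (rule has_grad_compose[OF ds]) (intro has_real_derivative_smoothstep continuous_intros)+
  define g where "g x = (- e x * k x) *\<^sub>R x" for x
  have dg: "has_grad (\<lambda>x. e x * \<zeta> x) g"
  proof -
    have "\<zeta> x *\<^sub>R ((- a / 4 * q x powr (- a / 4 - 1)) *\<^sub>R (2 *\<^sub>R x))
      + e x *\<^sub>R (smoothstep' (2 - (norm x)\<^sup>2 / R\<^sup>2) *\<^sub>R ((- 2 / R\<^sup>2) *\<^sub>R x)) = g x" for x
    proof -
      have "q x powr (- a / 4 - 1) = e x / q x"
        using q0[of x] by (simp add: e_def powr_diff)
      then show ?thesis
        by (simp add: g_def k_def \<tau>_def scaleR_add_left[symmetric] algebra_simps)
    qed
    then show ?thesis using has_grad_mult[OF de d\<zeta>] by simp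
  qed
  have \<zeta>0: "\<zeta> x = 0" "\<tau> x = 0" if "(norm x)\<^sup>2 \<ge> 2 * R\<^sup>2" for x
    using that R by (auto simp: \<zeta>_def \<tau>_def smoothstep_eq_0 smoothstep'_eq_0 divide_simps)
  have bs: "bounded_support (\<lambda>x. e x * \<zeta> x)"
  proof (rule bounded_supportI[of "2 * R"])
    fix x :: 'a assume "2 * R < norm x"
    then have "(2 * R)\<^sup>2 \<le> (norm x)\<^sup>2" using R by (intro power_mono) auto
    then have "2 * R\<^sup>2 \<le> (norm x)\<^sup>2" by (simp add: power_mult_distrib) (use zero_le_power2[of R] in linarith)
    then show "e x * \<zeta> x = 0" by (simp add: \<zeta>0)
  qed
  have \<zeta>b: "0 \<le> \<zeta> x" "\<zeta> x \<le> 1" for x by (auto simp: \<zeta>_def smoothstep_bounds)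
  have \<tau>b: "0 \<le> \<tau> x" "\<tau> x \<le> 4 / R\<^sup>2" for x
    using smoothstep'_bounds[of "2 - (norm x)\<^sup>2 / R\<^sup>2"] R by (auto simp: \<tau>_def divide_simps)
  have e2: "(e x)\<^sup>2 = q x powr (- a / 2)" for x
    by (simp add: e_def power2_eq_square powr_add[symmetric])
  define A where "A x = (1 + (norm x)\<^sup>2) powr (- a / 2 - 1) * (w x)\<^sup>2 * (\<zeta> x)\<^sup>2" for x
  define B where "B x = (norm (gu x))\<^sup>2 * xi 0 (2 * R) x" for x
  have Aeq: "A x = (e x)\<^sup>2 * (w x)\<^sup>2 * (\<zeta> x)\<^sup>2 / q x" for x
    using q0[of x] by (simp add: A_def e2 powr_diff q_def)
  have iA: "integrable lborel A"
    unfolding A_def[abs_def]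
  proof (rule integrable_bounded_support)
    show "continuous_on UNIV (\<lambda>x. (1 + (norm x)\<^sup>2) powr (- a / 2 - 1) * (w x)\<^sup>2 * (\<zeta> x)\<^sup>2)"
      using q0 unfolding q_def
      by (intro continuous_intros has_gradD(3)[OF has_grad_w] has_gradD(3)[OF d\<zeta>]) (auto simp: less_imp_neq[symmetric])
    show "bounded_support (\<lambda>x. (1 + (norm x)\<^sup>2) powr (- a / 2 - 1) * (w x)\<^sup>2 * (\<zeta> x)\<^sup>2)"
      by (rule bounded_support_subset[OF bs]) (use q0 in \<open>simp add: e_def less_imp_neq[symmetric]\<close>)
  qed
  have iB: "integrable lborel B"
    unfolding B_def[abs_def] using R by (intro integrable_xi continuous_intros cont_gu) auto
  \<comment> \<open>On the support of \<open>\<tau>\<close> one has \<open>n * T \<le> 8\<close> and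
    \<open>W * T \<le> 8 * G\<close>, which gives \<open>8 a + 64 + 16\<close>; there
    \<open>(e x)\<^sup>2\<close> is at most \<open>R powr (- a)\<close>, and \<open>64 = 2^6\<close>
    since \<open>bump\<close> with radius \<open>2 * R\<close> is at least
    \<open>1/2\<close>.\<close>
  define C where "C = (80 + 8 * a) * 64 * R powr (- a)"
  let ?P = "\<lambda>x. (w x)\<^sup>2 * (norm (g x))\<^sup>2 + (2 - real DIM('a)) * (norm (gu x))\<^sup>2 * (e x * \<zeta> x)\<^sup>2
    + 4 * w x * (e x * \<zeta> x) * (g x \<bullet> gu x) - 2 * (norm (gu x))\<^sup>2 * (e x * \<zeta> x) * (g x \<bullet> x)"
  have P: "?P x \<le> - (2 * a - a\<^sup>2 / 4) * A x + C * B x" for x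
  proof -
    define G n Z T W Q where "G = (norm (gu x))\<^sup>2" and "n = (norm x)\<^sup>2" and "Z = \<zeta> x" and "T = \<tau> x"
      and "W = (w x)\<^sup>2" and "Q = q x"
    have nn: "0 \<le> G" "0 \<le> n" "0 \<le> Z" "Z \<le> 1" "0 \<le> T" "0 \<le> W" "n \<le> Q" "1 \<le> Q" "W \<le> n * G"
      using \<zeta>b \<tau>b w_power2_le by (auto simp: G_def n_def Z_def T_def W_def Q_def q_def)
    have kk: "k x = (a / 2) * Z / Q + T" by (simp add: k_def Z_def Q_def T_def)
    have ng: "(norm (g x))\<^sup>2 = (e x)\<^sup>2 * (k x)\<^sup>2 * n"
      by (simp add: g_def n_def power_mult_distrib)
    have gg: "g x \<bullet> gu x = - e x * k x * w x" "g x \<bullet> x = - e x * k x * n"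
      by (simp_all add: g_def w_def n_def power2_norm_eq_inner)
    have Peq: "?P x = (e x)\<^sup>2 * (W * n * (k x)\<^sup>2 - a * G * Z\<^sup>2 - 4 * W * Z * k x + 2 * G * n * Z * k x)"
    proof -
      have N: "real DIM('a) = a + 2" using a(1) by simp
      show ?thesis
        unfolding ng gg N by (simp add: W_def G_def Z_def power2_eq_square algebra_simps)
    qed
    have nQ: "n / Q \<le> 1" "0 \<le> n / Q" using nn by (auto simp: divide_simps)
    have 1: "2 * G * n * Z * k x - a * G * Z\<^sup>2 \<le> 2 * G * (n * T)"
    proof -
      have "2 * G * n * Z * k x = a * G * Z\<^sup>2 * (n / Q) + 2 * G * (n * T) * Z"
        unfolding kk by (simp add: power2_eq_square algebra_simps)
      moreover have "a * G * Z\<^sup>2 * (n / Q) \<le> a * G * Z\<^sup>2"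
        using nn a(2) nQ by (intro mult_left_le) auto
      moreover have "2 * G * (n * T) * Z \<le> 2 * G * (n * T)"
        using nn by (intro mult_left_le) auto
      ultimately show ?thesis by linarith
    qed
    \<comment> \<open>The \<open>2 * a\<close> comes from the part linear in \<open>k x\<close>, the
      \<open>a\<^sup>2 / 4\<close> from the quadratic one via \<open>n \<le> Q\<close>.\<close>
    have 2: "n * (k x)\<^sup>2 - 4 * Z * k x \<le> - (2 * a - a\<^sup>2 / 4) * (Z\<^sup>2 / Q) + (a * T + n * T\<^sup>2)"
    proof -
      have "n * (k x)\<^sup>2 = (a\<^sup>2 / 4) * (Z\<^sup>2 / Q) * (n / Q) + a * T * Z * (n / Q) + n * T\<^sup>2"
        unfolding kk by (simp add: power2_eq_square algebra_simps)
      moreover have "(a\<^sup>2 / 4) * (Z\<^sup>2 / Q) * (n / Q) \<le> (a\<^sup>2 / 4) * (Z\<^sup>2 / Q)"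
        using nn nQ by (intro mult_left_le) auto
      moreover have "a * T * Z * (n / Q) \<le> a * T * Z"
        using nn nQ a(2) by (intro mult_left_le) auto
      moreover have "a * T * Z \<le> a * T"
        using nn a(2) by (intro mult_left_le) auto
      moreover have "4 * Z * k x = 2 * a * (Z\<^sup>2 / Q) + 4 * Z * T"
        unfolding kk by (simp add: power2_eq_square algebra_simps)
      moreover have "0 \<le> 4 * Z * T" using nn by simp
      ultimately show ?thesis by (simp add: algebra_simps)
    qed
    have 3: "(e x)\<^sup>2 * (W * (a * T + n * T\<^sup>2) + 2 * G * (n * T)) \<le> C * B x"
    proof (cases "T = 0")
      case True
      have "0 \<le> C" using a(2) by (simp add: C_def)
      then show ?thesis using True by (simp add: B_def xi_bounds)
    next
      case False
      then have "smoothstep' (2 - n / R\<^sup>2) \<noteq> 0" by (auto simp: T_def \<tau>_def n_def)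
      then have "0 < 2 - n / R\<^sup>2" "2 - n / R\<^sup>2 < 1" using smoothstep'_eq_0 not_le by blast+
      then have n: "R\<^sup>2 \<le> n" "n \<le> 2 * R\<^sup>2" using R by (auto simp: divide_simps split: if_splits)
      have "n * T \<le> (2 * R\<^sup>2) * (4 / R\<^sup>2)"
        using \<tau>b n nn by (intro mult_mono) (auto simp: T_def)
      then have nT: "n * T \<le> 8" using R by simp
      have WT: "W * T \<le> 8 * G"
      proof -
        have "W * T \<le> (n * G) * T" using nn by (intro mult_right_mono) auto
        also have "\<dots> = (n * T) * G" by simp
        also have "\<dots> \<le> 8 * G" using nT nn by (intro mult_right_mono) auto
        finally show ?thesis .
      qed
      have "W * (a * T + n * T\<^sup>2) + 2 * G * (n * T) = a * (W * T) + (W * T) * (n * T) + 2 * G * (n * T)"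
        by (simp add: power2_eq_square algebra_simps)
      also have "\<dots> \<le> a * (8 * G) + (8 * G) * 8 + 2 * G * 8"
      proof -
        have "a * (W * T) \<le> a * (8 * G)" using WT a(2) by (rule mult_left_mono)
        moreover have "(W * T) * (n * T) \<le> (8 * G) * 8" by (rule mult_mono[OF WT nT]) (use nn in auto)
        moreover have "2 * G * (n * T) \<le> 2 * G * 8" by (rule mult_left_mono[OF nT]) (use nn in auto)
        ultimately show ?thesis by linarith
      qed
      also have "\<dots> = (80 + 8 * a) * G" by (simp add: algebra_simps)
      finally have b: "W * (a * T + n * T\<^sup>2) + 2 * G * (n * T) \<le> (80 + 8 * a) * G" .
      have e: "(e x)\<^sup>2 \<le> R powr (- a)"
      proof -
        have "R\<^sup>2 \<le> q x" using n(1) by (simp add: q_def n_def)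
        then have "q x powr (- a / 2) \<le> (R\<^sup>2) powr (- a / 2)"
          using R a(2) by (intro powr_mono2') auto
        also have "\<dots> = R powr (- a)" using R by (simp add: powr_powr flip: powr_numeral)
        finally show ?thesis by (simp add: e2)
      qed
      have x64: "1 \<le> 64 * xi 0 (2 * R) x"
      proof -
        have "1/2 \<le> bump 0 (2 * R) x"
        proof -
          have "n / (2 * R)\<^sup>2 \<le> 1/2" using n(2) R by (simp add: power_mult_distrib divide_simps)
          then have "1/2 \<le> 1 - (norm (x - 0))\<^sup>2 / (2 * R)\<^sup>2" by (simp add: n_def)
          then show ?thesis unfolding bump_def by (rule max.coboundedI2)
        qed
        then have "(1/2) ^ 6 \<le> bump 0 (2 * R) x ^ 6" by (intro power_mono) auto
        then show ?thesis by (simp add: xi_def power_divide)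
      qed
      have "(e x)\<^sup>2 * (W * (a * T + n * T\<^sup>2) + 2 * G * (n * T)) \<le> R powr (- a) * ((80 + 8 * a) * G)"
        using b e nn a(2) by (intro mult_mono) auto
      also have "\<dots> \<le> R powr (- a) * ((80 + 8 * a) * G) * (64 * xi 0 (2 * R) x)"
        using mult_left_mono[OF x64, of "R powr (- a) * ((80 + 8 * a) * G)"] nn a(2) by simp
      also have "\<dots> = C * B x" by (simp add: C_def B_def G_def)
      finally show ?thesis .
    qed
    have "?P x = (e x)\<^sup>2 * (W * (n * (k x)\<^sup>2 - 4 * Z * k x) + (2 * G * n * Z * k x - a * G * Z\<^sup>2))"
      unfolding Peq by (simp add: algebra_simps)
    also have "\<dots> \<le> (e x)\<^sup>2 * (W * (- (2 * a - a\<^sup>2 / 4) * (Z\<^sup>2 / Q) + (a * T + n * T\<^sup>2)) + 2 * G * (n * T))"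
      using 1 2 nn by (intro mult_left_mono add_mono) auto
    also have "\<dots> = - (2 * a - a\<^sup>2 / 4) * A x + (e x)\<^sup>2 * (W * (a * T + n * T\<^sup>2) + 2 * G * (n * T))"
    proof -
      have "E * (W * (- c * (Y / Q) + V) + U) = - c * (E * W * Y / Q) + E * (W * V + U)"
        for E c Y V U :: real by (simp add: algebra_simps)
      then show ?thesis unfolding Aeq W_def[symmetric] Z_def[symmetric] Q_def[symmetric] .
    qed
    finally show ?thesis using 3 by linarith
  qed
  have "0 \<le> (LINT x|lborel. ?P x)" by (rule pohozaev_stability[OF dg bs])
  also have "\<dots> \<le> (LINT x|lborel. - (2 * a - a\<^sup>2 / 4) * A x + C * B x)"
  proof (rule integral_mono[OF _ _ P])
    note cont = has_gradD(2)[OF dg] has_gradD(3)[OF de] has_gradD(3)[OF d\<zeta>] has_gradD(3)[OF has_grad_w] cont_gu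
    note bg = bounded_support_common[OF bs bounded_support_grad[OF dg bs]]
    show "integrable lborel ?P"
      by (intro integrable_bounded_support continuous_intros cont bg) simp
    show "integrable lborel (\<lambda>x. - (2 * a - a\<^sup>2 / 4) * A x + C * B x)"
      using iA iB by simp
  qed
  also have "\<dots> = - (2 * a - a\<^sup>2 / 4) * (LINT x|lborel. A x) + C * (LINT x|lborel. B x)"
    using iA iB by simp
  finally have "(2 * a - a\<^sup>2 / 4) * (LINT x|lborel. A x) \<le> C * (LINT x|lborel. B x)"
    by (simp add: algebra_simps)
  then show ?thesis unfolding A_def B_def C_def \<zeta>_def .
qed

lemma eq_origin_if_radial_derivative_eq_0:
  assumes "\<And>x. w x = 0"
  shows "u x = u 0"
proof -
  have l: "((\<lambda>t. t *\<^sub>R x) has_derivative (\<lambda>s. s *\<^sub>R x)) (at t)" for t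
    by (auto intro!: derivative_eq_intros)
  have d: "((\<lambda>t. u (t *\<^sub>R x)) has_real_derivative gu (t *\<^sub>R x) \<bullet> x) (at t)" for t
    using has_derivative_compose[OF l has_gradD(1)[OF grad_u], of t]
    by (auto simp: has_field_derivative_def mult_commute_abs)
  have "u (1 *\<^sub>R x) = u (0 *\<^sub>R x)"
  proof (rule DERIV_isconst_end[of 0 1 "\<lambda>t. u (t *\<^sub>R x)"])
    show "continuous_on {0..1} (\<lambda>t. u (t *\<^sub>R x))"
      by (intro continuous_on_compose2[OF cont_u] continuous_intros) auto
    fix t :: real assume "0 < t"
    then have "gu (t *\<^sub>R x) \<bullet> x = 0" using assms[of "t *\<^sub>R x"] by (simp add: w_def inner_commute)
    then show "((\<lambda>t. u (t *\<^sub>R x)) has_real_derivative 0) (at t)" using d[of t] by simp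
  qed auto
  then show ?thesis by simp
qed

text \<open>The weight \<open>R powr (- a)\<close> with \<open>a = N - 2\<close> exactly compensates
  the growth \<open>R^(N-2)\<close> of the energy bound; since the energy is of smaller order than
  that, the weighted integral of \<open>w\<^sup>2\<close> is arbitrarily small.\<close>

theorem constant_if_dim_le_9:
  assumes "DIM('a) \<le> 9"
  shows "u x = u 0"
proof (rule eq_origin_if_radial_derivative_eq_0)
  fix x :: 'a
  define R1 where "R1 = norm x + 1"
  have R1: "R1 > 0" "norm x < R1" by (auto simp: R1_def intro: add_nonneg_pos)
  have xi1: "xi 0 R1 x > 0"
  proof -
    have "(norm x)\<^sup>2 < R1\<^sup>2" using R1 by (intro power_strict_mono) auto
    then have "bump 0 R1 x > 0" using R1(1) by (simp add: bump_def divide_simps)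
    then show ?thesis by (simp add: xi_def)
  qed
  show "w x = 0"
  proof (cases "DIM('a) \<le> 2")
    case True
    \<comment> \<open>Here \<open>R ^ DIM('a) / R\<^sup>2\<close> is bounded for
      \<open>R \<ge> 1\<close>, so the energy itself tends to 0 and the whole gradient
      vanishes.\<close>
    define I where "I = (LINT x|lborel. (norm (gu x))\<^sup>2 * xi 0 R1 x)"
    have "I \<le> \<epsilon>" if \<epsilon>: "\<epsilon> > 0" for \<epsilon>
    proof -
      obtain R0 where R0: "\<And>R. R \<ge> R0 \<Longrightarrow>
          (LINT x|lborel. (norm (gu x))\<^sup>2 * xi 0 R x) \<le> \<epsilon> * R ^ DIM('a) / R\<^sup>2"
        using energy_decay[OF \<epsilon>] by blast
      define R where "R = Max {R0, R1, 1}"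
      have R: "R \<ge> R0" "R \<ge> R1" "R \<ge> 1" by (auto simp: R_def)
      have "I \<le> (LINT x|lborel. (norm (gu x))\<^sup>2 * xi 0 R x)"
        unfolding I_def
      proof (rule integral_mono)
        show "(norm (gu x))\<^sup>2 * xi 0 R1 x \<le> (norm (gu x))\<^sup>2 * xi 0 R x" for x
          using R R1 unfolding xi_def bump_def
          by (intro mult_left_mono power_mono max.mono diff_left_mono divide_left_mono) auto
      qed (use R R1 in \<open>auto intro!: integrable_xi continuous_intros cont_gu\<close>)
      also have "\<dots> \<le> \<epsilon> * R ^ DIM('a) / R\<^sup>2" by (rule R0[OF R(1)])
      also have "\<dots> \<le> \<epsilon>"
        using power_increasing[OF True R(3)] R(3) \<epsilon> by (simp add: divide_simps)
      finally show ?thesis .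
    qed
    then have "I \<le> 0" using field_le_epsilon[of I 0] by simp
    then have "(norm (gu x))\<^sup>2 * xi 0 R1 x = 0"
      unfolding I_def
    proof (rule continuous_integral_eq_0[rotated 3])
      show "continuous_on UNIV (\<lambda>x. (norm (gu x))\<^sup>2 * xi 0 R1 x)"
        by (intro continuous_intros cont_gu)
      show "bounded_support (\<lambda>x. (norm (gu x))\<^sup>2 * xi 0 R1 x)"
        by (rule bounded_support_subset[OF bounded_support_xi(1)[OF R1(1), of 0]]) simp
      show "0 \<le> (norm (gu x))\<^sup>2 * xi 0 R1 x" for x
        by (intro mult_nonneg_nonneg xi_bounds) simp
    qed
    then show ?thesis using xi1 by (simp add: w_def)
  next
    case False
    define a where "a = real DIM('a) - 2"
    have a: "1 \<le> a" "a \<le> 7" using False assms by (auto simp: a_def)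
    define c where "c = 2 * a - a\<^sup>2 / 4"
    \<comment> \<open>Positive for \<open>0 < a < 8\<close>, that is, in dimensions 3 to 9.\<close>
    have "c = a * (8 - a) / 4" by (simp add: c_def power2_eq_square algebra_simps)
    moreover have "a * (8 - a) > 0" using a by (intro mult_pos_pos) auto
    ultimately have c: "c > 0" by simp
    define p where "p x = (1 + (norm x)\<^sup>2) powr (- a / 2 - 1)" for x :: 'a
    have one: "1 + (norm x)\<^sup>2 > 0" for x :: 'a by (intro add_pos_nonneg) auto
    have cp: "continuous_on UNIV p"
      unfolding p_def using one by (intro continuous_intros) (auto simp: less_imp_neq[symmetric])
    have cw: "continuous_on UNIV w" by (rule has_gradD(3)[OF has_grad_w])
    define I where "I = (LINT x|lborel. p x * (w x)\<^sup>2 * xi 0 R1 x)"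
    define K where "K = (80 + 8 * a) * 64 * 2 ^ DIM('a) / 4"
    have K: "K > 0" using a by (simp add: K_def)
    have "I \<le> \<epsilon>" if \<epsilon>: "\<epsilon> > 0" for \<epsilon>
    proof -
      have "\<epsilon> * c / K > 0" using \<epsilon> c K by simp
      from energy_decay[OF this] obtain R0 where R0: "\<And>R. R \<ge> R0 \<Longrightarrow>
          (LINT x|lborel. (norm (gu x))\<^sup>2 * xi 0 R x) \<le> \<epsilon> * c / K * R ^ DIM('a) / R\<^sup>2"
        by blast
      define R where "R = Max {R0, R1, 1}"
      have R: "R \<ge> R0" "R \<ge> R1" "R \<ge> 1" by (auto simp: R_def)
      define \<zeta> where "\<zeta> x = smoothstep (2 - (norm x)\<^sup>2 / R\<^sup>2)" for x :: 'a
      have "I \<le> (LINT x|lborel. p x * (w x)\<^sup>2 * (\<zeta> x)\<^sup>2)"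
        unfolding I_def
      proof (rule integral_mono)
        show "integrable lborel (\<lambda>x. p x * (w x)\<^sup>2 * xi 0 R1 x)"
          by (intro integrable_xi R1 continuous_intros cp cw)
        show "integrable lborel (\<lambda>x. p x * (w x)\<^sup>2 * (\<zeta> x)\<^sup>2)"
        proof (rule integrable_bounded_support)
          show "continuous_on UNIV (\<lambda>x. p x * (w x)\<^sup>2 * (\<zeta> x)\<^sup>2)"
            unfolding \<zeta>_def divide_inverse by (intro continuous_intros cp cw)
          show "bounded_support (\<lambda>x. p x * (w x)\<^sup>2 * (\<zeta> x)\<^sup>2)"
          proof (rule bounded_supportI[of "2 * R"])
            fix x :: 'a assume "2 * R < norm x"
            then have "(2 * R)\<^sup>2 \<le> (norm x)\<^sup>2" using R by (intro power_mono) auto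
            then have "2 * R\<^sup>2 \<le> (norm x)\<^sup>2"
              by (simp add: power_mult_distrib) (use zero_le_power2[of R] in linarith)
            then have "2 \<le> (norm x)\<^sup>2 / R\<^sup>2" using R by (simp add: le_divide_eq)
            then show "p x * (w x)\<^sup>2 * (\<zeta> x)\<^sup>2 = 0" by (simp add: \<zeta>_def smoothstep_eq_0)
          qed
        qed
        show "p x * (w x)\<^sup>2 * xi 0 R1 x \<le> p x * (w x)\<^sup>2 * (\<zeta> x)\<^sup>2" for x
        proof (cases "norm x \<le> R1")
          case True
          then have "(norm x)\<^sup>2 \<le> R\<^sup>2" using R by (intro power_mono) auto
          then have "\<zeta> x = 1" using R by (simp add: \<zeta>_def smoothstep_eq_1 divide_simps)
          then show ?thesis using xi_bounds(2)[of 0 R1 x] by (intro mult_left_mono) (auto simp: p_def)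
        next
          case False
          then show ?thesis using R1 by (simp add: xi_eq_0 p_def)
        qed
      qed
      then have "c * I \<le> c * (LINT x|lborel. p x * (w x)\<^sup>2 * (\<zeta> x)\<^sup>2)" using c by simp
      also have "\<dots> \<le> (80 + 8 * a) * 64 * R powr (- a) * (LINT x|lborel. (norm (gu x))\<^sup>2 * xi 0 (2 * R) x)"
        unfolding c_def p_def \<zeta>_def
        by (rule radial_derivative_estimate) (use a R in \<open>auto simp: a_def\<close>)
      also have "\<dots> \<le> (80 + 8 * a) * 64 * R powr (- a) * (\<epsilon> * c / K * (2 * R) ^ DIM('a) / (2 * R)\<^sup>2)"
        using R0[of "2 * R"] R a by (intro mult_left_mono) auto
      also have "\<dots> = K * (\<epsilon> * c / K) * (R powr (- a) * (R ^ DIM('a) / R\<^sup>2))"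
        by (simp add: K_def power_mult_distrib)
      also have "R powr (- a) * (R ^ DIM('a) / R\<^sup>2) = 1"
      proof -
        have "R powr a = R ^ DIM('a) / R\<^sup>2"
          using R by (simp add: a_def powr_diff powr_realpow)
        then show ?thesis using R by (simp add: powr_minus)
      qed
      finally have "c * I \<le> c * \<epsilon>" using K by (simp add: mult.commute)
      then show ?thesis using c by simp
    qed
    then have "I \<le> 0" using field_le_epsilon[of I 0] by simp
    then have "p x * (w x)\<^sup>2 * xi 0 R1 x = 0"
      unfolding I_def
    proof (rule continuous_integral_eq_0[rotated 3])
      show "continuous_on UNIV (\<lambda>x. p x * (w x)\<^sup>2 * xi 0 R1 x)"
        by (intro continuous_intros cp cw)
      show "bounded_support (\<lambda>x. p x * (w x)\<^sup>2 * xi 0 R1 x)"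
        by (rule bounded_support_subset[OF bounded_support_xi(1)[OF R1(1), of 0]]) simp
      show "0 \<le> p x * (w x)\<^sup>2 * xi 0 R1 x" for x
        by (intro mult_nonneg_nonneg xi_bounds) (simp_all add: p_def)
    qed
    then show ?thesis using xi1 one[of x] by (simp add: p_def)
  qed
qed

end

section \<open>The nonlinearity and the weighted test function\<close>

lemma mono_if_deriv_nonneg:
  fixes g g' :: "real \<Rightarrow> real"
  assumes "a \<le> b" "\<And>x. a \<le> x \<Longrightarrow> x \<le> b \<Longrightarrow> (g has_real_derivative g' x) (at x)"
    "\<And>x. a \<le> x \<Longrightarrow> x \<le> b \<Longrightarrow> 0 \<le> g' x"
  shows "g a \<le> g b"
  using assms(1) by (rule DERIV_nonneg_imp_nondecreasing) (use assms(2,3) in blast)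

lemma continuous_on_if_has_real_derivative:
  fixes g g' :: "real \<Rightarrow> real"
  assumes "\<And>v. v \<in> A \<Longrightarrow> (g has_real_derivative g' v) (at v)"
  shows "continuous_on A g"
  using assms by (meson DERIV_continuous_on has_field_derivative_at_within)

text \<open>Comparison from the endpoint 0, where the functions have a limit but need not be
  continuous or differentiable. Most inequalities between \<open>f\<close>, \<open>F\<close> and
  their derived quantities are reduced to their derivatives in this way.\<close>

lemma nonneg_if_deriv_nonneg_at_right_0:
  fixes D D' :: "real \<Rightarrow> real"
  assumes "\<And>v. 0 < v \<Longrightarrow> v \<le> M \<Longrightarrow> (D has_real_derivative D' v) (at v)"
    and "\<And>v. 0 < v \<Longrightarrow> v \<le> M \<Longrightarrow> 0 \<le> D' v"
    and "(D \<longlongrightarrow> 0) (at_right 0)" "0 < v" "v \<le> M"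
  shows "0 \<le> D v"
proof -
  have le: "D t \<le> D v" if "0 < t" "t < v" for t
    by (rule mono_if_deriv_nonneg[of t v D D']) (use that assms in auto)
  have "\<forall>\<^sub>F t in at_right 0. D t \<le> D v"
    unfolding eventually_at_right_field using assms(4) le by blast
  then show ?thesis using tendsto_upperbound[OF assms(3)] by auto
qed

lemma antiderivative_from_0:
  fixes P :: "real \<Rightarrow> real"
  assumes P: "continuous_on {0<..} P" "(P \<longlongrightarrow> 0) (at_right 0)"
  shows "\<exists>A. (\<forall>v>0. (A has_real_derivative P v) (at v)) \<and> (A \<longlongrightarrow> 0) (at_right 0)"
proof -
  \<comment> \<open>\<open>P\<close> is arbitrary at and below 0; the extension by 0 is continuous
    on \<open>{0..b}\<close> because \<open>P\<close> tends to 0.\<close>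
  define Q where "Q v = (if v \<le> 0 then 0 else P v)" for v
  have c: "continuous_on {0..b} Q" for b
    unfolding continuous_on_eq_continuous_within
  proof
    fix v assume v: "v \<in> {0..b}"
    show "continuous (at v within {0..b}) Q"
    proof (cases "v = 0")
      case True
      have "(Q \<longlongrightarrow> 0) (at_right 0)"
        by (rule Lim_transform_eventually[OF P(2)])
          (auto simp: Q_def eventually_at_right_field intro!: exI[of _ 1])
      moreover have "at 0 within {0..b} \<le> at_right 0"
        unfolding at_within_def by (intro inf_mono) auto
      ultimately have "(Q \<longlongrightarrow> 0) (at 0 within {0..b})" by (rule tendsto_mono[rotated])
      then show ?thesis using True by (simp add: continuous_within Q_def)
    next
      case False
      then have "v > 0" using v by simp
      have "(P \<longlongrightarrow> P v) (at v)"
        using P(1) \<open>v > 0\<close> by (simp add: continuous_on_eq_continuous_at isCont_def)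
      then have "(Q \<longlongrightarrow> P v) (at v)"
        by (rule Lim_transform_within_open[where s = "{0<..}"])
          (use \<open>v > 0\<close> in \<open>auto simp: Q_def\<close>)
      then have "isCont Q v" using \<open>v > 0\<close> by (simp add: isCont_def Q_def)
      then show ?thesis by (rule continuous_at_imp_continuous_at_within)
    qed
  qed
  define A where "A v = integral {0..v} Q" for v
  have "(A has_real_derivative P v) (at v)" if "v > 0" for v
  proof -
    have "(A has_real_derivative Q v) (at v within {0..v+1})"
      unfolding A_def by (rule integral_has_real_derivative[OF c]) (use that in auto)
    moreover have "at v within {0..v+1} = at v"
      by (rule at_within_interior) (use that in simp)
    ultimately show ?thesis using that by (simp add: Q_def)
  qed
  moreover have "(A \<longlongrightarrow> 0) (at_right 0)"
  proof -
    have "(A has_real_derivative Q 0) (at 0 within {0..1})"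
      unfolding A_def by (rule integral_has_real_derivative[OF c]) auto
    then have "continuous (at 0 within {0..1}) A" by (rule DERIV_continuous)
    then have "(A \<longlongrightarrow> 0) (at 0 within {0..1})" by (simp add: continuous_within A_def)
    then show ?thesis by (simp add: at_within_Icc_at_right)
  qed
  ultimately show ?thesis by blast
qed

lemma dyadic_sum_le:
  fixes t :: "nat \<Rightarrow> real"
  assumes "\<And>i. t (Suc i) = t i / 2" "0 \<le> t 0" "0 \<le> v"
  shows "(\<Sum>i\<le>n. if t i \<le> v then t i else 0) \<le> 2 * v"
proof -
  have t0: "0 \<le> t i" for i
  proof (induction i)
    case (Suc i)
    then show ?case using assms(1)[of i] by simp
  qed (rule assms(2))
  \<comment> \<open>The term \<open>- t n\<close> pays for the next summand \<open>t n / 2\<close>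
    and leaves \<open>- t (Suc n)\<close>, which makes the induction close.\<close>
  have "(\<Sum>i\<le>n. if t i \<le> v then t i else 0) \<le> (if t n \<le> v then 2 * v - t n else 0)"
  proof (induction n)
    case (Suc n)
    show ?case
      using Suc.IH t0[of n] assms(1)[of n] by (auto split: if_splits)
  qed auto
  also have "\<dots> \<le> 2 * v" using t0[of n] assms(3) by auto
  finally show ?thesis .
qed

lemma dyadic_level:
  fixes v M :: real
  assumes "0 < v" "v \<le> M" "M / 2 ^ n \<le> v"
  shows "\<exists>i\<le>n. M / 2 ^ i \<le> v \<and> v \<le> 2 * (M / 2 ^ i)"
proof -
  define i where "i = (LEAST i. M / 2 ^ i \<le> v)"
  have i: "M / 2 ^ i \<le> v" unfolding i_def by (rule LeastI[of _ n]) (rule assms(3))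
  have "i \<le> n" unfolding i_def by (rule Least_le) (rule assms(3))
  moreover have "v \<le> 2 * (M / 2 ^ i)"
  proof (cases i)
    case 0
    then show ?thesis using assms by simp
  next
    case (Suc j)
    then have "\<not> M / 2 ^ j \<le> v" using not_less_Least[of j "\<lambda>i. M / 2 ^ i \<le> v"] by (simp add: i_def)
    then show ?thesis using Suc by simp
  qed
  ultimately show ?thesis using i by blast
qed

text \<open>The weight behaves like \<open>z\<^bsup>\<mu>\<^esup>\<close> near \<open>0\<close> but is flat for \<open>z\<close> much larger than \<open>z1\<close>, where no
  good bound on \<open>q\<close> is available.\<close>

definition weight :: "real \<Rightarrow> real \<Rightarrow> real \<Rightarrow> real" where
  "weight z1 \<mu> z = (z / (z1 + z)) powr \<mu>"

text \<open>\<open>rho\<close> bounds \<open>1/q\<close> on all levels, \<open>C1\<close> bounds the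
  elasticity \<open>v F / f\<close>, and together they give doubling. \<open>mu_theta\<close> is the
  condition under which \<open>B\<close> is nondecreasing; it is required up to \<open>M\<close>,
  which the flattening of the weight makes attainable.\<close>

locale growth =
  fixes f F F2 :: "real \<Rightarrow> real" and M \<rho> C1 \<mu> z1 \<theta> :: real
  assumes M_pos: "0 < M"
    and f_deriv': "\<And>v. 0 < v \<Longrightarrow> (f has_real_derivative F v) (at v)"
    and F_deriv: "\<And>v. 0 < v \<Longrightarrow> (F has_real_derivative F2 v) (at v)"
    and F2_cont: "continuous_on {0<..} F2"
    and F2_nonneg: "\<And>v. 0 < v \<Longrightarrow> 0 \<le> F2 v"
    and F_pos: "\<And>v. 0 < v \<Longrightarrow> 0 < F v"
    and f_pos: "\<And>v. 0 < v \<Longrightarrow> 0 < f v"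
    and f_lim: "(f \<longlongrightarrow> 0) (at_right 0)"
    and F_lim: "(F \<longlongrightarrow> 0) (at_right 0)"
    and rho: "0 \<le> \<rho>" "\<And>v. 0 < v \<Longrightarrow> v \<le> M \<Longrightarrow> f v * F2 v \<le> \<rho> * (F v)\<^sup>2"
    and C1: "0 < C1" "\<And>v. 0 < v \<Longrightarrow> v \<le> M \<Longrightarrow> v * F v \<le> C1 * f v"
    and mu: "0 \<le> \<mu>" "0 < z1" "0 \<le> \<theta>" "\<theta> < 1"
    and mu_theta: "\<And>v. 0 < v \<Longrightarrow> v \<le> M \<Longrightarrow> (\<mu> * (z1 / (z1 + F v)))\<^sup>2 * (f v * F2 v) \<le> \<theta> * (F v)\<^sup>2"
begin

section \<open>Convexity and doubling of the nonlinearity\<close>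

lemma f_cont: "continuous_on {0<..} f"
  by (rule continuous_on_if_has_real_derivative[of _ f F]) (use f_deriv' in auto)

lemma F_cont': "continuous_on {0<..} F"
  by (rule continuous_on_if_has_real_derivative[of _ F F2]) (use F_deriv in auto)

lemma F_mono: "0 < a \<Longrightarrow> a \<le> b \<Longrightarrow> F a \<le> F b"
  by (rule mono_if_deriv_nonneg[of a b F F2]) (use F_deriv F2_nonneg in auto)

lemma f_mono: "0 < a \<Longrightarrow> a \<le> b \<Longrightarrow> f a \<le> f b"
  by (rule mono_if_deriv_nonneg[of a b f F]) (use f_deriv' F_pos in \<open>auto intro: less_imp_le\<close>)

lemma tendsto_ident_0: "((\<lambda>v::real. v) \<longlongrightarrow> 0) (at_right 0)"
  by (rule tendsto_ident_at)

lemma f_le: assumes "0 < v" shows "f v \<le> v * F v"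
proof -
  have "0 \<le> v * F v - f v"
  proof (rule nonneg_if_deriv_nonneg_at_right_0[of v "\<lambda>v. v * F v - f v" "\<lambda>v. v * F2 v"])
    show "((\<lambda>v. v * F v - f v) has_real_derivative t * F2 t) (at t)" if "0 < t" for t
      by (auto intro!: derivative_eq_intros F_deriv f_deriv' that)
    show "((\<lambda>v. v * F v - f v) \<longlongrightarrow> 0) (at_right 0)"
      using tendsto_diff[OF tendsto_mult[OF tendsto_ident_0 F_lim] f_lim] by simp
  qed (use assms F2_nonneg in auto)
  then show ?thesis by simp
qed

lemma f_scale: assumes "0 < t" "t \<le> v" shows "f t \<le> t / v * f v"
proof -
  have "f t / t \<le> f v / v"
  proof (rule DERIV_nonneg_imp_nondecreasing[OF assms(2)])
    fix x assume "t \<le> x" "x \<le> v"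
    then have x: "0 < x" using assms by simp
    show "\<exists>y. ((\<lambda>v. f v / v) has_real_derivative y) (at x) \<and> 0 \<le> y"
    proof (intro exI conjI)
      show "((\<lambda>v. f v / v) has_real_derivative (x * F x - f x) / x\<^sup>2) (at x)"
        using x by (auto intro!: derivative_eq_intros f_deriv' simp: power2_eq_square)
      show "0 \<le> (x * F x - f x) / x\<^sup>2" using f_le[OF x] by simp
    qed
  qed
  then show ?thesis using assms by (simp add: field_simps)
qed

lemma tangent: assumes "0 < a" "a \<le> v" shows "f a + F a * (v - a) \<le> f v"
proof -
  have "f a - F a * a \<le> f v - F a * v"
  proof (rule DERIV_nonneg_imp_nondecreasing[OF assms(2)])
    fix x assume "a \<le> x" "x \<le> v"
    then show "\<exists>y. ((\<lambda>v. f v - F a * v) has_real_derivative y) (at x) \<and> 0 \<le> y"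
      using assms F_mono[of a x] by (intro exI[of _ "F x - F a"])
        (auto intro!: derivative_eq_intros f_deriv')
  qed
  then show ?thesis by (simp add: algebra_simps)
qed

definition lam :: real where "lam = \<rho> * C1"

lemma lam_nonneg: "0 \<le> lam" using rho C1 by (simp add: lam_def)

text \<open>\<open>rho\<close> and \<open>C1\<close> combine to \<open>v F2 \<le> lam F\<close>, so
  that \<open>F t * t powr (- lam)\<close> is nonincreasing.\<close>

lemma F_doubling:
  assumes "0 < \<kappa>" "\<kappa> \<le> 1" "0 < t" "t \<le> M"
  shows "\<kappa> powr lam * F t \<le> F (\<kappa> * t)"
proof -
  have F2le: "v * F2 v \<le> lam * F v" if "0 < v" "v \<le> M" for v
  proof -
    have "F v * (v * F2 v) \<le> C1 * (f v * F2 v)"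
      using mult_right_mono[OF C1(2)[OF that] F2_nonneg[OF that(1)]] by (simp add: mult_ac)
    also have "\<dots> \<le> C1 * (\<rho> * (F v)\<^sup>2)" using rho(2)[OF that] C1(1) by (intro mult_left_mono) auto
    also have "\<dots> = F v * (lam * F v)" by (simp add: lam_def power2_eq_square)
    finally show ?thesis using F_pos[OF that(1)] by simp
  qed
  have "F t * t powr (- lam) \<le> F (\<kappa> * t) * (\<kappa> * t) powr (- lam)"
  proof (rule DERIV_nonpos_imp_nonincreasing[of "\<kappa> * t" t "\<lambda>t. F t * t powr (- lam)"])
    show "\<kappa> * t \<le> t" using assms by (simp add: mult_le_cancel_right1)
    fix x assume "\<kappa> * t \<le> x" "x \<le> t"
    moreover have "0 < \<kappa> * t" using assms by simp
    ultimately have x: "0 < x" "x \<le> M" using assms by linarith+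
    show "\<exists>y. ((\<lambda>t. F t * t powr (- lam)) has_real_derivative y) (at x) \<and> y \<le> 0"
    proof (intro exI conjI)
      show "((\<lambda>t. F t * t powr (- lam)) has_real_derivative x powr (- lam - 1) * (x * F2 x - lam * F x)) (at x)"
        using x by (auto intro!: derivative_eq_intros F_deriv simp: powr_diff powr_minus field_simps)
      show "x powr (- lam - 1) * (x * F2 x - lam * F x) \<le> 0"
        using F2le[OF x] by (intro mult_nonneg_nonpos) auto
    qed
  qed
  then have "F t * t powr (- lam) \<le> F (\<kappa> * t) * (\<kappa> powr (- lam) * t powr (- lam))"
    using assms by (simp add: powr_mult)
  then have "F t \<le> F (\<kappa> * t) * \<kappa> powr (- lam)" using assms by simp
  then show ?thesis using assms by (simp add: powr_minus field_simps)
qed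

text \<open>Bounded below by \<open>t * F t\<close> and not only by \<open>f t\<close>: the spare
  factor \<open>F t\<close> is what puts the square of \<open>F\<close> into
  \<open>B_coercive\<close>.\<close>

lemma f_doubling:
  assumes "0 < \<kappa>" "\<kappa> \<le> 1" "0 < t" "t \<le> M"
  shows "\<kappa> powr (1 + lam) / C1 * (t * F t) \<le> f (\<kappa> * t)"
proof -
  have "\<kappa> * t \<le> t" using assms by (simp add: mult_left_le_one_le)
  from order_trans[OF this assms(4)] have k: "0 < \<kappa> * t" "\<kappa> * t \<le> M" using assms by simp_all
  have "\<kappa> powr (1 + lam) * (t * F t) = (\<kappa> * t) * (\<kappa> powr lam * F t)"
    using assms by (simp add: powr_add)
  also have "\<dots> \<le> (\<kappa> * t) * F (\<kappa> * t)" using k F_doubling[OF assms] by (intro mult_left_mono) auto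
  also have "\<dots> \<le> C1 * f (\<kappa> * t)" by (rule C1(2)[OF k])
  finally show ?thesis using C1(1) by (simp add: field_simps)
qed

section \<open>The weight as a function of the level\<close>

definition chi :: "real \<Rightarrow> real" where "chi v = weight z1 \<mu> (F v)"

text \<open>The factor \<open>z1 / (z1 + F v)\<close> lowers the effective exponent from
  \<open>\<mu>\<close>, where \<open>F\<close> is small, to almost 0 where \<open>F\<close> is
  large.\<close>

definition chi' :: "real \<Rightarrow> real" where
  "chi' v = chi v * (\<mu> * (z1 / (z1 + F v))) * F2 v / F v"

lemma z1_plus_F_pos: "0 < v \<Longrightarrow> 0 < z1 + F v" using mu F_pos by (simp add: add_pos_pos)

lemma chi_deriv: assumes "0 < v" shows "(chi has_real_derivative chi' v) (at v)"
proof -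
  have Fp: "F v > 0" "z1 + F v > 0" using F_pos z1_plus_F_pos assms by auto
  have q: "((\<lambda>v. F v / (z1 + F v)) has_real_derivative F2 v * z1 / (z1 + F v)\<^sup>2) (at v)"
    using Fp by (auto intro!: derivative_eq_intros F_deriv assms simp: power2_eq_square algebra_simps)
  have "((\<lambda>v. (F v / (z1 + F v)) powr \<mu>) has_real_derivative
      \<mu> * (F v / (z1 + F v)) powr (\<mu> - 1) * (F2 v * z1 / (z1 + F v)\<^sup>2)) (at v)"
    by (rule DERIV_chain2[where f = "\<lambda>z. z powr \<mu>", OF has_real_derivative_powr q]) (use Fp in simp)
  moreover have "\<mu> * (F v / (z1 + F v)) powr (\<mu> - 1) * (F2 v * z1 / (z1 + F v)\<^sup>2) = chi' v"
    using Fp by (simp add: chi'_def chi_def weight_def powr_diff power2_eq_square mult_ac)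
  ultimately show ?thesis by (simp add: chi_def[abs_def] weight_def)
qed

lemma chi_pos: "0 < v \<Longrightarrow> 0 < chi v"
  using F_pos[of v] z1_plus_F_pos[of v] by (simp add: chi_def weight_def)

lemma chi_le_1: "0 < v \<Longrightarrow> chi v \<le> 1"
  using F_pos[of v] z1_plus_F_pos[of v] mu unfolding chi_def weight_def
  by (intro powr_le1) (auto simp: divide_simps)

lemma chi_le: "0 < v \<Longrightarrow> chi v \<le> (F v / z1) powr \<mu>"
  using F_pos[of v] z1_plus_F_pos[of v] mu unfolding chi_def weight_def
  by (intro powr_mono2 divide_left_mono) auto

lemma chi'_nonneg: "0 < v \<Longrightarrow> 0 \<le> chi' v"
  using F_pos[of v] z1_plus_F_pos[of v] mu chi_pos[of v] F2_nonneg[of v] by (simp add: chi'_def)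

lemma chi_mono: "0 < a \<Longrightarrow> a \<le> b \<Longrightarrow> chi a \<le> chi b"
  by (rule mono_if_deriv_nonneg[of a b chi chi']) (use chi_deriv chi'_nonneg in auto)

lemma chi_doubling:
  assumes "0 < \<kappa>" "\<kappa> \<le> 1" "0 < t" "t \<le> M"
  shows "\<kappa> powr (lam * \<mu>) * chi t \<le> chi (\<kappa> * t)"
proof -
  let ?k = "\<kappa> powr lam" and ?z = "F t"
  have z: "0 < ?z" "0 < z1 + ?z" "0 < ?k" "?k \<le> 1"
    using F_pos[OF assms(3)] z1_plus_F_pos[OF assms(3)] assms(1,2) lam_nonneg by (simp_all add: powr_le1)
  have kt: "0 < \<kappa> * t" using assms by simp
  have "?k * (?z / (z1 + ?z)) \<le> (?k * ?z) / (z1 + ?k * ?z)"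
  proof -
    have "z1 + ?k * ?z \<le> z1 + ?z" using z by (simp add: mult_left_le_one_le)
    moreover have "0 < z1 + ?k * ?z" using z mu by (simp add: add_pos_pos)
    ultimately have "(?k * ?z) / (z1 + ?z) \<le> (?k * ?z) / (z1 + ?k * ?z)"
      using z by (intro divide_left_mono) auto
    then show ?thesis by simp
  qed
  also have "\<dots> \<le> F (\<kappa> * t) / (z1 + F (\<kappa> * t))"
  proof -
    have "?k * ?z \<le> F (\<kappa> * t)" by (rule F_doubling[OF assms])
    moreover have "0 < z1 + ?k * ?z" using z mu by (simp add: add_pos_pos)
    ultimately show ?thesis
      using z1_plus_F_pos[OF kt] mu by (simp add: divide_simps algebra_simps)
  qed
  finally have "(?k * (?z / (z1 + ?z))) powr \<mu> \<le> (F (\<kappa> * t) / (z1 + F (\<kappa> * t))) powr \<mu>"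
    using z mu by (intro powr_mono2) auto
  moreover have "(?k * (?z / (z1 + ?z))) powr \<mu> = \<kappa> powr (lam * \<mu>) * chi t"
    unfolding chi_def weight_def using z by (subst powr_mult) (auto simp: powr_powr)
  ultimately show ?thesis by (simp add: chi_def weight_def)
qed

section \<open>The test function and the primitive of its squared derivative\<close>

definition psi' :: "real \<Rightarrow> real" where "psi' v = F v * chi v + f v * chi' v"

lemma psi_deriv: "0 < v \<Longrightarrow> ((\<lambda>v. f v * chi v) has_real_derivative psi' v) (at v)"
  unfolding psi'_def by (auto intro!: derivative_eq_intros f_deriv' chi_deriv)

definition Cpsi :: real where "Cpsi = 1 + \<mu> * \<rho>"

lemma Cpsi: "1 \<le> Cpsi" using mu rho by (simp add: Cpsi_def)

lemma f_chi'_le: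
  assumes "0 < v" "v \<le> M"
  shows "f v * chi' v \<le> \<mu> * \<rho> * (F v * chi v)"
proof -
  have Fp: "F v > 0" "z1 + F v > 0" using F_pos z1_plus_F_pos assms by auto
  have k: "z1 / (z1 + F v) \<le> 1" "0 \<le> z1 / (z1 + F v)" using Fp mu by (auto simp: divide_simps)
  have "f v * chi' v = (chi v * \<mu> / F v) * ((z1 / (z1 + F v)) * (f v * F2 v))"
    by (simp add: chi'_def mult_ac)
  also have "\<dots> \<le> (chi v * \<mu> / F v) * (1 * (\<rho> * (F v)\<^sup>2))"
  proof (rule mult_left_mono)
    show "(z1 / (z1 + F v)) * (f v * F2 v) \<le> 1 * (\<rho> * (F v)\<^sup>2)"
      by (rule mult_mono[OF k(1) rho(2)[OF assms]]) (use k f_pos[of v] F2_nonneg[of v] assms in auto)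
  qed (use chi_pos[of v] mu Fp assms in auto)
  also have "\<dots> = \<mu> * \<rho> * (F v * chi v)" using Fp by (simp add: power2_eq_square)
  finally show ?thesis .
qed

lemma psi'_bounds:
  assumes "0 < v" "v \<le> M"
  shows "0 \<le> psi' v" "psi' v \<le> Cpsi * (F v * chi v)"
  using f_chi'_le[OF assms] F_pos[OF assms(1)] chi_pos[OF assms(1)] f_pos[OF assms(1)] chi'_nonneg[OF assms(1)]
  by (auto simp: psi'_def Cpsi_def algebra_simps)

lemma chi_cont: "continuous_on {0<..} chi"
  by (rule continuous_on_if_has_real_derivative[of _ chi chi']) (use chi_deriv in auto)

lemma psi'_cont: "continuous_on {0<..} psi'"
  unfolding psi'_def chi'_def using F_pos z1_plus_F_pos
  by (intro continuous_intros f_cont F_cont' F2_cont chi_cont) (auto simp: less_imp_neq[symmetric])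

lemma eventually_small: "\<forall>\<^sub>F v in at_right 0. 0 < v \<and> v \<le> M"
  unfolding eventually_at_right_field using M_pos by (intro exI[of _ M]) auto

lemma lim_bounded_mult:
  fixes g h :: "real \<Rightarrow> real"
  assumes "(g \<longlongrightarrow> 0) (at_right 0)" "\<And>v. 0 < v \<Longrightarrow> v \<le> M \<Longrightarrow> \<bar>h v\<bar> \<le> C * \<bar>g v\<bar>"
  shows "(h \<longlongrightarrow> 0) (at_right (0::real))"
proof (rule Lim_null_comparison)
  show "\<forall>\<^sub>F v in at_right 0. norm (h v) \<le> C * \<bar>g v\<bar>"
    using eventually_small by eventually_elim (use assms(2) in auto)
  show "((\<lambda>v. C * \<bar>g v\<bar>) \<longlongrightarrow> 0) (at_right 0)"
    using tendsto_mult[OF tendsto_const[of C] tendsto_rabs[OF assms(1)]] by simp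
qed

text \<open>The primitive from 0 has no closed form; it is selected by its derivative on positive
  levels and its limit at 0, the only facts that comparison from 0 requires.\<close>

definition Psi :: "real \<Rightarrow> real" where
  "Psi = (SOME A. (\<forall>v>0. (A has_real_derivative (psi' v)\<^sup>2) (at v)) \<and> (A \<longlongrightarrow> 0) (at_right 0))"

lemma Psi: "0 < v \<Longrightarrow> (Psi has_real_derivative (psi' v)\<^sup>2) (at v)" "(Psi \<longlongrightarrow> 0) (at_right 0)"
proof -
  have lim: "((\<lambda>v. (psi' v)\<^sup>2) \<longlongrightarrow> 0) (at_right 0)"
  proof (rule lim_bounded_mult)
    show "((\<lambda>v. (F v)\<^sup>2) \<longlongrightarrow> 0) (at_right 0)"
      using tendsto_power[OF F_lim, of 2] by simp
    fix v assume v: "0 < v" "v \<le> M"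
    have "psi' v \<le> Cpsi * (F v * 1)"
      by (rule order_trans[OF psi'_bounds(2)[OF v]])
        (use chi_le_1[OF v(1)] F_pos[OF v(1)] Cpsi in \<open>intro mult_left_mono, auto\<close>)
    then have "(psi' v)\<^sup>2 \<le> (Cpsi * (F v * 1))\<^sup>2" using psi'_bounds(1)[OF v] by (rule power_mono)
    then show "\<bar>(psi' v)\<^sup>2\<bar> \<le> Cpsi\<^sup>2 * \<bar>(F v)\<^sup>2\<bar>" by (simp add: power_mult_distrib)
  qed
  have cont: "continuous_on {0<..} (\<lambda>v. (psi' v)\<^sup>2)" by (intro continuous_intros psi'_cont)
  have "(\<forall>v>0. (Psi has_real_derivative (psi' v)\<^sup>2) (at v)) \<and> (Psi \<longlongrightarrow> 0) (at_right 0)"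
    unfolding Psi_def by (rule someI_ex[OF antiderivative_from_0[OF cont lim]])
  then show "0 < v \<Longrightarrow> (Psi has_real_derivative (psi' v)\<^sup>2) (at v)" "(Psi \<longlongrightarrow> 0) (at_right 0)" by auto
qed

lemma Ffchi_deriv:
  assumes "0 < v"
  shows "((\<lambda>v. F v * f v * (chi v)\<^sup>2) has_real_derivative
    F2 v * f v * (chi v)\<^sup>2 + (F v)\<^sup>2 * (chi v)\<^sup>2 + 2 * F v * f v * chi v * chi' v) (at v)"
  using assms by (auto intro!: derivative_eq_intros f_deriv' F_deriv chi_deriv simp: power2_eq_square algebra_simps)

lemma Ffchi_lim: "((\<lambda>v. F v * f v * (chi v)\<^sup>2) \<longlongrightarrow> 0) (at_right 0)"
proof (rule lim_bounded_mult)
  show "((\<lambda>v. F v * f v) \<longlongrightarrow> 0) (at_right 0)" using tendsto_mult[OF F_lim f_lim] by simp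
  fix v assume v: "0 < v" "v \<le> M"
  have "(chi v)\<^sup>2 \<le> 1" using chi_le_1[OF v(1)] chi_pos[OF v(1)] by (simp add: power_le_one)
  then show "\<bar>F v * f v * (chi v)\<^sup>2\<bar> \<le> 1 * \<bar>F v * f v\<bar>"
    by (simp add: abs_mult mult_left_le)
qed

text \<open>The square of \<open>psi'\<close> is at most \<open>Cpsi\<^sup>2\<close> times
  \<open>F\<^sup>2 chi\<^sup>2\<close>, which is one of the nonnegative summands in the derivative
  of \<open>F f chi\<^sup>2\<close>; both sides vanish at 0.\<close>

lemma Psi_bounds:
  assumes "0 < v" "v \<le> M"
  shows "0 \<le> Psi v" "Psi v \<le> Cpsi\<^sup>2 * (F v * f v * (chi v)\<^sup>2)"
proof -
  show "0 \<le> Psi v"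
    by (rule nonneg_if_deriv_nonneg_at_right_0[OF Psi(1) _ Psi(2) assms]) auto
  have "0 \<le> Cpsi\<^sup>2 * (F v * f v * (chi v)\<^sup>2) - Psi v"
  proof (rule nonneg_if_deriv_nonneg_at_right_0[OF DERIV_diff[OF DERIV_cmult[OF Ffchi_deriv] Psi(1)] _ _ assms])
    show "((\<lambda>v. Cpsi\<^sup>2 * (F v * f v * (chi v)\<^sup>2) - Psi v) \<longlongrightarrow> 0) (at_right 0)"
      using tendsto_diff[OF tendsto_mult[OF tendsto_const Ffchi_lim] Psi(2)] by simp
    fix v assume v: "0 < v" "v \<le> M"
    have "(psi' v)\<^sup>2 \<le> (Cpsi * (F v * chi v))\<^sup>2" using psi'_bounds[OF v] by (intro power_mono) auto
    also have "\<dots> = Cpsi\<^sup>2 * ((F v)\<^sup>2 * (chi v)\<^sup>2)" by (simp add: power_mult_distrib)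
    also have "\<dots> \<le> Cpsi\<^sup>2 * (F2 v * f v * (chi v)\<^sup>2 + (F v)\<^sup>2 * (chi v)\<^sup>2 + 2 * F v * f v * chi v * chi' v)"
      using F2_nonneg[OF v(1)] f_pos[OF v(1)] F_pos[OF v(1)] chi_pos[OF v(1)] chi'_nonneg[OF v(1)]
      by (intro mult_left_mono) auto
    finally show "0 \<le> Cpsi\<^sup>2 * (F2 v * f v * (chi v)\<^sup>2 + (F v)\<^sup>2 * (chi v)\<^sup>2 + 2 * F v * f v * chi v * chi' v)
      - (psi' v)\<^sup>2" by simp
  qed
  then show "Psi v \<le> Cpsi\<^sup>2 * (F v * f v * (chi v)\<^sup>2)" by simp
qed

text \<open>Testing the equation with \<open>\<Psi>(u)\<close> cancels the gradient term produced by the test function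
  \<open>\<psi>(u)\<close> in the stability inequality; what remains is \<open>f B = F \<psi>\<^sup>2 - f \<Psi>\<close>.\<close>

definition B :: "real \<Rightarrow> real" where "B v = F v * f v * (chi v)\<^sup>2 - Psi v"

text \<open>The square of \<open>psi'\<close> cancels the summands
  \<open>F\<^sup>2 chi\<^sup>2\<close> and \<open>2 F f chi chi'\<close> in the derivative of
  \<open>F f chi\<^sup>2\<close>.\<close>

definition B' :: "real \<Rightarrow> real" where
  "B' v = F2 v * f v * (chi v)\<^sup>2 - (f v * chi' v)\<^sup>2"

lemma B_deriv: "0 < v \<Longrightarrow> (B has_real_derivative B' v) (at v)"
proof -
  assume v: "0 < v"
  have "F2 v * f v * (chi v)\<^sup>2 + (F v)\<^sup>2 * (chi v)\<^sup>2 + 2 * F v * f v * chi v * chi' v - (psi' v)\<^sup>2 = B' v"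
    by (simp add: B'_def psi'_def power2_eq_square algebra_simps)
  then show ?thesis using DERIV_diff[OF Ffchi_deriv[OF v] Psi(1)[OF v]] by (simp add: B_def[abs_def])
qed

text \<open>\<open>(f chi')\<^sup>2\<close> is
  \<open>(\<mu> z1 / (z1 + F))\<^sup>2 * f F2 / F\<^sup>2\<close> times the positive term
  \<open>f F2 chi\<^sup>2\<close>, and \<open>mu_theta\<close> bounds this ratio by
  \<open>\<theta> < 1\<close>.\<close>

lemma B'_ge:
  assumes "0 < v" "v \<le> M"
  shows "(1 - \<theta>) * (f v * F2 v * (chi v)\<^sup>2) \<le> B' v"
proof -
  have Fp: "F v > 0" using F_pos assms by auto
  let ?k = "\<mu> * (z1 / (z1 + F v))" and ?h = "f v * F2 v"
  have h: "0 \<le> ?h" using f_pos[OF assms(1)] F2_nonneg[OF assms(1)] by simp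
  have "(f v * chi' v)\<^sup>2 = (?k\<^sup>2 * ?h) * (?h * (chi v)\<^sup>2) / (F v)\<^sup>2"
    by (simp add: chi'_def power2_eq_square mult_ac)
  also have "\<dots> \<le> (\<theta> * (F v)\<^sup>2) * (?h * (chi v)\<^sup>2) / (F v)\<^sup>2"
    using mu_theta[OF assms] h by (intro divide_right_mono mult_right_mono) auto
  also have "\<dots> = \<theta> * (?h * (chi v)\<^sup>2)" using Fp by simp
  finally show ?thesis by (simp add: B'_def algebra_simps)
qed

lemma B'_nonneg: "0 < v \<Longrightarrow> v \<le> M \<Longrightarrow> 0 \<le> B' v"
  by (rule order_trans[OF _ B'_ge])
    (use f_pos[of v] F2_nonneg[of v] mu in \<open>intro mult_nonneg_nonneg, auto\<close>)

lemma B_lim: "(B \<longlongrightarrow> 0) (at_right 0)"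
  using tendsto_diff[OF Ffchi_lim Psi(2)] by (simp add: B_def[abs_def])

lemma B_nonneg: "0 < v \<Longrightarrow> v \<le> M \<Longrightarrow> 0 \<le> B v"
  by (rule nonneg_if_deriv_nonneg_at_right_0[OF B_deriv B'_nonneg B_lim])

lemma B_mono: "0 < a \<Longrightarrow> a \<le> b \<Longrightarrow> b \<le> M \<Longrightarrow> B a \<le> B b"
  by (rule mono_if_deriv_nonneg[of a b B B']) (use B_deriv B'_nonneg in auto)

text \<open>The power of \<open>1 / K\<close> collects the losses of \<open>f_doubling\<close> and
  of the squared \<open>chi_doubling\<close> between \<open>t\<close> and \<open>t / K\<close>; the
  2 stems from the drop of \<open>F\<close> by one half.\<close>

definition cB :: "real \<Rightarrow> real" where
  "cB K = (1 - \<theta>) * (1 / K) powr (1 + lam + 2 * (lam * \<mu>)) / (2 * C1)"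

lemma cB_pos: "0 < K \<Longrightarrow> 0 < cB K" using mu C1 by (simp add: cB_def)

text \<open>\<open>B'\<close> is at least \<open>F2\<close> times a nondecreasing function.
  Integrated from \<open>t / K\<close> to \<open>t\<close> it yields that function at
  \<open>t / K\<close> times the increment of \<open>F\<close>, which is at least half of
  \<open>F t\<close>; doubling moves the remaining factors back to \<open>t\<close>.\<close>

lemma B_coercive:
  assumes K: "1 \<le> K" and t: "0 < t" "t \<le> v" "v \<le> M" and drop: "F (t / K) \<le> F t / 2"
  shows "cB K * (t * (F t)\<^sup>2 * (chi t)\<^sup>2) \<le> B v"
proof -
  define a where "a = t / K"
  have a: "0 < a" "a \<le> t" "t \<le> M" using K t by (auto simp: a_def divide_le_eq mult_left_le)
  have ak: "a = (1 / K) * t" by (simp add: a_def)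
  have k: "0 < 1 / K" "1 / K \<le> 1" using K by auto
  let ?c = "(1 - \<theta>) * (f a * (chi a)\<^sup>2)"
  have c0: "0 \<le> f a * (chi a)\<^sup>2" using f_pos[OF a(1)] by simp
  have "B a - ?c * F a \<le> B t - ?c * F t"
  proof (rule DERIV_nonneg_imp_nondecreasing[OF a(2)])
    fix x assume "a \<le> x" "x \<le> t"
    then have x: "0 < x" "x \<le> M" "a \<le> x" using a by auto
    have "f a * (chi a)\<^sup>2 \<le> f x * (chi x)\<^sup>2"
      using f_mono[OF a(1) x(3)] chi_mono[OF a(1) x(3)] f_pos[OF a(1)] chi_pos[OF a(1)] f_pos[OF x(1)]
      by (intro mult_mono power_mono) auto
    then have "?c * F2 x \<le> (1 - \<theta>) * (f x * (chi x)\<^sup>2) * F2 x"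
      using F2_nonneg[OF x(1)] mu by (intro mult_right_mono mult_left_mono) auto
    also have "\<dots> \<le> B' x" using B'_ge[OF x(1,2)] by (simp add: mult_ac)
    finally show "\<exists>y. ((\<lambda>v. B v - ?c * F v) has_real_derivative y) (at x) \<and> 0 \<le> y"
      using x by (intro exI[of _ "B' x - ?c * F2 x"]) (auto intro!: derivative_eq_intros B_deriv F_deriv)
  qed
  then have 1: "?c * (F t - F a) \<le> B t"
    using B_nonneg[OF a(1)] a by (simp add: algebra_simps)
  have f2: "(1 / K) powr (1 + lam) / C1 * (t * F t) \<le> f a"
    unfolding ak by (rule f_doubling[OF k t(1) a(3)])
  have "((1 / K) powr (lam * \<mu>) * chi t)\<^sup>2 \<le> (chi a)\<^sup>2"
    unfolding ak using chi_doubling[OF k t(1) a(3)] chi_pos[OF t(1)] by (intro power_mono) auto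
  then have c2: "(1 / K) powr (2 * (lam * \<mu>)) * (chi t)\<^sup>2 \<le> (chi a)\<^sup>2"
  proof -
    have "((1 / K) powr (lam * \<mu>))\<^sup>2 = (1 / K) powr (2 * (lam * \<mu>))"
      by (simp only: power2_eq_square powr_add[symmetric] mult_2)
    then show ?thesis using \<open>((1 / K) powr (lam * \<mu>) * chi t)\<^sup>2 \<le> (chi a)\<^sup>2\<close>
      by (simp only: power_mult_distrib)
  qed
  have Fd: "F t / 2 \<le> F t - F a" using drop by (simp add: a_def)
  have "cB K * (t * (F t)\<^sup>2 * (chi t)\<^sup>2) = (1 - \<theta>) * ((((1 / K) powr (1 + lam) / C1 * (t * F t)))
      * ((1 / K) powr (2 * (lam * \<mu>)) * (chi t)\<^sup>2)) * (F t / 2)"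
    unfolding cB_def powr_add[of "1 / K" "1 + lam"] by (simp add: power2_eq_square mult_ac)
  also have "\<dots> \<le> ?c * (F t - F a)"
    using f2 c2 Fd mu F_pos[OF t(1)] C1(1) t(1) f_pos[OF a(1)]
    by (intro mult_mono mult_left_mono) auto
  also have "\<dots> \<le> B t" by (rule 1)
  also have "\<dots> \<le> B v" by (rule B_mono[OF t])
  finally show ?thesis .
qed

section \<open>The square of the test function, alone and times \<open>F\<close>\<close>

definition X :: "real \<Rightarrow> real" where "X v = (f v * chi v)\<^sup>2"

definition G :: "real \<Rightarrow> real" where "G v = F v * X v"

lemma X_pos: "0 < v \<Longrightarrow> 0 < X v" and G_pos: "0 < v \<Longrightarrow> 0 < G v"
  using f_pos[of v] chi_pos[of v] F_pos[of v] by (auto simp: X_def G_def)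

lemma X_mono: "0 < a \<Longrightarrow> a \<le> b \<Longrightarrow> X a \<le> X b"
  using f_mono[of a b] chi_mono[of a b] f_pos[of a] f_pos[of b] chi_pos[of a]
  unfolding X_def by (intro power_mono mult_mono) auto

lemma G_mono: "0 < a \<Longrightarrow> a \<le> b \<Longrightarrow> G a \<le> G b"
  using F_mono[of a b] X_mono[of a b] F_pos[of a] F_pos[of b] X_pos[of a]
  unfolding G_def by (intro mult_mono) auto

lemma X_cont: "continuous_on {0<..} X" and G_cont: "continuous_on {0<..} G"
  unfolding X_def G_def by (intro continuous_intros f_cont F_cont' chi_cont)+

lemma B_cont: "continuous_on {0<..} B"
  by (rule continuous_on_if_has_real_derivative[of _ B B']) (use B_deriv in auto)

lemma G_lim: "(G \<longlongrightarrow> 0) (at_right 0)"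
proof (rule lim_bounded_mult)
  show "((\<lambda>v. F v * (f v)\<^sup>2) \<longlongrightarrow> 0) (at_right 0)"
    using tendsto_mult[OF F_lim tendsto_power[OF f_lim, of 2]] by simp
  fix v assume v: "0 < v" "v \<le> M"
  have "(chi v)\<^sup>2 \<le> 1" using chi_le_1[OF v(1)] chi_pos[OF v(1)] by (simp add: power_le_one)
  then have "(F v * (f v)\<^sup>2) * (chi v)\<^sup>2 \<le> F v * (f v)\<^sup>2"
    using F_pos[OF v(1)] by (intro mult_left_le) auto
  then show "\<bar>G v\<bar> \<le> 1 * \<bar>F v * (f v)\<^sup>2\<bar>"
    using F_pos[OF v(1)] by (simp add: G_def X_def power_mult_distrib abs_mult mult.assoc)
qed

definition CG :: real where "CG = 1 / ((1/4) powr (lam + 2 * (1 + lam) + 2 * (lam * \<mu>)) / C1\<^sup>2)"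

lemma CG_pos: "0 < CG" using C1 by (simp add: CG_def)

text \<open>The ratio 4 is that of a dyadic level to the largest values assigned to it: one factor 2
  is lost in the transition of the layer, another between consecutive levels.\<close>

lemma G_doubling:
  assumes "0 < t" "t \<le> v" "v \<le> 4 * t" "v \<le> M"
  shows "G v \<le> CG * G t"
proof -
  let ?k = "1/4 :: real"
  have v: "0 < v" and kv: "0 < ?k * v" "?k * v \<le> t" using assms by auto
  have "(?k powr (1 + lam) / C1 * f v)\<^sup>2 \<le> (f (?k * v))\<^sup>2"
  proof (rule power_mono)
    have "?k powr (1 + lam) / C1 * f v \<le> ?k powr (1 + lam) / C1 * (v * F v)"
      using f_le[OF v] C1(1) by (intro mult_left_mono) auto
    also have "\<dots> \<le> f (?k * v)" by (rule f_doubling) (use v assms in auto)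
    finally show "?k powr (1 + lam) / C1 * f v \<le> f (?k * v)" .
  qed (use f_pos[OF v] C1(1) in auto)
  moreover have "(?k powr (lam * \<mu>) * chi v)\<^sup>2 \<le> (chi (?k * v))\<^sup>2"
    by (rule power_mono[OF chi_doubling]) (use v assms chi_pos[OF v] in auto)
  moreover have "?k powr lam * F v \<le> F (?k * v)" by (rule F_doubling) (use v assms in auto)
  ultimately have "(?k powr lam * F v) * ((?k powr (1 + lam) / C1 * f v)\<^sup>2 * (?k powr (lam * \<mu>) * chi v)\<^sup>2)
      \<le> F (?k * v) * ((f (?k * v))\<^sup>2 * (chi (?k * v))\<^sup>2)"
    using F_pos[OF v] F_pos[OF kv(1)] by (intro mult_mono) auto
  also have "\<dots> = G (?k * v)" by (simp add: G_def X_def power_mult_distrib)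
  also have "\<dots> \<le> G t" by (rule G_mono[OF kv])
  also have "(?k powr lam * F v) * ((?k powr (1 + lam) / C1 * f v)\<^sup>2 * (?k powr (lam * \<mu>) * chi v)\<^sup>2)
      = (?k powr lam * (?k powr (1 + lam))\<^sup>2 * (?k powr (lam * \<mu>))\<^sup>2 / C1\<^sup>2) * G v"
    by (simp add: G_def X_def power_mult_distrib power_divide)
  also have "?k powr lam * (?k powr (1 + lam))\<^sup>2 * (?k powr (lam * \<mu>))\<^sup>2 = ?k powr (lam + 2 * (1 + lam) + 2 * (lam * \<mu>))"
    by (simp only: power2_eq_square powr_add[symmetric]) (simp add: algebra_simps)
  finally have "G v / CG \<le> G t" by (simp add: CG_def mult.commute)
  then show ?thesis using CG_pos by (simp add: divide_le_eq mult.commute)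
qed

definition Lf :: "real \<Rightarrow> real" where
  "Lf = (SOME A. (\<forall>v>0. (A has_real_derivative Psi v) (at v)) \<and> (A \<longlongrightarrow> 0) (at_right 0))"

lemma Psi_cont: "continuous_on {0<..} Psi"
  by (rule continuous_on_if_has_real_derivative[of _ Psi "\<lambda>v. (psi' v)\<^sup>2"]) (use Psi(1) in auto)

lemma Lf: "0 < v \<Longrightarrow> (Lf has_real_derivative Psi v) (at v)" "(Lf \<longlongrightarrow> 0) (at_right 0)"
  using someI_ex[OF antiderivative_from_0[OF Psi_cont Psi(2)]] unfolding Lf_def[symmetric] by auto

text \<open>A primitive of \<open>psi psi' - Psi\<close>, the coefficient of the cross term in the
  stability inequality; through it that term becomes an integral against
  \<open>lap_xi\<close>.\<close>

definition Kf :: "real \<Rightarrow> real" where "Kf v = X v / 2 - Lf v"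

definition CK :: real where "CK = (1 + Cpsi\<^sup>2) / 2"

lemma X_deriv: "0 < v \<Longrightarrow> (X has_real_derivative 2 * (f v * chi v) * psi' v) (at v)"
  using DERIV_power[OF psi_deriv, of v 2] by (simp add: X_def[abs_def] mult_ac)

lemma Kf_deriv: "0 < v \<Longrightarrow> (Kf has_real_derivative f v * chi v * psi' v - Psi v) (at v)"
  unfolding Kf_def[abs_def] by (auto intro!: derivative_eq_intros X_deriv Lf(1))

text \<open>By comparison from 0: \<open>Psi\<close> is at most \<open>Cpsi\<^sup>2\<close> times
  \<open>(f chi) (F chi)\<close>, and \<open>F chi \<le> psi'\<close>, so the derivative of
  \<open>Lf\<close> is dominated by that of a multiple of \<open>X\<close>.\<close>

lemma Kf_bound:
  assumes "0 < v" "v \<le> M"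
  shows "\<bar>Kf v\<bar> \<le> CK * X v"
proof -
  have L0: "0 \<le> Lf v"
    by (rule nonneg_if_deriv_nonneg_at_right_0[OF Lf(1) Psi_bounds(1) Lf(2) assms])
  have "0 \<le> Cpsi\<^sup>2 / 2 * X v - Lf v"
  proof (rule nonneg_if_deriv_nonneg_at_right_0[OF DERIV_diff[OF DERIV_cmult[OF X_deriv] Lf(1)] _ _ assms])
    have Xlim: "(X \<longlongrightarrow> 0) (at_right 0)"
    proof (rule lim_bounded_mult)
      show "((\<lambda>v. (f v)\<^sup>2) \<longlongrightarrow> 0) (at_right 0)" using tendsto_power[OF f_lim, of 2] by simp
      fix v assume v: "0 < v" "v \<le> M"
      have "(chi v)\<^sup>2 \<le> 1" using chi_le_1[OF v(1)] chi_pos[OF v(1)] by (simp add: power_le_one)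
      then show "\<bar>X v\<bar> \<le> 1 * \<bar>(f v)\<^sup>2\<bar>" by (simp add: X_def power_mult_distrib mult_left_le)
    qed
    have "((\<lambda>v. Cpsi\<^sup>2 / 2 * X v - Lf v) \<longlongrightarrow> Cpsi\<^sup>2 / 2 * 0 - 0) (at_right 0)"
      by (intro tendsto_diff tendsto_mult tendsto_const Xlim Lf(2))
    then show "((\<lambda>v. Cpsi\<^sup>2 / 2 * X v - Lf v) \<longlongrightarrow> 0) (at_right 0)" by simp
    fix v assume v: "0 < v" "v \<le> M"
    have "Psi v \<le> Cpsi\<^sup>2 * ((f v * chi v) * (F v * chi v))"
      using Psi_bounds(2)[OF v] by (simp add: power2_eq_square mult_ac)
    also have "\<dots> \<le> Cpsi\<^sup>2 * ((f v * chi v) * psi' v)"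
      using f_pos[OF v(1)] chi_pos[OF v(1)] chi'_nonneg[OF v(1)]
      by (intro mult_left_mono) (auto simp: psi'_def)
    finally show "0 \<le> Cpsi\<^sup>2 / 2 * (2 * (f v * chi v) * psi' v) - Psi v" by simp
  qed
  then have "Lf v \<le> Cpsi\<^sup>2 / 2 * X v" by simp
  moreover have "CK * X v = X v / 2 + Cpsi\<^sup>2 / 2 * X v" by (simp add: CK_def algebra_simps add_divide_distrib)
  ultimately show ?thesis
    using L0 X_pos[OF assms(1)] mult_nonneg_nonneg[of "Cpsi\<^sup>2 / 2" "X v"] unfolding Kf_def by simp
qed

lemma CK_pos: "0 < CK" by (simp add: CK_def add_pos_nonneg)

end

section \<open>Stability and averages of superharmonic functions\<close>

text \<open>The cubic spline that is a primitive of \<open>smoothstep\<close>.\<close>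

definition smoothint :: "real \<Rightarrow> real" where
  "smoothint s = 2/3 * (max 0 s ^ 3 - 2 * max 0 (s - 1/2) ^ 3 + max 0 (s - 1) ^ 3)"

lemma has_real_derivative_smoothint: "(smoothint has_real_derivative smoothstep s) (at s)"
proof -
  have p: "((\<lambda>s::real. max 0 (s - c) ^ 3) has_real_derivative 3 * (max 0 (s - c))\<^sup>2) (at s)" for c
  proof -
    have "((\<lambda>s::real. max 0 s ^ 3) has_real_derivative 3 * (max 0 (s - c))\<^sup>2) (at (s - c))"
      using max_power_deriv[of 2 "s - c"] by (simp add: numeral_3_eq_3 numeral_2_eq_2)
    then have "((\<lambda>s. max 0 (s - c) ^ 3) has_real_derivative (3 * (max 0 (s - c))\<^sup>2) * 1) (at s)"
      by (rule DERIV_chain2) (auto intro!: derivative_eq_intros)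
    then show ?thesis by simp
  qed
  have "2/3 * (3 * (max 0 s)\<^sup>2 - 2 * (3 * (max 0 (s - 1/2))\<^sup>2) + 3 * (max 0 (s - 1))\<^sup>2) = smoothstep s"
    by (simp add: smoothstep_def algebra_simps)
  then show ?thesis
    unfolding smoothint_def[abs_def]
    using DERIV_cmult[OF DERIV_add[OF DERIV_diff[OF p[of 0] DERIV_cmult[OF p[of "1/2"], of 2]] p[of 1]], of "2/3"]
    by simp
qed

lemma smoothint_eq_0: "s \<le> 0 \<Longrightarrow> smoothint s = 0"
  by (simp add: smoothint_def)

lemma smoothint_bounds:
  assumes "0 \<le> s"
  shows "0 \<le> smoothint s" "smoothint s \<le> s * smoothstep s"
proof -
  have "smoothint 0 \<le> smoothint s"
    by (rule mono_if_deriv_nonneg[OF assms has_real_derivative_smoothint smoothstep_bounds(1)])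
  then show "0 \<le> smoothint s" by (simp add: smoothint_eq_0)
  have "0 * smoothstep 0 - smoothint 0 \<le> s * smoothstep s - smoothint s"
  proof (rule mono_if_deriv_nonneg[OF assms, of _ "\<lambda>s. s * smoothstep' s"])
    show "((\<lambda>s. s * smoothstep s - smoothint s) has_real_derivative x * smoothstep' x) (at x)" for x
      by (auto intro!: derivative_eq_intros has_real_derivative_smoothstep has_real_derivative_smoothint)
  qed (auto simp: smoothstep'_bounds)
  then show "smoothint s \<le> s * smoothstep s" by (simp add: smoothint_eq_0)
qed

text \<open>A smooth replacement for the indicator of \<open>v > t\<close>; the transition takes
  place between \<open>t\<close> and \<open>2 * t\<close>.\<close>

definition layer :: "real \<Rightarrow> real \<Rightarrow> real" where
  "layer t v = smoothstep ((v - t) / t)"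

lemma layer_bounds: "0 \<le> layer t v" "layer t v \<le> 1"
  by (auto simp: layer_def smoothstep_bounds)

lemma layer_eq_0: "0 < t \<Longrightarrow> v \<le> t \<Longrightarrow> layer t v = 0"
  by (auto simp: layer_def divide_simps intro!: smoothstep_eq_0)

lemma layer_eq_1: "0 < t \<Longrightarrow> 2 * t \<le> v \<Longrightarrow> layer t v = 1"
  by (auto simp: layer_def divide_simps intro!: smoothstep_eq_1)

lemma layer_cont: "0 < t \<Longrightarrow> continuous_on A (layer t)"
  unfolding layer_def by (intro continuous_intros) auto

locale stable_growth = stable_solution u gu f M F + growth f F F2 M \<rho> C1 \<mu> z1 \<theta>
  for u :: "'a::euclidean_space \<Rightarrow> real" and gu :: "'a \<Rightarrow> 'a" and f :: "real \<Rightarrow> real" and M :: real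
    and F F2 :: "real \<Rightarrow> real" and \<rho> C1 \<mu> z1 \<theta> :: real
begin

definition CS :: real where "CS = 216 + lap_const TYPE('a) * CK"

lemma CS_pos: "0 < CS" using CK_pos by (simp add: CS_def add_pos_nonneg)

text \<open>The gradient term \<open>psi'\<^sup>2 |\<nabla>u|\<^sup>2\<close> that the test function
  creates in the stability inequality is exactly that of the equation tested with
  \<open>Psi (u x) * xi p R x\<close>. Once both are subtracted, only terms with derivatives of the
  cut-off face \<open>f B\<close>.\<close>

lemma stability_B:
  assumes R: "R > 0"
  shows "(LINT x|lborel. f (u x) * B (u x) * xi p R x) \<le> CS / R\<^sup>2 * (LINT x|lborel. X (u x) * xi p (2 * R) x)"
proof -
  note cc = cont_compose[OF f_cont] cont_compose[OF F_cont'] cont_compose[OF chi_cont] cont_compose[OF psi'_cont]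
    cont_compose[OF Psi_cont] cont_compose[OF B_cont] cont_compose[OF X_cont] cont_gu
  have g\<psi>: "has_grad (\<lambda>x. f (u x) * chi (u x)) (\<lambda>x. psi' (u x) *\<^sub>R gu x)"
    by (rule has_grad_compose[OF grad_u psi_deriv[OF u_pos]])
      (rule continuous_on_subset[OF psi'_cont], use u_pos in auto)
  have gPsi: "has_grad (\<lambda>x. Psi (u x)) (\<lambda>x. (psi' (u x))\<^sup>2 *\<^sub>R gu x)"
    by (rule has_grad_compose[OF grad_u Psi(1)[OF u_pos]])
      (rule continuous_on_subset[of "{0<..}"], use u_pos psi'_cont in \<open>auto intro!: continuous_intros\<close>)
  have gK: "has_grad (\<lambda>x. Kf (u x)) (\<lambda>x. (f (u x) * chi (u x) * psi' (u x) - Psi (u x)) *\<^sub>R gu x)"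
    by (rule has_grad_compose[OF grad_u Kf_deriv[OF u_pos]])
      (rule continuous_on_subset[of "{0<..}"], use u_pos psi'_cont f_cont chi_cont Psi_cont in \<open>auto intro!: continuous_intros\<close>)
  note cc = cc has_gradD(3)[OF gK]
  note bs = bounded_support_common[OF bounded_support_xi(4)[OF R, of p] bounded_support_xi(5)[OF R, of p]]
  have z: "eta p R x = 0 \<Longrightarrow> xi p R x = 0" "eta p R x = 0 \<Longrightarrow> grad_xi p R x = 0" for x
    by (simp_all add: xi_eq_eta)
  define gz where "gz x = eta p R x *\<^sub>R (psi' (u x) *\<^sub>R gu x) + (f (u x) * chi (u x)) *\<^sub>R grad_eta p R x" for x
  define T1 where "T1 x = (norm (gz x))\<^sup>2 - F (u x) * (f (u x) * chi (u x) * eta p R x)\<^sup>2" for x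
  define T2 where "T2 x = gu x \<bullet> (xi p R x *\<^sub>R ((psi' (u x))\<^sup>2 *\<^sub>R gu x) + Psi (u x) *\<^sub>R grad_xi p R x)
    - f (u x) * (Psi (u x) * xi p R x)" for x
  define T3 where "T3 x = ((f (u x) * chi (u x) * psi' (u x) - Psi (u x)) *\<^sub>R gu x) \<bullet> grad_xi p R x" for x
  define T4 where "T4 x = X (u x) * (norm (grad_eta p R x))\<^sup>2" for x
  define T5 where "T5 x = f (u x) * B (u x) * xi p R x" for x
  have i1: "integrable lborel (\<lambda>x. (norm (gz x))\<^sup>2)"
    "integrable lborel (\<lambda>x. F (u x) * (f (u x) * chi (u x) * eta p R x)\<^sup>2)"
    unfolding gz_def by (intro integrable_bounded_support continuous_intros cc bs; simp)+
  have i2: "integrable lborel (\<lambda>x. gu x \<bullet> (xi p R x *\<^sub>R ((psi' (u x))\<^sup>2 *\<^sub>R gu x) + Psi (u x) *\<^sub>R grad_xi p R x))"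
    "integrable lborel (\<lambda>x. f (u x) * (Psi (u x) * xi p R x))"
    by (intro integrable_bounded_support continuous_intros cc bs; simp add: z)+
  have I2: "integrable lborel T2" unfolding T2_def using i2 by simp
  have I3: "integrable lborel T3"
    unfolding T3_def by (intro integrable_bounded_support continuous_intros cc bs; simp add: z)
  have I4: "integrable lborel T4"
    unfolding T4_def by (intro integrable_bounded_support continuous_intros cc bs; simp add: z)
  have I5: "integrable lborel T5"
    unfolding T5_def by (intro integrable_bounded_support continuous_intros cc bs; simp add: z)
  have "0 \<le> (LINT x|lborel. T1 x)"
    using stable[OF has_grad_mult[OF g\<psi> has_grad_eta]] i1
      bounded_support_subset[OF bounded_support_xi(4)[OF R, of p], of "\<lambda>x. f (u x) * chi (u x) * eta p R x"]
    unfolding T1_def gz_def by simp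
  \<comment> \<open>\<open>T2\<close> is the tested equation with zero integral, \<open>T3\<close>
    is the cross term, a gradient of \<open>Kf\<close> along \<open>grad_xi\<close>,
    \<open>T4\<close> comes from the gradient of \<open>eta\<close> alone, and \<open>T5\<close> is
    the quantity to be bounded.\<close>
  also have "(\<lambda>x. T1 x) = (\<lambda>x. T2 x + T3 x + T4 x - T5 x)"
  proof
    fix x
    show "T1 x = T2 x + T3 x + T4 x - T5 x"
      unfolding T1_def T2_def T3_def T4_def T5_def gz_def B_def X_def xi_eq_eta power2_norm_eq_inner
      by (simp add: inner_add_left inner_add_right inner_commute power2_eq_square algebra_simps)
  qed
  also have "(LINT x|lborel. T2 x + T3 x + T4 x - T5 x)
      = (LINT x|lborel. T2 x) + (LINT x|lborel. T3 x) + (LINT x|lborel. T4 x) - (LINT x|lborel. T5 x)"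
    using I2 I3 I4 I5 by simp
  also have "(LINT x|lborel. T2 x) = 0"
  proof -
    have "(LINT x|lborel. f (u x) * (Psi (u x) * xi p R x))
      = (LINT x|lborel. gu x \<bullet> (xi p R x *\<^sub>R ((psi' (u x))\<^sup>2 *\<^sub>R gu x) + Psi (u x) *\<^sub>R grad_xi p R x))"
      by (rule weak_equation[OF has_grad_mult[OF gPsi has_grad_xi]])
        (rule bounded_support_subset[OF bounded_support_xi(1)[OF R, of p]], simp)
    then show ?thesis unfolding T2_def using i2 by simp
  qed
  also have "(LINT x|lborel. T3 x) \<le> lap_const TYPE('a) / R\<^sup>2 * (LINT x|lborel. (CK * X (u x)) * xi p (2 * R) x)"
  proof -
    have "(LINT x|lborel. T3 x) = - (LINT x|lborel. Kf (u x) * lap_xi p R x)"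
      unfolding T3_def by (rule integral_grad_inner_grad_xi[OF gK R])
    also have "\<dots> \<le> \<bar>LINT x|lborel. Kf (u x) * lap_xi p R x\<bar>" by simp
    also have "\<dots> \<le> lap_const TYPE('a) / R\<^sup>2 * (LINT x|lborel. (CK * X (u x)) * xi p (2 * R) x)"
      by (rule integral_mult_lap_xi_le) (intro continuous_intros cc Kf_bound u_pos u_le R)+
    finally show ?thesis .
  qed
  also have "(LINT x|lborel. T4 x) \<le> (LINT x|lborel. 216 / R\<^sup>2 * (X (u x) * xi p (2 * R) x))"
  proof (rule integral_mono[OF I4])
    show "integrable lborel (\<lambda>x. 216 / R\<^sup>2 * (X (u x) * xi p (2 * R) x))"
      using R by (intro integrable_mult_right integrable_xi cc) auto
    show "T4 x \<le> 216 / R\<^sup>2 * (X (u x) * xi p (2 * R) x)" for x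
      using mult_left_mono[OF grad_eta_bound[OF R, of p x] less_imp_le[OF X_pos[OF u_pos[of x]]]]
      by (simp add: T4_def mult_ac)
  qed
  finally have "(LINT x|lborel. T5 x) \<le> lap_const TYPE('a) / R\<^sup>2 * (CK * (LINT x|lborel. X (u x) * xi p (2 * R) x))
      + 216 / R\<^sup>2 * (LINT x|lborel. X (u x) * xi p (2 * R) x)"
    by (simp add: mult.assoc)
  then show ?thesis by (simp add: T5_def CS_def algebra_simps add_divide_distrib)
qed

text \<open>Poincare's inequality for \<open>layer t (u x) * eta p R x\<close>. The energy it needs
  comes from the equation tested with \<open>layer t (u x) * xi p R x\<close>, whose cross term is
  again moved to \<open>lap_xi\<close>.\<close>

lemma layer_estimate:
  assumes t: "t > 0" and R: "R > 0" and r: "r > 0"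
    and avg: "\<And>x. (LINT y|lborel. u y * xi x r y) \<le> t / 2 * (LINT y|lborel. xi x r y)"
  shows "(LINT x|lborel. (layer t (u x))\<^sup>2 * xi p R x) \<le> 8 * r\<^sup>2 / t * ((LINT x|lborel. f (u x) * layer t (u x) * xi p R x)
    + (lap_const TYPE('a) + 108) / R\<^sup>2 * (LINT x|lborel. u x * layer t (u x) * xi p (2 * R) x))"
proof -
  define S' where "S' x = smoothstep' ((u x - t) / t) / t" for x
  have lin: "((\<lambda>v. (v - t) / t) has_real_derivative 1 / t) (at v)" for v
    using t by (auto intro!: derivative_eq_intros)
  have gs: "has_grad (\<lambda>x. layer t (u x)) (\<lambda>x. S' x *\<^sub>R gu x)"
    unfolding layer_def S'_def
  proof (rule has_grad_compose[OF grad_u, of "\<lambda>v. smoothstep ((v - t) / t)" "\<lambda>v. smoothstep' ((v - t) / t) / t"])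
    show "((\<lambda>v. smoothstep ((v - t) / t)) has_real_derivative smoothstep' ((u x - t) / t) / t) (at (u x))" for x
      using DERIV_chain2[OF has_real_derivative_smoothstep lin] by simp
  qed (use t in \<open>auto intro!: continuous_intros\<close>)
  define g where "g v = t * smoothint ((v - t) / t)" for v
  have gg: "has_grad (\<lambda>x. g (u x)) (\<lambda>x. layer t (u x) *\<^sub>R gu x)"
  proof (rule has_grad_compose[OF grad_u])
    show "(g has_real_derivative layer t (u x)) (at (u x))" for x
      unfolding g_def layer_def
      using DERIV_cmult[OF DERIV_chain2[OF has_real_derivative_smoothint lin], of t "u x"] t by simp
  qed (rule layer_cont[OF t])
  have gb: "\<bar>g v\<bar> \<le> v * layer t v" if "0 \<le> v" for v
  proof (cases "v \<le> t")
    case True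
    then show ?thesis using t by (simp add: g_def smoothint_eq_0 layer_eq_0 divide_le_0_iff)
  next
    case False
    then have s: "0 \<le> (v - t) / t" using t by simp
    have "g v \<le> t * ((v - t) / t * layer t v)"
      unfolding g_def layer_def using smoothint_bounds(2)[OF s] t by (intro mult_left_mono) auto
    also have "\<dots> = (v - t) * layer t v" using t by simp
    also have "\<dots> \<le> v * layer t v" using t layer_bounds by (intro mult_right_mono) auto
    finally show ?thesis using smoothint_bounds(1)[OF s] t by (simp add: g_def)
  qed
  note cont = has_gradD(3)[OF gs] has_gradD(3)[OF gg] cont_u cont_gu cont_fu
  have cS': "continuous_on UNIV S'"
    unfolding S'_def using t by (intro continuous_intros cont_u) auto
  note bs = bounded_support_common[OF bounded_support_xi(4)[OF R, of p] bounded_support_xi(5)[OF R, of p]]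
  have zz: "eta p R x = 0 \<Longrightarrow> xi p R x = 0" "eta p R x = 0 \<Longrightarrow> grad_xi p R x = 0" for x
    by (simp_all add: xi_eq_eta)
  define I1 where "I1 = (LINT x|lborel. f (u x) * layer t (u x) * xi p R x)"
  define I2 where "I2 = (LINT x|lborel. u x * layer t (u x) * xi p (2 * R) x)"
  have iE: "integrable lborel (\<lambda>x. S' x * (norm (gu x))\<^sup>2 * xi p R x)"
    by (intro integrable_xi R continuous_intros cS' cont)
  have E: "(LINT x|lborel. S' x * (norm (gu x))\<^sup>2 * xi p R x) \<le> I1 + lap_const TYPE('a) / R\<^sup>2 * I2"
  proof -
    have i: "integrable lborel (\<lambda>x. (layer t (u x) *\<^sub>R gu x) \<bullet> grad_xi p R x)"
      by (intro integrable_bounded_support continuous_intros cont bs; simp add: zz)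
    have "I1 = (LINT x|lborel. f (u x) * (layer t (u x) * xi p R x))" by (simp add: I1_def mult.assoc)
    also have "\<dots> = (LINT x|lborel. gu x \<bullet> (xi p R x *\<^sub>R (S' x *\<^sub>R gu x) + layer t (u x) *\<^sub>R grad_xi p R x))"
      by (rule weak_equation[OF has_grad_mult[OF gs has_grad_xi]])
        (rule bounded_support_subset[OF bounded_support_xi(1)[OF R, of p]], simp)
    also have "\<dots> = (LINT x|lborel. S' x * (norm (gu x))\<^sup>2 * xi p R x + (layer t (u x) *\<^sub>R gu x) \<bullet> grad_xi p R x)"
      by (simp add: power2_norm_eq_inner inner_add_right mult_ac)
    also have "\<dots> = (LINT x|lborel. S' x * (norm (gu x))\<^sup>2 * xi p R x) + (LINT x|lborel. (layer t (u x) *\<^sub>R gu x) \<bullet> grad_xi p R x)"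
      by (rule Bochner_Integration.integral_add[OF iE i])
    finally have "(LINT x|lborel. S' x * (norm (gu x))\<^sup>2 * xi p R x) = I1 + (LINT x|lborel. g (u x) * lap_xi p R x)"
      using integral_grad_inner_grad_xi[OF gg R, of p] by simp
    moreover have "\<bar>LINT x|lborel. g (u x) * lap_xi p R x\<bar> \<le> lap_const TYPE('a) / R\<^sup>2 * I2"
      unfolding I2_def by (rule integral_mult_lap_xi_le) (intro continuous_intros cont gb u_nonneg R)+
    ultimately show ?thesis by linarith
  qed
  define gz where "gz x = eta p R x *\<^sub>R (S' x *\<^sub>R gu x) + layer t (u x) *\<^sub>R grad_eta p R x" for x
  have z: "has_grad (\<lambda>x. layer t (u x) * eta p R x) gz"
    using has_grad_mult[OF gs has_grad_eta] by (simp add: gz_def[abs_def])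
  \<comment> \<open>\<open>\<omega>\<close> is positive only where \<open>u < t\<close>, and there
    the layer vanishes; averages of \<open>u\<close> below \<open>t / 2\<close> make those of
    \<open>1 - u / t\<close> at least \<open>1/2\<close>.\<close>
  have "(LINT x|lborel. (layer t (u x) * eta p R x)\<^sup>2) \<le> 2 * r\<^sup>2 * (LINT x|lborel. (norm (gz x))\<^sup>2)"
  proof (rule poincare_vanishing[OF z _ r, where \<omega> = "\<lambda>x. max 0 (1 - u x / t)"])
    show "bounded_support (\<lambda>x. layer t (u x) * eta p R x)"
      by (rule bounded_support_subset[OF bounded_support_xi(4)[OF R, of p]]) simp
    show c\<omega>: "continuous_on UNIV (\<lambda>x. max 0 (1 - u x / t))"
      using t by (intro continuous_intros cont_u) auto
    show "max 0 (1 - u x / t) \<le> 1" for x using u_nonneg[of x] t by simp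
    show "layer t (u x) * eta p R x * max 0 (1 - u x / t) = 0" for x
      using t by (cases "u x \<le> t") (auto simp: layer_eq_0 max_def divide_simps)
    show "1/2 * (LINT y|lborel. xi x r y) \<le> (LINT y|lborel. max 0 (1 - u y / t) * xi x r y)" for x
    proof -
      have ix: "integrable lborel (xi x r)" "integrable lborel (\<lambda>y. u y * xi x r y)"
        using integrable_xi[OF r continuous_on_const, of 1 x] integrable_xi[OF r cont_u, of x] by simp_all
      have "1/2 * (LINT y|lborel. xi x r y) \<le> (LINT y|lborel. xi x r y) - (LINT y|lborel. u y * xi x r y) / t"
        using avg[of x] t by (simp add: field_simps)
      also have "\<dots> = (LINT y|lborel. xi x r y - u y * xi x r y / t)" using ix by simp
      also have "\<dots> \<le> (LINT y|lborel. max 0 (1 - u y / t) * xi x r y)"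
      proof (rule integral_mono)
        show "integrable lborel (\<lambda>y. xi x r y - u y * xi x r y / t)" using ix by simp
        show "integrable lborel (\<lambda>y. max 0 (1 - u y / t) * xi x r y)" by (rule integrable_xi[OF r c\<omega>])
        have "(1 - u y / t) * xi x r y \<le> max 0 (1 - u y / t) * xi x r y" for y
          by (intro mult_right_mono xi_bounds) simp
        then show "xi x r y - u y * xi x r y / t \<le> max 0 (1 - u y / t) * xi x r y" for y
          by (simp add: algebra_simps)
      qed
      finally show ?thesis .
    qed
  qed simp
  also have "(LINT x|lborel. (norm (gz x))\<^sup>2) \<le> (LINT x|lborel. 4 / t * (S' x * (norm (gu x))\<^sup>2 * xi p R x)
      + 432 / (t * R\<^sup>2) * (u x * layer t (u x) * xi p (2 * R) x))"
  proof (rule integral_mono)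
    show "integrable lborel (\<lambda>x. (norm (gz x))\<^sup>2)"
      unfolding gz_def by (intro integrable_bounded_support continuous_intros cont cS' bs; simp)
    show "integrable lborel (\<lambda>x. 4 / t * (S' x * (norm (gu x))\<^sup>2 * xi p R x)
      + 432 / (t * R\<^sup>2) * (u x * layer t (u x) * xi p (2 * R) x))"
      using R by (intro Bochner_Integration.integrable_add integrable_mult_right iE integrable_xi continuous_intros cont) auto
    fix x
    define a b where "a = eta p R x *\<^sub>R (S' x *\<^sub>R gu x)" and "b = layer t (u x) *\<^sub>R grad_eta p R x"
    have "(norm (gz x))\<^sup>2 \<le> (norm a + norm b)\<^sup>2"
      unfolding gz_def a_def b_def by (intro power_mono norm_triangle_ineq) simp
    also have "\<dots> \<le> 2 * (norm a)\<^sup>2 + 2 * (norm b)\<^sup>2"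
      using zero_le_power2[of "norm a - norm b"] by (simp add: power2_sum power2_diff)
    also have "(norm a)\<^sup>2 = S' x * (S' x * (norm (gu x))\<^sup>2 * xi p R x)"
      by (simp add: a_def power_mult_distrib xi_eq_eta power2_eq_square mult_ac)
    \<comment> \<open>One factor \<open>S'\<close> is spent on its bound \<open>2 / t\<close>, since
      the energy identity \<open>E\<close> is linear in \<open>S'\<close>.\<close>
    also have "\<dots> \<le> 2 / t * (S' x * (norm (gu x))\<^sup>2 * xi p R x)"
      using smoothstep'_bounds[of "(u x - t) / t"] t xi_bounds(1)[of p R x]
      by (intro mult_right_mono) (auto simp: S'_def divide_right_mono)
    also have "(norm b)\<^sup>2 = (layer t (u x))\<^sup>2 * (norm (grad_eta p R x))\<^sup>2"
      by (simp add: b_def power_mult_distrib)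
    also have "\<dots> \<le> (u x * layer t (u x) / t) * (216 / R\<^sup>2 * xi p (2 * R) x)"
    proof (rule mult_mono[OF _ grad_eta_bound[OF R]])
      show "(layer t (u x))\<^sup>2 \<le> u x * layer t (u x) / t"
      proof (cases "u x \<le> t")
        case False
        then have "1 \<le> u x / t" using t by simp
        then have "layer t (u x) \<le> u x / t" using layer_bounds(2)[of t "u x"] by linarith
        from mult_right_mono[OF this layer_bounds(1)[of t "u x"]]
        show ?thesis by (simp add: power2_eq_square)
      qed (use t in \<open>simp add: layer_eq_0\<close>)
      show "0 \<le> u x * layer t (u x) / t" using u_nonneg layer_bounds t by simp
    qed simp
    finally show "(norm (gz x))\<^sup>2 \<le> 4 / t * (S' x * (norm (gu x))\<^sup>2 * xi p R x)
      + 432 / (t * R\<^sup>2) * (u x * layer t (u x) * xi p (2 * R) x)"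
      using t R by (simp add: field_simps)
  qed
  also have "\<dots> = 4 / t * (LINT x|lborel. S' x * (norm (gu x))\<^sup>2 * xi p R x) + 432 / (t * R\<^sup>2) * I2"
    unfolding I2_def
  proof (subst Bochner_Integration.integral_add)
    show "integrable lborel (\<lambda>x. 432 / (t * R\<^sup>2) * (u x * layer t (u x) * xi p (2 * R) x))"
      using R by (intro integrable_mult_right integrable_xi continuous_intros cont) auto
  qed (use iE in simp_all)
  also have "\<dots> \<le> 4 / t * (I1 + lap_const TYPE('a) / R\<^sup>2 * I2) + 432 / (t * R\<^sup>2) * I2"
    using E t by (intro add_mono mult_left_mono) auto
  also have "\<dots> = 4 / t * (I1 + (lap_const TYPE('a) + 108) / R\<^sup>2 * I2)"
    using t R by (simp add: field_simps)
  finally have "(LINT x|lborel. (layer t (u x) * eta p R x)\<^sup>2) \<le> 2 * r\<^sup>2 * (4 / t * (I1 + (lap_const TYPE('a) + 108) / R\<^sup>2 * I2))"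
    using r by (simp add: mult_left_mono)
  note fin = this
  have Y: "2 * r\<^sup>2 * (4 / t * Y) = 8 * r\<^sup>2 / t * Y" for Y by simp
  have "(LINT x|lborel. (layer t (u x) * eta p R x)\<^sup>2)
      \<le> 8 * r\<^sup>2 / t * (I1 + (lap_const TYPE('a) + 108) / R\<^sup>2 * I2)"
    using fin unfolding Y .
  moreover have "(\<lambda>x. (layer t (u x) * eta p R x)\<^sup>2) = (\<lambda>x. (layer t (u x))\<^sup>2 * xi p R x)"
    by (simp add: power_mult_distrib xi_eq_eta(1))
  ultimately show ?thesis unfolding I1_def I2_def by simp
qed

text \<open>Below a level at which \<open>F\<close> is almost constant the equation is essentially linear, so that
  on balls of the natural radius \<open>F(t)\<^bsup>-1/2\<^esup>\<close> the average of \<open>u\<close> is small compared with \<open>t\<close>.\<close>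

lemma small_average:
  fixes \<delta> :: real
  assumes \<delta>: "0 < \<delta>" and t: "0 < t" "t \<le> M"
    and A: "A = sqrt (4 * lap_const TYPE('a) * doubling_const TYPE('a)) + \<delta>"
    and K: "K = 4 * (A / \<delta>) ^ DIM('a)" and flat: "F t / 2 \<le> F (t / K)"
  shows "(LINT y|lborel. u y * xi x (\<delta> / sqrt (F t)) y) \<le> t / 2 * (LINT y|lborel. xi x (\<delta> / sqrt (F t)) y)"
proof -
  let ?L = "lap_const TYPE('a)" and ?D = "doubling_const TYPE('a)"
  define m where "m = F t"
  define c where "c = (LINT y|lborel. xi (0::'a) 1 y)"
  have m: "0 < m" using F_pos t by (simp add: m_def)
  have c: "0 < c" unfolding c_def by (rule integral_xi_pos)
  have D: "0 < ?D" by (rule doubling_const_pos)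
  have A0: "\<delta> \<le> A" "0 < A" using D \<delta> by (auto simp: A intro!: add_nonneg_pos mult_nonneg_nonneg)
  have A2: "4 * ?L * ?D \<le> A\<^sup>2"
  proof -
    have "(sqrt (4 * ?L * ?D))\<^sup>2 \<le> A\<^sup>2" using D \<delta> by (intro power_mono) (auto simp: A)
    then show ?thesis using D by simp
  qed
  have "1 \<le> (A / \<delta>) ^ DIM('a)" using A0 \<delta> by (intro one_le_power) simp
  then have K1: "K \<ge> 1" by (simp add: K)
  define \<kappa> where "\<kappa> = t / K"
  have \<kappa>: "0 < \<kappa>" using t K1 by (simp add: \<kappa>_def)
  \<comment> \<open>Above \<open>\<kappa>\<close> the tangent of \<open>f\<close> at
    \<open>\<kappa>\<close> has slope at least \<open>m / 2\<close>, by the flatness of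
    \<open>F\<close> between \<open>t / K\<close> and \<open>t\<close>.\<close>
  have lin: "v \<le> \<kappa> + 2 / m * f v" if "0 < v" for v
  proof (cases "\<kappa> \<le> v")
    case True
    have "m / 2 * (v - \<kappa>) \<le> F \<kappa> * (v - \<kappa>)"
      using flat True by (intro mult_right_mono) (auto simp: m_def \<kappa>_def)
    also have "\<dots> \<le> f v" using tangent[OF \<kappa> True] f_pos[OF \<kappa>] by simp
    finally show ?thesis using m by (simp add: field_simps)
  next
    case False
    then show ?thesis using f_pos[OF that] m by (simp add: add_increasing2)
  qed
  \<comment> \<open>\<open>lin\<close> bounds \<open>u\<close> by its source, and the source by
    \<open>u\<close> on the doubled ball with coefficient \<open>2 L / (m R^2) = 2 L / A^2\<close>,
    where \<open>L\<close> is \<open>lap_const\<close>. \<open>A\<close> is chosen so that this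
    times the doubling constant is at most \<open>1/2\<close>.\<close>
  define R where "R = A / sqrt m"
  define r where "r = \<delta> / sqrt m"
  have R: "0 < R" "0 < r" "r \<le> R" using A0 m \<delta> by (auto simp: R_def r_def divide_right_mono)
  have R2: "R\<^sup>2 = A\<^sup>2 / m" using m by (simp add: R_def power_divide)
  have "(LINT y|lborel. u y * xi x R y) \<le> 2 * (\<kappa> * (R ^ DIM('a) * c))"
  proof (rule absorb_doubled_ball[OF cont_u u_nonneg u_le R(1)])
    show "0 \<le> 2 / m * (?L / R\<^sup>2)" using m by simp
    show "2 / m * (?L / R\<^sup>2) * ?D \<le> 1/2"
      using A2 A0 m by (simp add: R2 divide_simps) (simp add: algebra_simps)
    fix p
    have i: "integrable lborel (\<lambda>y. \<kappa> * xi p R y)" "integrable lborel (\<lambda>y. f (u y) * xi p R y)"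
      by (intro integrable_xi R continuous_intros cont_fu)+
    have "(LINT y|lborel. u y * xi p R y) \<le> (LINT y|lborel. \<kappa> * xi p R y + 2 / m * (f (u y) * xi p R y))"
    proof (rule integral_mono)
      show "integrable lborel (\<lambda>y. u y * xi p R y)" by (intro integrable_xi R cont_u)
      show "integrable lborel (\<lambda>y. \<kappa> * xi p R y + 2 / m * (f (u y) * xi p R y))" using i by simp
      show "u y * xi p R y \<le> \<kappa> * xi p R y + 2 / m * (f (u y) * xi p R y)" for y
        using mult_right_mono[OF lin[OF u_pos[of y]] xi_bounds(1)[of p R y]] by (simp add: algebra_simps)
    qed
    also have "\<dots> = \<kappa> * (R ^ DIM('a) * c) + 2 / m * (LINT y|lborel. f (u y) * xi p R y)"
      using i integral_xi[OF R(1), of p] by (simp add: c_def)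
    also have "\<dots> \<le> \<kappa> * (R ^ DIM('a) * c) + 2 / m * (?L / R\<^sup>2 * (LINT y|lborel. u y * xi p (2 * R) y))"
      using integral_fu_xi_le[OF R(1), of 0 p] u_nonneg m by (intro add_left_mono mult_left_mono) auto
    finally show "(LINT y|lborel. u y * xi p R y)
        \<le> 2 / m * (?L / R\<^sup>2) * (LINT y|lborel. u y * xi p (2 * R) y) + \<kappa> * (R ^ DIM('a) * c)"
      by (simp only: mult.assoc add.commute)
  qed
  moreover have "(LINT y|lborel. u y * xi x r y) \<le> (LINT y|lborel. u y * xi x R y)"
  proof (rule integral_mono)
    show "u y * xi x r y \<le> u y * xi x R y" for y
      using R u_nonneg unfolding xi_def bump_def
      by (intro mult_left_mono power_mono max.mono diff_left_mono divide_left_mono) auto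
  qed (intro integrable_xi R cont_u)+
  \<comment> \<open>Passing from radius \<open>R\<close> to the smaller \<open>r\<close> costs the
    volume ratio \<open>(A / \<delta>) ^ DIM('a)\<close>, which the choice of \<open>K\<close>
    compensates.\<close>
  moreover have "2 * (\<kappa> * (R ^ DIM('a) * c)) = t / 2 * (LINT y|lborel. xi x r y)"
  proof -
    have "(A / \<delta>) * r = R" using \<delta> by (simp add: R_def r_def)
    then have "R ^ DIM('a) = (A / \<delta>) ^ DIM('a) * r ^ DIM('a)" by (metis power_mult_distrib)
    moreover have "(A / \<delta>) ^ DIM('a) > 0" using A0 \<delta> by simp
    ultimately show ?thesis
      unfolding integral_xi[OF R(2), of x] c_def[symmetric] \<kappa>_def K
      using A0 \<delta> by (simp add: field_simps)
  qed
  ultimately show ?thesis by (simp add: r_def m_def)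
qed

end

section \<open>Coercivity\<close>

context stable_growth
begin

text \<open>The exponent \<open>Suc i\<close> makes layer \<open>i\<close> equal to 1 from
  \<open>M / 2 ^ i\<close> on, so that the top layer is saturated at the largest value
  \<open>M\<close>.\<close>

definition dyadic :: "nat \<Rightarrow> real" where "dyadic i = M / 2 ^ Suc i"

lemma dyadic: "0 < dyadic i" "dyadic i \<le> M" "dyadic (Suc i) = dyadic i / 2"
proof -
  show "0 < dyadic i" using M_pos by (simp add: dyadic_def)
  have "(1::real) \<le> 2 ^ Suc i" by (rule one_le_power) simp
  then show "dyadic i \<le> M" using M_pos unfolding dyadic_def by (simp add: divide_le_eq mult_le_cancel_left1 del: power_Suc)
  show "dyadic (Suc i) = dyadic i / 2" by (simp add: dyadic_def)
qed

text \<open>Convexity makes \<open>f\<close> at least linear in the level,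
  \<open>f t \<le> t / v * f v\<close>, which reduces the claim to a geometric sum.\<close>

lemma sum_f_dyadic_le:
  assumes "0 < v" "v \<le> M"
  shows "(\<Sum>i\<le>n. if dyadic i \<le> v then f (dyadic i) else 0) \<le> 2 * f v"
proof -
  have "(\<Sum>i\<le>n. if dyadic i \<le> v then f (dyadic i) else 0)
      \<le> (\<Sum>i\<le>n. f v / v * (if dyadic i \<le> v then dyadic i else 0))"
    by (intro sum_mono) (use f_scale[OF dyadic(1)] in \<open>auto simp: mult.commute\<close>)
  also have "\<dots> = f v / v * (\<Sum>i\<le>n. if dyadic i \<le> v then dyadic i else 0)"
    by (rule sum_distrib_left[symmetric])
  also have "\<dots> \<le> f v / v * (2 * v)"
    using dyadic_sum_le[of dyadic v n] dyadic less_imp_le[OF dyadic(1)] f_pos[OF assms(1)] assms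
    by (intro mult_left_mono) auto
  finally show ?thesis using assms by simp
qed

text \<open>Above \<open>M / 2 ^ n\<close> one saturated layer with a comparable level suffices.
  Values further down contribute at most \<open>G (M / 2 ^ n)\<close>, which tends to 0 with growing
  \<open>n\<close>.\<close>

lemma G_le_layers:
  assumes "0 < v" "v \<le> M"
  shows "G v \<le> CG * (\<Sum>i\<le>n. G (dyadic i) * (layer (dyadic i) v)\<^sup>2) + G (M / 2 ^ n)"
proof (cases "M / 2 ^ n \<le> v")
  case True
  from dyadic_level[OF assms True]
  obtain i where i: "i \<le> n" "M / 2 ^ i \<le> v" "v \<le> 2 * (M / 2 ^ i)" by blast
  have "2 * dyadic i = M / 2 ^ i" by (simp add: dyadic_def)
  then have d: "2 * dyadic i \<le> v" "v \<le> 4 * dyadic i" using i by auto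
  then have "G v \<le> CG * G (dyadic i)"
    using assms dyadic(1)[of i] by (intro G_doubling) auto
  also have "G (dyadic i) = G (dyadic i) * (layer (dyadic i) v)\<^sup>2"
    by (simp add: layer_eq_1[OF dyadic(1) d(1)])
  also have "\<dots> \<le> (\<Sum>i\<le>n. G (dyadic i) * (layer (dyadic i) v)\<^sup>2)"
  proof (rule member_le_sum[of i "{..n}" "\<lambda>i. G (dyadic i) * (layer (dyadic i) v)\<^sup>2"])
    show "0 \<le> G (dyadic j) * (layer (dyadic j) v)\<^sup>2" for j
      using G_pos[OF dyadic(1)[of j]] by simp
  qed (use i(1) in auto)
  finally have "G v \<le> CG * (\<Sum>i\<le>n. G (dyadic i) * (layer (dyadic i) v)\<^sup>2)"
    using CG_pos by (simp add: mult_left_mono)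
  then show ?thesis using G_pos[of "M / 2 ^ n"] M_pos by (simp add: add_increasing2)
next
  case False
  then have "G v \<le> G (M / 2 ^ n)" using assms by (intro G_mono) auto
  moreover have "0 \<le> CG * (\<Sum>i\<le>n. G (dyadic i) * (layer (dyadic i) v)\<^sup>2)"
    using CG_pos G_pos[OF dyadic(1)] by (intro mult_nonneg_nonneg sum_nonneg) (auto intro: less_imp_le)
  ultimately show ?thesis by linarith
qed

text \<open>Levels at which \<open>F\<close> drops are controlled by stability (\<open>B_coercive\<close>), the others by the
  Poincare inequality with a small constant \<open>\<delta>\<^sup>2\<close>, which is then absorbed.\<close>

lemma coercivity:
  "\<exists>C>0. \<forall>p R. R > 0 \<longrightarrow> (LINT x|lborel. G (u x) * xi p R x) \<le> C / R\<^sup>2 * (LINT x|lborel. X (u x) * xi p (2 * R) x)"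
proof -
  let ?L = "lap_const TYPE('a) + 108"
  \<comment> \<open>Chosen so that the flat levels return exactly half of the left-hand side, see
    \<open>\<delta>2\<close>.\<close>
  define \<delta> where "\<delta> = sqrt (1 / (32 * CG))"
  have \<delta>: "0 < \<delta>" using CG_pos by (simp add: \<delta>_def)
  have \<delta>2: "16 * \<delta>\<^sup>2 * CG = 1/2" using CG_pos by (simp add: \<delta>_def)
  define A where "A = sqrt (4 * lap_const TYPE('a) * doubling_const TYPE('a)) + \<delta>"
  define K where "K = 4 * (A / \<delta>) ^ DIM('a)"
  have A\<delta>: "\<delta> \<le> A" using doubling_const_pos[where 'a = 'a] by (simp add: A_def)
  then have "1 \<le> (A / \<delta>) ^ DIM('a)" using \<delta> by (intro one_le_power) simp
  then have K: "1 \<le> K" by (simp add: K_def)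
  have cB: "0 < cB K" using cB_pos K by simp
  \<comment> \<open>Twice the sum of the two contributions: \<open>2 * CG * CS / cB K\<close> from
    the levels with a drop, and half of \<open>?L * C1\<close> from the flat ones.\<close>
  define C where "C = 4 * CG * CS / cB K + ?L * C1"
  have C: "0 < C"
    unfolding C_def using CG_pos CS_pos cB C1(1) by (intro add_pos_pos divide_pos_pos mult_pos_pos) auto
  note cc = cont_compose[OF f_cont] cont_compose[OF F_cont'] cont_compose[OF chi_cont]
    cont_compose[OF B_cont] cont_compose[OF X_cont] cont_compose[OF G_cont] cont_u
  have clay: "continuous_on UNIV (\<lambda>x. layer (dyadic i) (u x))" for i
    by (rule continuous_on_compose2[OF layer_cont[OF dyadic(1), of UNIV] cont_u]) auto
  have main: "(LINT x|lborel. G (u x) * xi p R x) \<le> C / R\<^sup>2 * (LINT x|lborel. X (u x) * xi p (2 * R) x)"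
    if R: "R > 0" for p :: 'a and R
  proof -
    define I J IB c where "I = (LINT x|lborel. G (u x) * xi p R x)"
      and "J = (LINT x|lborel. X (u x) * xi p (2 * R) x)"
      and "IB = (LINT x|lborel. f (u x) * B (u x) * xi p R x)"
      and "c = (LINT x|lborel. xi p R x)"
    have IB: "IB \<le> CS / R\<^sup>2 * J" unfolding IB_def J_def by (rule stability_B[OF R])
    define s where "s i x = layer (dyadic i) (u x)" for i x
    have iG: "integrable lborel (\<lambda>x. G (u x) * xi p R x)" by (intro integrable_xi R cc)
    have is2: "integrable lborel (\<lambda>x. (s i x)\<^sup>2 * xi p R x)" for i
      unfolding s_def by (intro integrable_xi R continuous_intros clay)
    have if_s: "integrable lborel (\<lambda>x. f (u x) * s i x * xi p R x)"
      "integrable lborel (\<lambda>x. u x * s i x * xi p (2 * R) x)" for i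
      unfolding s_def using R by (intro integrable_xi continuous_intros clay cc; simp)+
    have ifB: "integrable lborel (\<lambda>x. f (u x) * B (u x) * xi p R x)"
      by (intro integrable_xi R continuous_intros cc)
    have step: "I \<le> I / 2 + (C / R\<^sup>2 * J) / 2 + G (M / 2 ^ n) * c" for n
    proof -
      define Good where "Good = {i. F (dyadic i / K) \<le> F (dyadic i) / 2}"
      define W where "W i = (LINT x|lborel. (s i x)\<^sup>2 * xi p R x)" for i
      \<comment> \<open>This is \<open>X (dyadic i) / dyadic i\<close>: in
        \<open>G (dyadic i) * r^2 / dyadic i\<close> the squared natural radius
        \<open>r^2 = \<delta>^2 / F (dyadic i)\<close> cancels the factor \<open>F\<close> of
        \<open>G\<close>.\<close>
      define b where "b i = (f (dyadic i))\<^sup>2 * (chi (dyadic i))\<^sup>2 / dyadic i" for i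
      have b0: "0 \<le> b i" for i using dyadic(1)[of i] by (simp add: b_def)
      have "I \<le> (LINT x|lborel. CG * (\<Sum>i\<le>n. G (dyadic i) * ((s i x)\<^sup>2 * xi p R x)) + G (M / 2 ^ n) * xi p R x)"
        unfolding I_def
      proof (rule integral_mono[OF iG])
        show "integrable lborel (\<lambda>x. CG * (\<Sum>i\<le>n. G (dyadic i) * ((s i x)\<^sup>2 * xi p R x)) + G (M / 2 ^ n) * xi p R x)"
          using is2 integrable_xi[OF R continuous_on_const, of 1 p] by simp
        show "G (u x) * xi p R x \<le> CG * (\<Sum>i\<le>n. G (dyadic i) * ((s i x)\<^sup>2 * xi p R x)) + G (M / 2 ^ n) * xi p R x" for x
          using mult_right_mono[OF G_le_layers[OF u_pos u_le] xi_bounds(1)[of p R x], of x n]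
          by (simp add: s_def distrib_right sum_distrib_right mult.assoc)
      qed
      also have "\<dots> = CG * (\<Sum>i\<le>n. G (dyadic i) * W i) + G (M / 2 ^ n) * c"
        using is2 integrable_xi[OF R continuous_on_const, of 1 p] by (simp add: W_def c_def)
      also have "(\<Sum>i\<le>n. G (dyadic i) * W i)
          = (\<Sum>i\<in>{..n} \<inter> Good. G (dyadic i) * W i) + (\<Sum>i\<in>{..n} - Good. G (dyadic i) * W i)"
        by (rule sum.Int_Diff) simp
      finally have split: "I \<le> CG * ((\<Sum>i\<in>{..n} \<inter> Good. G (dyadic i) * W i)
          + (\<Sum>i\<in>{..n} - Good. G (dyadic i) * W i)) + G (M / 2 ^ n) * c" .
      have good: "(\<Sum>i\<in>{..n} \<inter> Good. G (dyadic i) * W i) \<le> 2 / cB K * IB"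
      proof -
        have "(\<Sum>i\<in>{..n} \<inter> Good. G (dyadic i) * W i)
            = (LINT x|lborel. (\<Sum>i\<in>{..n} \<inter> Good. G (dyadic i) * ((s i x)\<^sup>2 * xi p R x)))"
          using is2 by (simp add: W_def)
        also have "\<dots> \<le> (LINT x|lborel. 2 / cB K * (f (u x) * B (u x) * xi p R x))"
        proof (rule integral_mono)
          show "integrable lborel (\<lambda>x. \<Sum>i\<in>{..n} \<inter> Good. G (dyadic i) * ((s i x)\<^sup>2 * xi p R x))"
            using is2 by simp
          show "integrable lborel (\<lambda>x. 2 / cB K * (f (u x) * B (u x) * xi p R x))" using ifB by simp
          fix x
          have v: "0 < u x" "u x \<le> M" using u_pos u_le by auto
          have Bx: "0 \<le> B (u x) / cB K" using B_nonneg[OF v] cB by simp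
          \<comment> \<open>One factor \<open>f t\<close> is kept and another is replaced by
            \<open>t * F t\<close>, which leaves \<open>f t\<close> times the quantity in
            \<open>B_coercive\<close>; the kept factors can then be summed over the dyadic
            levels.\<close>
          have le_f: "G (dyadic i) * (s i x)\<^sup>2 \<le> (if dyadic i \<le> u x then f (dyadic i) else 0) * (B (u x) / cB K)"
            if "i \<in> Good" for i
          proof (cases "dyadic i \<le> u x")
            case True
            let ?t = "dyadic i"
            have "cB K * (?t * (F ?t)\<^sup>2 * (chi ?t)\<^sup>2) \<le> B (u x)"
              by (rule B_coercive[OF K dyadic(1) True v(2)]) (use that in \<open>simp add: Good_def\<close>)
            then have q: "?t * (F ?t)\<^sup>2 * (chi ?t)\<^sup>2 \<le> B (u x) / cB K"
              using cB by (simp add: field_simps)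
            have "G ?t * (s i x)\<^sup>2 \<le> G ?t * 1"
              using layer_bounds[of ?t "u x"] G_pos[OF dyadic(1)[of i]]
              by (intro mult_left_mono) (auto simp: s_def power_le_one)
            also have "G ?t * 1 = f ?t * (f ?t * (F ?t * (chi ?t)\<^sup>2))"
              by (simp add: G_def X_def power2_eq_square)
            also have "\<dots> \<le> f ?t * ((?t * F ?t) * (F ?t * (chi ?t)\<^sup>2))"
              using f_le[OF dyadic(1)] f_pos[OF dyadic(1)[of i]] F_pos[OF dyadic(1)[of i]]
              by (intro mult_left_mono mult_right_mono) auto
            also have "\<dots> = f ?t * (?t * (F ?t)\<^sup>2 * (chi ?t)\<^sup>2)" by (simp add: power2_eq_square)
            also have "\<dots> \<le> f ?t * (B (u x) / cB K)"
              using q f_pos[OF dyadic(1)[of i]] by (intro mult_left_mono) auto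
            finally show ?thesis using True by simp
          next
            case False
            then show ?thesis by (simp add: s_def layer_eq_0 dyadic(1))
          qed
          have "(\<Sum>i\<in>{..n} \<inter> Good. G (dyadic i) * (s i x)\<^sup>2)
              \<le> (\<Sum>i\<in>{..n} \<inter> Good. (if dyadic i \<le> u x then f (dyadic i) else 0) * (B (u x) / cB K))"
            by (intro sum_mono le_f) auto
          also have "\<dots> \<le> (\<Sum>i\<le>n. (if dyadic i \<le> u x then f (dyadic i) else 0) * (B (u x) / cB K))"
            using Bx f_pos[OF dyadic(1)] less_imp_le
            by (intro sum_mono2 mult_nonneg_nonneg) auto
          also have "\<dots> = (\<Sum>i\<le>n. (if dyadic i \<le> u x then f (dyadic i) else 0)) * (B (u x) / cB K)"
            by (rule sum_distrib_right[symmetric])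
          also have "\<dots> \<le> (2 * f (u x)) * (B (u x) / cB K)"
            by (rule mult_right_mono[OF sum_f_dyadic_le[OF v] Bx])
          finally have "(\<Sum>i\<in>{..n} \<inter> Good. G (dyadic i) * (s i x)\<^sup>2) * xi p R x
              \<le> ((2 * f (u x)) * (B (u x) / cB K)) * xi p R x"
            by (rule mult_right_mono[OF _ xi_bounds(1)])
          then show "(\<Sum>i\<in>{..n} \<inter> Good. G (dyadic i) * ((s i x)\<^sup>2 * xi p R x))
              \<le> 2 / cB K * (f (u x) * B (u x) * xi p R x)"
            by (simp add: sum_distrib_right mult.assoc)
        qed
        also have "\<dots> = 2 / cB K * IB" by (simp add: IB_def)
        finally show ?thesis .
      qed
      have bad: "(\<Sum>i\<in>{..n} - Good. G (dyadic i) * W i) \<le> 16 * \<delta>\<^sup>2 * (I + ?L * C1 / R\<^sup>2 * J)"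
      proof -
        have W: "G (dyadic i) * W i \<le> 8 * \<delta>\<^sup>2 * ((LINT x|lborel. b i * (f (u x) * s i x * xi p R x))
            + ?L / R\<^sup>2 * (LINT x|lborel. b i * (u x * s i x * xi p (2 * R) x)))" if "i \<notin> Good" for i
        proof -
          let ?t = "dyadic i"
          let ?r = "\<delta> / sqrt (F ?t)"
          have Ft: "0 < F ?t" by (rule F_pos[OF dyadic(1)])
          have r: "0 < ?r" using Ft \<delta> by simp
          have "W i \<le> 8 * ?r\<^sup>2 / ?t * ((LINT x|lborel. f (u x) * s i x * xi p R x)
              + ?L / R\<^sup>2 * (LINT x|lborel. u x * s i x * xi p (2 * R) x))"
            unfolding W_def s_def
            by (rule layer_estimate[OF dyadic(1) R r])
              (rule small_average[OF \<delta> dyadic(1,2) A_def K_def], use that in \<open>simp add: Good_def\<close>)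
          then have "G ?t * W i \<le> G ?t * (8 * ?r\<^sup>2 / ?t * ((LINT x|lborel. f (u x) * s i x * xi p R x)
              + ?L / R\<^sup>2 * (LINT x|lborel. u x * s i x * xi p (2 * R) x)))"
            using G_pos[OF dyadic(1)[of i]] by (intro mult_left_mono) auto
          also have "G ?t * (8 * ?r\<^sup>2 / ?t * Y) = 8 * \<delta>\<^sup>2 * (b i * Y)" for Y
          proof -
            have "?r\<^sup>2 = \<delta>\<^sup>2 / F ?t" using Ft by (simp add: power_divide)
            then show ?thesis using Ft by (simp add: G_def X_def b_def power_mult_distrib)
          qed
          finally show ?thesis by (simp add: distrib_left mult_ac)
        qed
        \<comment> \<open>By convexity \<open>f t / t \<le> F t \<le> F (u x)\<close> for active
          levels, so a summable factor \<open>f t\<close> remains.\<close>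
        have sumb: "(\<Sum>i\<le>n. b i * s i x) \<le> 2 * (F (u x) * f (u x) * (chi (u x))\<^sup>2)" for x
        proof -
          have v: "0 < u x" "u x \<le> M" using u_pos u_le by auto
          have "b i * s i x \<le> F (u x) * (chi (u x))\<^sup>2 * (if dyadic i \<le> u x then f (dyadic i) else 0)" for i
          proof (cases "dyadic i \<le> u x")
            case True
            let ?t = "dyadic i"
            have "f ?t / ?t \<le> F (u x)"
              using f_le[OF dyadic(1)[of i]] F_mono[OF dyadic(1) True] dyadic(1)[of i]
              by (simp add: divide_le_eq) (metis mult.commute mult_left_mono less_imp_le order_trans)
            moreover have "(chi ?t)\<^sup>2 \<le> (chi (u x))\<^sup>2"
              using chi_mono[OF dyadic(1) True] chi_pos[OF dyadic(1)[of i]] by (intro power_mono) auto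
            ultimately have "f ?t * ((f ?t / ?t) * (chi ?t)\<^sup>2) \<le> f ?t * (F (u x) * (chi (u x))\<^sup>2)"
              using f_pos[OF dyadic(1)[of i]] F_pos[OF v(1)] by (intro mult_left_mono mult_mono) auto
            then have "b i \<le> F (u x) * (chi (u x))\<^sup>2 * f ?t"
              by (simp add: b_def power2_eq_square mult_ac)
            moreover have "b i * s i x \<le> b i"
              using b0[of i] layer_bounds by (intro mult_left_le) (auto simp: s_def)
            ultimately show ?thesis using True by simp
          qed (simp add: s_def layer_eq_0 dyadic(1))
          then have "(\<Sum>i\<le>n. b i * s i x) \<le> (\<Sum>i\<le>n. F (u x) * (chi (u x))\<^sup>2 * (if dyadic i \<le> u x then f (dyadic i) else 0))"
            by (intro sum_mono)
          also have "\<dots> = F (u x) * (chi (u x))\<^sup>2 * (\<Sum>i\<le>n. if dyadic i \<le> u x then f (dyadic i) else 0)"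
            by (rule sum_distrib_left[symmetric])
          also have "\<dots> \<le> F (u x) * (chi (u x))\<^sup>2 * (2 * f (u x))"
            using F_pos[OF v(1)] by (intro mult_left_mono sum_f_dyadic_le[OF v]) auto
          finally show ?thesis by (simp add: mult_ac)
        qed
        \<comment> \<open>Used twice: with the source \<open>f (u x)\<close>, which gives back
          \<open>G\<close> and is absorbed, and with \<open>u x\<close> on the doubled ball, where
          \<open>u F \<le> C1 f\<close> gives \<open>X\<close>.\<close>
        have gsum: "(\<Sum>i\<in>{..n} - Good. (LINT x|lborel. b i * (h x * s i x * k x)))
            \<le> (LINT x|lborel. 2 * (F (u x) * f (u x) * (chi (u x))\<^sup>2) * (h x * k x))"
          if h: "\<And>x. 0 \<le> h x * k x" "\<And>i. integrable lborel (\<lambda>x. h x * s i x * k x)"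
            "integrable lborel (\<lambda>x. 2 * (F (u x) * f (u x) * (chi (u x))\<^sup>2) * (h x * k x))" for h k
        proof -
          have "(\<Sum>i\<in>{..n} - Good. (LINT x|lborel. b i * (h x * s i x * k x)))
              = (LINT x|lborel. (\<Sum>i\<in>{..n} - Good. b i * (h x * s i x * k x)))"
            using h(2) by simp
          also have "\<dots> \<le> (LINT x|lborel. 2 * (F (u x) * f (u x) * (chi (u x))\<^sup>2) * (h x * k x))"
          proof (rule integral_mono[OF _ h(3)])
            show "integrable lborel (\<lambda>x. \<Sum>i\<in>{..n} - Good. b i * (h x * s i x * k x))" using h(2) by simp
            fix x
            have "(\<Sum>i\<in>{..n} - Good. b i * s i x) \<le> (\<Sum>i\<le>n. b i * s i x)"
              using b0 layer_bounds(1) by (intro sum_mono2) (auto simp: s_def)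
            also have "\<dots> \<le> 2 * (F (u x) * f (u x) * (chi (u x))\<^sup>2)" by (rule sumb)
            finally have "(\<Sum>i\<in>{..n} - Good. b i * s i x) * (h x * k x)
                \<le> 2 * (F (u x) * f (u x) * (chi (u x))\<^sup>2) * (h x * k x)"
              by (rule mult_right_mono[OF _ h(1)])
            moreover have "(\<Sum>i\<in>{..n} - Good. b i * (h x * s i x * k x))
                = (\<Sum>i\<in>{..n} - Good. b i * s i x) * (h x * k x)"
              unfolding sum_distrib_right by (intro sum.cong refl) (simp add: mult_ac)
            ultimately show "(\<Sum>i\<in>{..n} - Good. b i * (h x * s i x * k x))
                \<le> 2 * (F (u x) * f (u x) * (chi (u x))\<^sup>2) * (h x * k x)" by simp
          qed
          finally show ?thesis .
        qed
        have s1: "(\<Sum>i\<in>{..n} - Good. (LINT x|lborel. b i * (f (u x) * s i x * xi p R x))) \<le> 2 * I"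
        proof -
          have "(\<Sum>i\<in>{..n} - Good. (LINT x|lborel. b i * (f (u x) * s i x * xi p R x)))
              \<le> (LINT x|lborel. 2 * (F (u x) * f (u x) * (chi (u x))\<^sup>2) * (f (u x) * xi p R x))"
          proof (rule gsum)
            show "0 \<le> f (u x) * xi p R x" for x
              using f_pos[OF u_pos[of x]] xi_bounds(1)[of p R x] by simp
            show "integrable lborel (\<lambda>x. 2 * (F (u x) * f (u x) * (chi (u x))\<^sup>2) * (f (u x) * xi p R x))"
              unfolding mult.assoc[symmetric] by (intro integrable_xi R continuous_intros cc)
          qed (rule if_s)
          also have "\<dots> = 2 * I"
          proof -
            have "(\<lambda>x. 2 * (F (u x) * f (u x) * (chi (u x))\<^sup>2) * (f (u x) * xi p R x))
                = (\<lambda>x. 2 * (G (u x) * xi p R x))"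
              by (simp add: fun_eq_iff G_def X_def power2_eq_square)
            then show ?thesis by (simp add: I_def)
          qed
          finally show ?thesis .
        qed
        have s2: "(\<Sum>i\<in>{..n} - Good. (LINT x|lborel. b i * (u x * s i x * xi p (2 * R) x))) \<le> 2 * (C1 * J)"
        proof -
          have "(\<Sum>i\<in>{..n} - Good. (LINT x|lborel. b i * (u x * s i x * xi p (2 * R) x)))
              \<le> (LINT x|lborel. 2 * (F (u x) * f (u x) * (chi (u x))\<^sup>2) * (u x * xi p (2 * R) x))"
          proof (rule gsum)
            show "0 \<le> u x * xi p (2 * R) x" for x
              using u_nonneg[of x] xi_bounds(1)[of p "2 * R" x] by simp
            show "integrable lborel (\<lambda>x. 2 * (F (u x) * f (u x) * (chi (u x))\<^sup>2) * (u x * xi p (2 * R) x))"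
              unfolding mult.assoc[symmetric] using R by (intro integrable_xi continuous_intros cc) auto
          qed (rule if_s)
          also have "\<dots> \<le> (LINT x|lborel. 2 * C1 * (X (u x) * xi p (2 * R) x))"
          proof (rule integral_mono)
            show "integrable lborel (\<lambda>x. 2 * (F (u x) * f (u x) * (chi (u x))\<^sup>2) * (u x * xi p (2 * R) x))"
              unfolding mult.assoc[symmetric] using R by (intro integrable_xi continuous_intros cc) auto
            show "integrable lborel (\<lambda>x. 2 * C1 * (X (u x) * xi p (2 * R) x))"
              using R by (intro integrable_mult_right integrable_xi cc) auto
            fix x
            have "(u x * F (u x)) * (f (u x) * (chi (u x))\<^sup>2 * xi p (2 * R) x)
                \<le> (C1 * f (u x)) * (f (u x) * (chi (u x))\<^sup>2 * xi p (2 * R) x)"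
              using f_pos[OF u_pos[of x]] xi_bounds(1)[of p "2 * R" x]
              by (intro mult_right_mono C1(2) u_pos u_le) auto
            then show "2 * (F (u x) * f (u x) * (chi (u x))\<^sup>2) * (u x * xi p (2 * R) x)
                \<le> 2 * C1 * (X (u x) * xi p (2 * R) x)"
              by (simp add: X_def power2_eq_square mult_ac)
          qed
          also have "\<dots> = 2 * (C1 * J)" by (simp add: J_def)
          finally show ?thesis .
        qed
        have "(\<Sum>i\<in>{..n} - Good. G (dyadic i) * W i)
            \<le> (\<Sum>i\<in>{..n} - Good. 8 * \<delta>\<^sup>2 * ((LINT x|lborel. b i * (f (u x) * s i x * xi p R x))
            + ?L / R\<^sup>2 * (LINT x|lborel. b i * (u x * s i x * xi p (2 * R) x))))"
          by (intro sum_mono W) auto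
        also have "\<dots> = 8 * \<delta>\<^sup>2 * ((\<Sum>i\<in>{..n} - Good. (LINT x|lborel. b i * (f (u x) * s i x * xi p R x)))
            + ?L / R\<^sup>2 * (\<Sum>i\<in>{..n} - Good. (LINT x|lborel. b i * (u x * s i x * xi p (2 * R) x))))"
          by (simp only: sum_distrib_left[symmetric] sum.distrib)
        also have "\<dots> \<le> 8 * \<delta>\<^sup>2 * (2 * I + ?L / R\<^sup>2 * (2 * (C1 * J)))"
          using s1 s2 by (intro mult_left_mono add_mono) auto
        also have "\<dots> = 16 * \<delta>\<^sup>2 * (I + ?L * C1 / R\<^sup>2 * J)" by (simp add: algebra_simps)
        finally show ?thesis .
      qed
      have "CG * ((\<Sum>i\<in>{..n} \<inter> Good. G (dyadic i) * W i) + (\<Sum>i\<in>{..n} - Good. G (dyadic i) * W i))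
          \<le> CG * (2 / cB K * (CS / R\<^sup>2 * J) + 16 * \<delta>\<^sup>2 * (I + ?L * C1 / R\<^sup>2 * J))"
        using good bad CG_pos cB
        by (intro mult_left_mono add_mono order_trans[OF good] IB) auto
      also have "\<dots> = CG * (2 / cB K * (CS / R\<^sup>2 * J)) + (16 * \<delta>\<^sup>2 * CG) * (I + ?L * C1 / R\<^sup>2 * J)"
        by (simp add: algebra_simps)
      also have "\<dots> = I / 2 + (C / R\<^sup>2 * J) / 2"
        unfolding \<delta>2 C_def using R cB by (simp add: field_simps)
      finally show ?thesis using split by linarith
    qed
    \<comment> \<open>\<open>step\<close> involves only finitely many layers, so sums and integrals
      commute freely; the remainder disappears in the limit.\<close>
    have "(\<lambda>n. G (M / 2 ^ n) * c) \<longlonglongrightarrow> 0 * c"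
    proof (intro tendsto_mult tendsto_const filterlim_compose[OF G_lim])
      show "filterlim (\<lambda>n. M / 2 ^ n) (at_right 0) sequentially"
        using M_pos unfolding filterlim_at
        by (auto intro!: LIMSEQ_divide_realpow_zero)
    qed
    then have "(\<lambda>n. I / 2 + (C / R\<^sup>2 * J) / 2 + G (M / 2 ^ n) * c) \<longlonglongrightarrow> I / 2 + (C / R\<^sup>2 * J) / 2 + 0 * c"
      by (intro tendsto_add tendsto_const)
    then have "I \<le> I / 2 + (C / R\<^sup>2 * J) / 2 + 0 * c"
      by (rule Lim_bounded2[of _ _ 0]) (use step in auto)
    then show ?thesis by (simp add: I_def J_def)
  qed
  show ?thesis using C main by blast
qed

text \<open>The exponent \<open>e\<close> of \<open>X\<close> in terms of \<open>F\<close> counts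
  twice in terms of \<open>1 / R\<close>, as the critical slope is of order \<open>R^(-2)\<close>;
  the integral of \<open>G\<close> is then of order \<open>R powr (- d)\<close>.\<close>

lemma no_solution_if_power_bound:
  fixes \<delta> c e :: real
  assumes \<delta>: "0 < \<delta>" and c: "0 \<le> c" and e: "0 \<le> e" "real DIM('a) - 2 < 2 * e"
    and X: "\<And>v. 0 < v \<Longrightarrow> v \<le> \<delta> \<Longrightarrow> X v \<le> c * F v powr e"
  shows False
proof -
  obtain C where C: "0 < C" "\<And>p R. R > 0 \<Longrightarrow>
      (LINT x|lborel. G (u x) * xi p R x) \<le> C / R\<^sup>2 * (LINT x|lborel. X (u x) * xi p (2 * R) x)"
    using coercivity by blast
  let ?D = "doubling_const TYPE('a)"
  have D: "0 < ?D" by (rule doubling_const_pos)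
  \<comment> \<open>Where \<open>F\<close> is at least \<open>A / R\<^sup>2\<close>,
    \<open>X\<close> is at most \<open>R\<^sup>2 / A * G\<close>. The coefficient of the doubled
    ball becomes \<open>C / A\<close>, and \<open>C / A * ?D = 1/2\<close> permits
    absorption.\<close>
  define A where "A = 2 * C * ?D"
  have A: "0 < A" using C D by (simp add: A_def)
  define c1 where "c1 = (LINT x|lborel. xi (0::'a) 1 x)"
  have c1: "0 < c1" unfolding c1_def by (rule integral_xi_pos)
  note cG = cont_compose[OF G_cont] and cX = cont_compose[OF X_cont]
  define I where "I = (LINT x|lborel. G (u x) * xi 0 1 x)"
  define K where "K = 2 * C * c * A powr e * 2 ^ DIM('a) * c1"
  define d where "d = 2 * e - (real DIM('a) - 2)"
  have d: "0 < d" using e by (simp add: d_def)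
  have "I \<le> K * R powr (- d)" if R: "R \<ge> max 1 (sqrt (A / F \<delta>))" for R
  proof -
    have R1: "R \<ge> 1" "R > 0" using R by auto
    have F\<delta>: "0 < F \<delta>" by (rule F_pos[OF \<delta>])
    have "(sqrt (A / F \<delta>))\<^sup>2 \<le> R\<^sup>2" using R A F\<delta> by (intro power_mono) auto
    \<comment> \<open>For such large \<open>R\<close>, values with slope below
      \<open>A / R\<^sup>2\<close> lie below \<open>\<delta>\<close>, where the power bound is
      available.\<close>
    then have RA: "A / R\<^sup>2 \<le> F \<delta>" using A F\<delta> R1 by (simp add: field_simps)
    define E where "E = c * (A / R\<^sup>2) powr e"
    have E: "0 \<le> E" using c by (simp add: E_def)
    have XG: "X v \<le> R\<^sup>2 / A * G v + E" if v: "0 < v" for v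
    proof (cases "A / R\<^sup>2 \<le> F v")
      case True
      then have "1 \<le> R\<^sup>2 / A * F v" using A R1 by (simp add: field_simps)
      from mult_right_mono[OF this less_imp_le[OF X_pos[OF v]]]
      show ?thesis using E by (simp add: G_def mult_ac)
    next
      case False
      then have "F v < F \<delta>" using RA by simp
      then have "v \<le> \<delta>" using F_mono[OF \<delta>, of v] by force
      then have "X v \<le> c * F v powr e" by (rule X[OF v])
      also have "\<dots> \<le> E"
        unfolding E_def using False e F_pos[OF v] c by (intro mult_left_mono powr_mono2) auto
      finally show ?thesis using A G_pos[OF v] by (simp add: add_increasing)
    qed
    have "(LINT x|lborel. G (u x) * xi 0 R x) \<le> 2 * (C / R\<^sup>2 * (E * ((2 * R) ^ DIM('a) * c1)))"
    proof (rule absorb_doubled_ball[OF cG _ _ R1(2)])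
      show "0 \<le> G (u x)" for x using G_pos[OF u_pos[of x]] by simp
      show "G (u x) \<le> G M" for x by (rule G_mono[OF u_pos u_le])
      show "0 \<le> C / A" using C A by simp
      show "C / A * ?D \<le> 1/2" using C D by (simp add: A_def)
      fix p
      have i: "integrable lborel (\<lambda>x. G (u x) * xi p (2 * R) x)" "integrable lborel (xi p (2 * R))"
        "integrable lborel (\<lambda>x. X (u x) * xi p (2 * R) x)"
        using R1 integrable_xi[of "2 * R" "\<lambda>_. 1" p] by (auto intro!: integrable_xi cG cX)
      have "(LINT x|lborel. X (u x) * xi p (2 * R) x)
          \<le> (LINT x|lborel. R\<^sup>2 / A * (G (u x) * xi p (2 * R) x) + E * xi p (2 * R) x)"
      proof (rule integral_mono[OF i(3)])
        show "integrable lborel (\<lambda>x. R\<^sup>2 / A * (G (u x) * xi p (2 * R) x) + E * xi p (2 * R) x)"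
          using i by simp
        show "X (u x) * xi p (2 * R) x \<le> R\<^sup>2 / A * (G (u x) * xi p (2 * R) x) + E * xi p (2 * R) x" for x
          using mult_right_mono[OF XG[OF u_pos[of x]] xi_bounds(1)[of p "2 * R" x]]
          by (simp add: distrib_right mult.assoc)
      qed
      also have "\<dots> = R\<^sup>2 / A * (LINT x|lborel. G (u x) * xi p (2 * R) x) + E * ((2 * R) ^ DIM('a) * c1)"
        using i integral_xi[of "2 * R" p] R1 by (simp add: c1_def)
      finally have J: "(LINT x|lborel. X (u x) * xi p (2 * R) x)
        \<le> R\<^sup>2 / A * (LINT x|lborel. G (u x) * xi p (2 * R) x) + E * ((2 * R) ^ DIM('a) * c1)" .
      have "(LINT x|lborel. G (u x) * xi p R x) \<le> C / R\<^sup>2 * (LINT x|lborel. X (u x) * xi p (2 * R) x)"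
        by (rule C(2)[OF R1(2)])
      also have "\<dots> \<le> C / R\<^sup>2 * (R\<^sup>2 / A * (LINT x|lborel. G (u x) * xi p (2 * R) x) + E * ((2 * R) ^ DIM('a) * c1))"
        using C(1) by (intro mult_left_mono J) auto
      also have "\<dots> = C / A * (LINT x|lborel. G (u x) * xi p (2 * R) x) + C / R\<^sup>2 * (E * ((2 * R) ^ DIM('a) * c1))"
        using R1 by (simp add: distrib_left)
      finally show "(LINT x|lborel. G (u x) * xi p R x) \<le> \<dots>" .
    qed
    also have "\<dots> = K * (R ^ DIM('a) / R\<^sup>2 * (1 / R\<^sup>2) powr e)"
    proof -
      have "(A / R\<^sup>2) powr e = A powr e * (1 / R\<^sup>2) powr e"
        using A by (simp add: powr_mult[symmetric])
      then show ?thesis by (simp add: K_def E_def power_mult_distrib)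
    qed
    also have "R ^ DIM('a) / R\<^sup>2 * (1 / R\<^sup>2) powr e = R powr (- d)"
    proof -
      have 1: "(1 / R\<^sup>2) powr e = R powr (- (2 * e))"
        using R1 by (simp add: powr_divide powr_minus_divide powr_powr flip: powr_numeral)
      have 2: "R ^ DIM('a) / R\<^sup>2 = R powr (real DIM('a) - 2)"
        using R1 by (simp add: powr_diff powr_realpow)
      show ?thesis unfolding 1 2 d_def by (simp add: powr_add[symmetric])
    qed
    finally have "(LINT x|lborel. G (u x) * xi 0 R x) \<le> K * R powr (- d)" .
    moreover have "I \<le> (LINT x|lborel. G (u x) * xi 0 R x)"
      unfolding I_def
    proof (rule integral_mono)
      show "G (u x) * xi 0 1 x \<le> G (u x) * xi 0 R x" for x
        using R1 G_pos[OF u_pos[of x]] unfolding xi_def bump_def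
        by (intro mult_left_mono power_mono max.mono diff_left_mono divide_left_mono) auto
    qed (use R1 in \<open>auto intro!: integrable_xi cG\<close>)
    ultimately show ?thesis by simp
  qed
  then have ev: "\<forall>\<^sub>F R in at_top. I \<le> K * R powr (- d)"
    unfolding eventually_at_top_linorder by blast
  have "((\<lambda>R. K * R powr (- d)) \<longlongrightarrow> K * 0) at_top"
    by (intro tendsto_mult tendsto_const tendsto_neg_powr) (use d in \<open>auto simp: filterlim_ident\<close>)
  then have "I \<le> 0" using tendsto_lowerbound[OF _ ev] by auto
  then have "G (u 0) * xi 0 1 (0::'a) = 0"
    unfolding I_def
  proof (rule continuous_integral_eq_0[rotated 3])
    show "continuous_on UNIV (\<lambda>x. G (u x) * xi 0 1 x)" by (intro continuous_intros cG)
    show "bounded_support (\<lambda>x. G (u x) * xi 0 1 x)"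
      by (rule bounded_support_subset[OF bounded_support_xi(1)[of 1 0]]) auto
    show "0 \<le> G (u x) * xi 0 1 x" for x
      using G_pos[OF u_pos[of x]] xi_bounds(1)[of 0 1 x] by simp
  qed
  then show False using G_pos[OF u_pos[of 0]] by (simp add: xi_def bump_def)
qed

end

section \<open>The Liouville theorem\<close>

text \<open>The bound \<open>1/q \<le> 1/Q\<close> is given only up to \<open>\<delta>\<close>. The
  constants extend the estimates to \<open>M\<close> by monotonicity and compactness, while the
  weight is flattened just enough for the sharp \<open>\<mu>\<^sup>2 / Q\<close> to hold on all
  levels.\<close>

lemma growth_exists:
  fixes f F F2 :: "real \<Rightarrow> real" and M \<delta> Q \<mu> :: real
  assumes f_deriv: "\<And>v. 0 < v \<Longrightarrow> (f has_real_derivative F v) (at v)"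
    and F_deriv: "\<And>v. 0 < v \<Longrightarrow> (F has_real_derivative F2 v) (at v)"
    and F2_cont: "continuous_on {0<..} F2"
    and F2_nonneg: "\<And>v. 0 < v \<Longrightarrow> 0 \<le> F2 v"
    and F_pos: "\<And>v. 0 < v \<Longrightarrow> 0 < F v"
    and f_pos: "\<And>v. 0 < v \<Longrightarrow> 0 < f v"
    and f_le: "\<And>v. 0 < v \<Longrightarrow> f v \<le> v * F v"
    and f_lim: "(f \<longlongrightarrow> 0) (at_right 0)"
    and F_lim: "(F \<longlongrightarrow> 0) (at_right 0)"
    and \<delta>: "0 < \<delta>" "\<delta> \<le> M" and Q: "1 < Q"
    and near_0: "\<And>v. 0 < v \<Longrightarrow> v \<le> \<delta> \<Longrightarrow> f v * F2 v \<le> 1 / Q * (F v)\<^sup>2"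
    and \<mu>: "0 \<le> \<mu>" "\<mu>\<^sup>2 < Q"
  shows "\<exists>\<rho> C1 z1 c. growth f F F2 M \<rho> C1 \<mu> z1 (\<mu>\<^sup>2 * (1 / Q)) \<and> 0 \<le> c \<and>
    (\<forall>v. 0 < v \<longrightarrow> v \<le> \<delta> \<longrightarrow> growth.X f F \<mu> z1 v \<le> c * F v powr (2 * Q + 2 * \<mu>))"
proof -
  let ?s = "1 / Q"
  have s: "0 < ?s" "?s < 1" using Q by auto
  have F_mono: "F a \<le> F b" if "0 < a" "a \<le> b" for a b
    by (rule mono_if_deriv_nonneg[OF that(2), of F F2]) (use F_deriv F2_nonneg that in auto)
  have f_mono: "f a \<le> f b" if "0 < a" "a \<le> b" for a b
    by (rule mono_if_deriv_nonneg[OF that(2), of f F]) (use f_deriv F_pos that in \<open>auto intro: less_imp_le\<close>)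
  \<comment> \<open>The derivative of \<open>f / F\<close> is \<open>1 - f F2 / F\<^sup>2\<close>,
    at least \<open>1 - ?s\<close>; this is where \<open>Q > 1\<close> makes the bound
    nontrivial.\<close>
  have elast: "(1 - ?s) * v * F v \<le> f v" if v: "0 < v" "v \<le> \<delta>" for v
  proof -
    have "0 \<le> f v / F v - (1 - ?s) * v"
    proof (rule nonneg_if_deriv_nonneg_at_right_0[OF _ _ _ v])
      fix v assume v: "0 < v" "v \<le> \<delta>"
      show "((\<lambda>v. f v / F v - (1 - ?s) * v) has_real_derivative ?s - f v * F2 v / (F v)\<^sup>2) (at v)"
        using F_pos[OF v(1)] Q
        by (auto intro!: derivative_eq_intros f_deriv F_deriv v simp: power2_eq_square field_simps)
      show "0 \<le> ?s - f v * F2 v / (F v)\<^sup>2"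
        using near_0[OF v] F_pos[OF v(1)] by (simp add: divide_le_eq)
    next
      have "((\<lambda>v. f v / F v) \<longlongrightarrow> 0) (at_right 0)"
      proof (rule Lim_null_comparison)
        show "\<forall>\<^sub>F v in at_right 0. norm (f v / F v) \<le> v"
          unfolding eventually_at_right_field
          using f_le F_pos f_pos by (intro exI[of _ 1]) (auto simp: divide_le_eq less_imp_le abs_of_pos)
      qed (rule tendsto_ident_at)
      from tendsto_diff[OF this tendsto_mult[OF tendsto_const tendsto_ident_at]]
      show "((\<lambda>v. f v / F v - (1 - ?s) * v) \<longlongrightarrow> 0) (at_right 0)" by simp
    qed
    then show ?thesis using F_pos[OF v(1)] by (simp add: field_simps)
  qed
  define C1 where "C1 = 1 / (1 - ?s) + M * F M / f \<delta>"
  have M: "0 < M" using \<delta> by simp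
  have C1a: "0 < 1 / (1 - ?s)" "0 < M * F M / f \<delta>"
    using s F_pos[OF M] f_pos[OF \<delta>(1)] M by auto
  have C1: "v * F v \<le> C1 * f v" if v: "0 < v" "v \<le> M" for v
  proof (cases "v \<le> \<delta>")
    case True
    have "v * F v \<le> 1 / (1 - ?s) * f v"
      using elast[OF v(1) True] s by (simp add: field_simps)
    also have "\<dots> \<le> C1 * f v"
      unfolding C1_def using C1a f_pos[OF v(1)] by (intro mult_right_mono) auto
    finally show ?thesis .
  next
    case False
    have "v * F v \<le> M * F M"
      using v F_mono[OF v] F_pos[OF v(1)] by (intro mult_mono) auto
    also have "\<dots> = M * F M / f \<delta> * f \<delta>" using f_pos[OF \<delta>(1)] by simp
    also have "\<dots> \<le> C1 * f v"
      unfolding C1_def using C1a f_mono[OF \<delta>(1), of v] f_pos[OF \<delta>(1)] False by (intro mult_mono) auto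
    finally show ?thesis .
  qed
  have "compact (F2 ` {\<delta>..M})"
    by (intro compact_continuous_image continuous_on_subset[OF F2_cont]) (use \<delta> in auto)
  then obtain b where "\<forall>v\<in>{\<delta>..M}. \<bar>F2 v\<bar> \<le> b"
    using compact_imp_bounded[of "F2 ` {\<delta>..M}"] unfolding bounded_iff by auto
  then have b: "\<bar>F2 v\<bar> \<le> b" if "\<delta> \<le> v" "v \<le> M" for v using that by simp
  have b0: "0 \<le> b" using b[of \<delta>] \<delta> by force
  define \<rho> where "\<rho> = ?s + f M * b / (F \<delta>)\<^sup>2"
  have \<rho>a: "0 \<le> f M * b / (F \<delta>)\<^sup>2" using b0 f_pos[OF M] by simp
  have \<rho>: "?s \<le> \<rho>" "0 < \<rho>" using \<rho>a s unfolding \<rho>_def by linarith+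
  have ratio: "f v * F2 v \<le> \<rho> * (F v)\<^sup>2" if v: "0 < v" "v \<le> M" for v
  proof (cases "v \<le> \<delta>")
    case True
    have "?s * (F v)\<^sup>2 \<le> \<rho> * (F v)\<^sup>2" by (rule mult_right_mono[OF \<rho>(1)]) simp
    then show ?thesis using near_0[OF v(1) True] by linarith
  next
    case False
    have "f v * F2 v \<le> f M * b"
      using f_mono[OF v] b[of v] False v f_pos[OF v(1)] f_pos[OF M] b0 F2_nonneg[OF v(1)] by (intro mult_mono) auto
    also have "\<dots> = f M * b / (F \<delta>)\<^sup>2 * (F \<delta>)\<^sup>2" using F_pos[OF \<delta>(1)] by simp
    also have "\<dots> \<le> \<rho> * (F v)\<^sup>2"
      using \<rho>a s F_mono[OF \<delta>(1), of v] F_pos[OF \<delta>(1)] False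
      by (intro mult_mono power_mono) (auto simp: \<rho>_def)
    finally show ?thesis .
  qed
  \<comment> \<open>Beyond \<open>\<delta>\<close> the squared factor
    \<open>(z1 / (z1 + F v))\<^sup>2\<close> is then at most \<open>?s / \<rho>\<close>, which turns
    the crude constant \<open>\<rho>\<close> into \<open>?s\<close>.\<close>
  define z1 where "z1 = F \<delta> * sqrt (?s / \<rho>)"
  have z1: "0 < z1" using F_pos[OF \<delta>(1)] s \<rho> by (simp add: z1_def)
  have mt: "(\<mu> * (z1 / (z1 + F v)))\<^sup>2 * (f v * F2 v) \<le> \<mu>\<^sup>2 * ?s * (F v)\<^sup>2" if v: "0 < v" "v \<le> M" for v
  proof -
    define k where "k = z1 / (z1 + F v)"
    have Fv: "0 < F v" by (rule F_pos[OF v(1)])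
    have k: "0 \<le> k" "k \<le> 1" using z1 Fv by (auto simp: k_def)
    have fF: "0 \<le> f v * F2 v" using f_pos[OF v(1)] F2_nonneg[OF v(1)] by simp
    have "k\<^sup>2 * (f v * F2 v) \<le> ?s * (F v)\<^sup>2"
    proof (cases "v \<le> \<delta>")
      case True
      have "k\<^sup>2 * (f v * F2 v) \<le> 1 * (f v * F2 v)"
        using k fF by (intro mult_right_mono) (auto simp: power_le_one)
      then show ?thesis using near_0[OF v(1) True] by simp
    next
      case False
      have "k \<le> z1 / F \<delta>"
        unfolding k_def using z1 F_mono[OF \<delta>(1), of v] F_pos[OF \<delta>(1)] False by (intro divide_left_mono) auto
      also have "\<dots> = sqrt (?s / \<rho>)" using F_pos[OF \<delta>(1)] by (simp add: z1_def)
      finally have "k\<^sup>2 \<le> (sqrt (?s / \<rho>))\<^sup>2" using k by (intro power_mono) auto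
      then have "k\<^sup>2 \<le> ?s / \<rho>" using s \<rho> by simp
      then have "k\<^sup>2 * (f v * F2 v) \<le> ?s / \<rho> * (\<rho> * (F v)\<^sup>2)"
        by (rule mult_mono[OF _ ratio[OF v]]) (use fF s \<rho> in auto)
      then show ?thesis using \<rho> by simp
    qed
    then have "\<mu>\<^sup>2 * (k\<^sup>2 * (f v * F2 v)) \<le> \<mu>\<^sup>2 * (?s * (F v)\<^sup>2)" by (intro mult_left_mono) auto
    then show ?thesis unfolding k_def[symmetric] by (simp only: power_mult_distrib mult.assoc)
  qed
  have th: "0 \<le> \<mu>\<^sup>2 * ?s" "\<mu>\<^sup>2 * ?s < 1" using \<mu> Q by simp_all
  have C1p: "0 < C1" unfolding C1_def using C1a by (rule add_pos_pos)
  interpret growth f F F2 M \<rho> C1 \<mu> z1 "\<mu>\<^sup>2 * ?s"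
    by (rule growth.intro)
      (fact M f_deriv F_deriv F2_cont F2_nonneg F_pos f_pos f_lim F_lim less_imp_le[OF \<rho>(2)] ratio C1p C1
        \<mu>(1) z1 th mt)+
  define k where "k = F \<delta> * f \<delta> powr (- ?s)"
  have k: "0 < k" using F_pos[OF \<delta>(1)] f_pos[OF \<delta>(1)] by (simp add: k_def)
  \<comment> \<open>The bound on \<open>f F2 / F\<^sup>2\<close> says that
    \<open>F * f powr (- ?s)\<close> is nonincreasing, so up to \<open>\<delta>\<close> it is at
    least its value \<open>k\<close> at \<open>\<delta>\<close>.\<close>
  have f_bound: "f v \<le> (F v / k) powr Q" if v: "0 < v" "v \<le> \<delta>" for v
  proof -
    have "F \<delta> * f \<delta> powr (- ?s) \<le> F v * f v powr (- ?s)"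
    proof (rule DERIV_nonpos_imp_nonincreasing[OF v(2), of "\<lambda>v. F v * f v powr (- ?s)"])
      fix x assume "v \<le> x" "x \<le> \<delta>"
      then have x: "0 < x" "x \<le> \<delta>" using v by auto
      have fx: "0 < f x" by (rule f_pos[OF x(1)])
      show "\<exists>y. ((\<lambda>v. F v * f v powr (- ?s)) has_real_derivative y) (at x) \<and> y \<le> 0"
      proof (intro exI conjI)
        have "((\<lambda>v. f v powr (- ?s)) has_real_derivative (- ?s) * f x powr (- ?s - 1) * F x) (at x)"
          by (rule DERIV_chain2[where f = "\<lambda>z. z powr (- ?s)", OF has_real_derivative_powr[OF fx] f_deriv[OF x(1)]])
        from DERIV_mult[OF F_deriv[OF x(1)] this]
        show "((\<lambda>v. F v * f v powr (- ?s)) has_real_derivative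
            f x powr (- ?s - 1) * (f x * F2 x - ?s * (F x)\<^sup>2)) (at x)"
        proof (rule DERIV_cong)
          have "f x powr (- ?s) = f x powr (- ?s - 1) * f x"
            using fx by (simp add: powr_diff)
          then show "F2 x * f x powr (- ?s) + (- ?s) * f x powr (- ?s - 1) * F x * F x
              = f x powr (- ?s - 1) * (f x * F2 x - ?s * (F x)\<^sup>2)"
            by (simp add: algebra_simps power2_eq_square)
        qed
        show "f x powr (- ?s - 1) * (f x * F2 x - ?s * (F x)\<^sup>2) \<le> 0"
          using near_0[OF x] by (intro mult_nonneg_nonpos) auto
      qed
    qed
    then have "k \<le> F v * f v powr (- ?s)" by (simp add: k_def)
    then have "f v powr ?s \<le> F v / k"
      using k f_pos[OF v(1)] by (simp add: powr_minus field_simps)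
    then have "(f v powr ?s) powr Q \<le> (F v / k) powr Q"
      using Q by (intro powr_mono2) auto
    then show ?thesis using Q f_pos[OF v(1)] by (simp add: powr_powr)
  qed
  define c where "c = (1 / k) powr (2 * Q) * (1 / z1) powr (2 * \<mu>)"
  have "X v \<le> c * F v powr (2 * Q + 2 * \<mu>)" if v: "0 < v" "v \<le> \<delta>" for v
  proof -
    have Fv: "0 < F v" by (rule F_pos[OF v(1)])
    have "X v \<le> ((F v / k) powr Q * (F v / z1) powr \<mu>)\<^sup>2"
      unfolding X_def
      using f_bound[OF v] chi_le[OF v(1)] f_pos[OF v(1)] chi_pos[OF v(1)] by (intro power_mono mult_mono) auto
    also have "\<dots> = (F v / k) powr (2 * Q) * (F v / z1) powr (2 * \<mu>)"
    proof -
      have "(x powr a)\<^sup>2 = x powr (2 * a)" for x a :: real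
        by (simp only: power2_eq_square powr_add[symmetric] mult_2)
      then show ?thesis by (simp only: power_mult_distrib)
    qed
    also have "\<dots> = c * F v powr (2 * Q + 2 * \<mu>)"
    proof -
      have "(F v / k) powr (2 * Q) = F v powr (2 * Q) * (1 / k) powr (2 * Q)"
        "(F v / z1) powr (2 * \<mu>) = F v powr (2 * \<mu>) * (1 / z1) powr (2 * \<mu>)"
        using Fv k z1 by (simp_all add: powr_mult[symmetric])
      then show ?thesis by (simp add: c_def powr_add)
    qed
    finally show ?thesis .
  qed
  moreover have "0 \<le> c" by (simp add: c_def)
  ultimately show ?thesis using growth_axioms by blast
qed

text \<open>Replacing \<open>q2\<close> by the smaller \<open>q1\<close> weakens the third condition
  to an inequality in \<open>q1\<close> alone, \<open>4 q1 + 4 sqrt q1 > N - 2\<close>. It is open,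
  which leaves room to choose \<open>Q\<close> strictly below \<open>q1\<close> and
  \<open>\<mu>\<close> strictly below \<open>sqrt Q\<close>.\<close>

lemma exponents_exist:
  fixes q1 q2 :: ereal and N :: nat
  assumes q: "0 \<le> q1" "q1 \<le> q2" and N: "10 \<le> N"
    and cond: "q1 > ereal (real N / 2) \<or> four_over_N_minus_2 N * (1 + 1 / sqrt_ereal q2) > 1 / q1"
  shows "\<exists>Q \<mu>. ereal Q < q1 \<and> 1 < Q \<and> 0 \<le> \<mu> \<and> \<mu>\<^sup>2 < Q \<and> real N - 2 < 4 * Q + 4 * \<mu>"
proof -
  have "\<exists>Q>0. ereal Q < q1 \<and> real N - 2 < 4 * Q + 4 * sqrt Q"
  proof (cases "q1 > ereal (real N / 2)")
    case True
    have "0 \<le> sqrt (real N / 2)" by simp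
    then have "real N - 2 < 4 * (real N / 2) + 4 * sqrt (real N / 2)" by linarith
    then show ?thesis using True N by (intro exI[of _ "real N / 2"]) auto
  next
    case False
    then have c3: "four_over_N_minus_2 N * (1 + 1 / sqrt_ereal q2) > 1 / q1" using cond by simp
    have "q1 \<noteq> \<infinity>" using False by auto
    then obtain r where r: "q1 = ereal r" "0 \<le> r" using q(1) by (cases q1) auto
    \<comment> \<open>With \<open>1 / 0 = \<infinity>\<close> the strict inequality in
      \<open>c3\<close> would be impossible.\<close>
    have "r \<noteq> 0" using c3 r by (auto simp: divide_ereal_def)
    then have r0: "0 < r" using r by simp
    have four: "four_over_N_minus_2 N = ereal (4 / (real N - 2))"
      using N by (simp add: four_over_N_minus_2_def)
    have N2: "0 < real N - 2" using N by simp
    have "1 / sqrt_ereal q2 \<le> ereal (1 / sqrt r)"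
    proof (cases q2)
      case (real t)
      then have "r \<le> t" using q(2) r by simp
      then have "1 / sqrt t \<le> 1 / sqrt r" "0 < sqrt t" using r0 by (auto intro!: divide_left_mono)
      then show ?thesis using real by (simp add: sqrt_ereal_def one_ereal_def)
    next
      case PInf
      then show ?thesis using r0 by (simp add: sqrt_ereal_def)
    next
      case MInf
      then show ?thesis using q r by simp
    qed
    then have "four_over_N_minus_2 N * (1 + 1 / sqrt_ereal q2) \<le> ereal (4 / (real N - 2)) * (1 + ereal (1 / sqrt r))"
      unfolding four using N2 by (intro ereal_mult_left_mono add_left_mono) auto
    then have "1 / q1 < ereal (4 / (real N - 2)) * (1 + ereal (1 / sqrt r))"
      using c3 by (rule less_le_trans[rotated])
    then have "1 / r < 4 / (real N - 2) * (1 + 1 / sqrt r)"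
      using r r0 by (simp add: one_ereal_def)
    then have lt: "r * (1 / r) * (real N - 2) < r * (4 / (real N - 2) * (1 + 1 / sqrt r)) * (real N - 2)"
      using r0 N2 by (intro mult_strict_right_mono mult_strict_left_mono) auto
    have "r * (4 / n * (1 + 1 / sqrt r)) * n = 4 * r + 4 * (r / sqrt r)" if "n \<noteq> 0" for n
      using that r0 by (simp add: field_simps)
    from this[of "real N - 2"]
    have "r * (4 / (real N - 2) * (1 + 1 / sqrt r)) * (real N - 2) = 4 * r + 4 * (r / sqrt r)"
      using N2 by linarith
    moreover have "r * (1 / r) * (real N - 2) = real N - 2" using r0 by simp
    ultimately have "real N - 2 < 4 * r + 4 * (r / sqrt r)" using lt by linarith
    then have "real N - 2 < 4 * r + 4 * sqrt r" using r0 by (simp add: real_div_sqrt)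
    moreover have "((\<lambda>Q. 4 * Q + 4 * sqrt Q) \<longlongrightarrow> 4 * r + 4 * sqrt r) (at_left r)"
      by (intro tendsto_intros)
    ultimately have "\<forall>\<^sub>F Q in at_left r. real N - 2 < 4 * Q + 4 * sqrt Q"
      by (simp add: order_tendstoD(1))
    moreover have "\<forall>\<^sub>F Q in at_left r. 0 < Q \<and> Q < r"
      unfolding eventually_at_left_field using r0 by (intro exI[of _ 0]) auto
    ultimately have "\<forall>\<^sub>F Q in at_left r. 0 < Q \<and> Q < r \<and> real N - 2 < 4 * Q + 4 * sqrt Q"
      by eventually_elim auto
    then obtain Q where "0 < Q" "Q < r" "real N - 2 < 4 * Q + 4 * sqrt Q"
      using eventually_happens'[OF trivial_limit_at_left_real] by blast
    then show ?thesis using r by auto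
  qed
  then obtain Q where Q: "0 < Q" "ereal Q < q1" "real N - 2 < 4 * Q + 4 * sqrt Q" by blast
  \<comment> \<open>Here the dimension enters: \<open>Q \<le> 1\<close> would give
    \<open>4 * Q + 4 * sqrt Q \<le> 8 \<le> N - 2\<close>.\<close>
  have Q1: "1 < Q"
  proof (rule ccontr)
    assume "\<not> 1 < Q"
    then have "sqrt Q \<le> 1" "Q \<le> 1" by auto
    then show False using Q(3) N by linarith
  qed
  define g where "g = 4 * Q + 4 * sqrt Q - (real N - 2)"
  \<comment> \<open>The reduction of \<open>sqrt Q\<close> by \<open>g / 8\<close> costs at most
    \<open>g / 2\<close>, half of the available gap.\<close>
  define \<mu> where "\<mu> = max 0 (sqrt Q - g / 8)"
  have g: "0 < g" using Q by (simp add: g_def)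
  have "\<mu> < sqrt Q" using g Q by (simp add: \<mu>_def)
  then have "\<mu>\<^sup>2 < (sqrt Q)\<^sup>2" by (intro power_strict_mono) (auto simp: \<mu>_def)
  then have "\<mu>\<^sup>2 < Q" using Q by simp
  moreover have "real N - 2 < 4 * Q + 4 * \<mu>"
  proof -
    have "sqrt Q - g / 8 \<le> \<mu>" by (simp add: \<mu>_def)
    moreover have "real N - 2 = 4 * Q + 4 * sqrt Q - g" by (simp add: g_def)
    ultimately show ?thesis using g by argo
  qed
  ultimately show ?thesis using Q Q1 by (intro exI[of _ Q] exI[of _ \<mu>]) (auto simp: \<mu>_def)
qed

text \<open>Tested with the cut-off alone, stability gives \<open>m * R\<^sup>2 \<le> K\<close> for
  every \<open>R\<close>. With the monotonicity of \<open>F\<close> this yields the limit 0 of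
  \<open>F\<close> at 0.\<close>

lemma (in stable_solution) F_not_bounded_below:
  assumes "0 < m" "\<And>v. 0 < v \<Longrightarrow> m \<le> F v"
  shows False
proof -
  define c where "c = (LINT x|lborel. xi (0::'a) 1 x)"
  have c: "0 < c" unfolding c_def by (rule integral_xi_pos)
  define K :: real where "K = 216 * 2 ^ DIM('a)"
  have "m * R\<^sup>2 \<le> K" if R: "R > 0" for R
  proof -
    have ix: "integrable lborel (xi (0::'a) R)" "integrable lborel (xi (0::'a) (2 * R))"
      using R integrable_xi[OF _ continuous_on_const, of _ 1 "0::'a"] by simp_all
    have "m * (R ^ DIM('a) * c) = (LINT x|lborel. m * xi (0::'a) R x)"
      using integral_xi[OF R, of "0::'a"] by (simp add: c_def)
    also have "\<dots> \<le> (LINT x|lborel. F (u x) * (eta 0 R x)\<^sup>2)"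
    proof (rule integral_mono)
      show "integrable lborel (\<lambda>x. m * xi (0::'a) R x)" using ix by simp
      show "integrable lborel (\<lambda>x. F (u x) * (eta 0 R x)\<^sup>2)"
        using integrable_xi[OF R cont_Fu, of 0] by (simp add: xi_eq_eta)
      show "m * xi 0 R x \<le> F (u x) * (eta 0 R x)\<^sup>2" for x
        using mult_right_mono[OF assms(2)[OF u_pos[of x]] xi_bounds(1)[of 0 R x]] by (simp add: xi_eq_eta)
    qed
    also have "\<dots> \<le> (LINT x|lborel. (norm (grad_eta (0::'a) R x))\<^sup>2)"
      by (rule stable[OF has_grad_eta bounded_support_xi(4)[OF R]])
    also have "\<dots> \<le> (LINT x|lborel. 216 / R\<^sup>2 * xi (0::'a) (2 * R) x)"
    proof (rule integral_mono)
      show "integrable lborel (\<lambda>x. (norm (grad_eta (0::'a) R x))\<^sup>2)"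
        by (intro integrable_bounded_support continuous_intros
            bounded_support_subset[OF bounded_support_xi(5)[OF R, of 0]]) simp
    qed (use ix grad_eta_bound[OF R] in auto)
    also have "\<dots> = 216 / R\<^sup>2 * ((2 * R) ^ DIM('a) * c)"
      using integral_xi[of "2 * R" "0::'a"] R by (simp add: c_def)
    also have "\<dots> = (K / R\<^sup>2) * (R ^ DIM('a) * c)" by (simp add: K_def power_mult_distrib)
    finally have "m \<le> K / R\<^sup>2"
      by (rule mult_right_le_imp_le) (use R c in simp)
    then show ?thesis using R by (simp add: field_simps)
  qed
  from this[of "sqrt ((K + 1) / m)"] show False
    using assms(1) by (simp add: K_def add_nonneg_pos)
qed

text \<open>Tested with the cut-off, the equation bounds the average of the source by a multiple of
  \<open>M / R\<^sup>2\<close>. Applied with \<open>m = f 0\<close> this excludes a positive value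
  of \<open>f\<close> at 0.\<close>

lemma (in bounded_superharmonic) fu_no_lower_bound:
  assumes "0 < m" "\<And>x. m \<le> fu x"
  shows False
proof -
  define c where "c = (LINT x|lborel. xi (0::'a) 1 x)"
  have c: "0 < c" unfolding c_def by (rule integral_xi_pos)
  have M: "0 \<le> M" using u_nonneg[of 0] u_le[of 0] by linarith
  define K where "K = lap_const TYPE('a) * M * 2 ^ DIM('a)"
  have "m * R\<^sup>2 \<le> K" if R: "R > 0" for R
  proof -
    have ix: "integrable lborel (xi (0::'a) R)" "integrable lborel (xi (0::'a) (2 * R))"
      using R integrable_xi[OF _ continuous_on_const, of _ 1 "0::'a"] by simp_all
    have "m * (R ^ DIM('a) * c) = (LINT x|lborel. m * xi (0::'a) R x)"
      using integral_xi[OF R, of "0::'a"] by (simp add: c_def)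
    also have "\<dots> \<le> (LINT x|lborel. fu x * xi 0 R x)"
      using ix integrable_xi[OF R cont_fu, of 0] assms(2)
      by (intro integral_mono mult_right_mono xi_bounds) auto
    also have "\<dots> \<le> lap_const TYPE('a) / R\<^sup>2 * (LINT x|lborel. (u x - 0) * xi 0 (2 * R) x)"
      by (rule integral_fu_xi_le[OF R u_nonneg])
    also have "\<dots> \<le> lap_const TYPE('a) / R\<^sup>2 * (LINT x|lborel. M * xi (0::'a) (2 * R) x)"
    proof (rule mult_left_mono[OF integral_mono])
      show "(u x - 0) * xi 0 (2 * R) x \<le> M * xi 0 (2 * R) x" for x
        using mult_right_mono[OF u_le xi_bounds(1)] by simp
    qed (use ix R integrable_xi[OF _ cont_u, of "2 * R" 0] in auto)
    also have "\<dots> = lap_const TYPE('a) / R\<^sup>2 * (M * ((2 * R) ^ DIM('a) * c))"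
      using integral_xi[of "2 * R" "0::'a"] R by (simp add: c_def)
    also have "\<dots> = (K / R\<^sup>2) * (R ^ DIM('a) * c)" by (simp add: K_def power_mult_distrib)
    finally have "m \<le> K / R\<^sup>2"
      by (rule mult_right_le_imp_le) (use R c in simp)
    then show ?thesis using R by (simp add: field_simps)
  qed
  moreover have "0 \<le> K" using M by (simp add: K_def)
  ultimately show False
    using assms(1) \<open>\<And>R. R > 0 \<Longrightarrow> m * R\<^sup>2 \<le> K\<close>[of "sqrt ((K + 1) / m)"] by (simp add: add_nonneg_pos)
qed

lemma C2_hessian:
  fixes u :: "'a::euclidean_space \<Rightarrow> real"
  assumes "C2 u"
  defines "H \<equiv> \<lambda>x h. \<Sum>b\<in>Basis. (gradient (partial_deriv b u) x \<bullet> h) *\<^sub>R b"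
  shows "has_grad u (gradient u)" "\<And>x. (gradient u has_derivative H x) (at x)"
    "\<And>b. continuous_on UNIV (\<lambda>x. H x b)" "\<And>x. (\<Sum>b\<in>Basis. H x b \<bullet> b) = laplacian u x"
proof -
  show "has_grad u (gradient u)" using assms by (intro C1_has_grad) (simp add: C2_def)
  have p: "has_grad (partial_deriv b u) (gradient (partial_deriv b u))" if "b \<in> Basis" for b
    using assms that by (intro C1_has_grad) (simp add: C2_def)
  show "(gradient u has_derivative H x) (at x)" for x
    unfolding gradient_def[of u, abs_def] H_def
    by (intro has_derivative_sum has_derivative_scaleR_left has_gradD(1)[OF p])
  show "continuous_on UNIV (\<lambda>x. H x b)" for b
    unfolding H_def by (intro continuous_intros has_gradD(2)[OF p])
  have "H x b \<bullet> b = partial_deriv b (partial_deriv b u) x" if "b \<in> Basis" for x b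
    using that by (simp add: H_def inner_sum_left has_grad_imp(1)[OF p[OF that]] inner_Basis if_distrib cong: if_cong)
  then show "(\<Sum>b\<in>Basis. H x b \<bullet> b) = laplacian u x" for x by (simp add: laplacian_def)
qed

theorem theorem1p11:
  fixes f :: "real \<Rightarrow> real" and u :: "'a::euclidean_space \<Rightarrow> real"
  assumes "continuous_on {0..} f"
    and "C2_on_pos f"
    and "mono_on {0..} f"
    and "convex_on {0..} f"
    and "\<And>s. s > 0 \<Longrightarrow> f s > 0"
    and "C2 u"
    and "bounded (range u)"
    and "\<And>x. u x \<ge> 0"
    and "\<And>x. - laplacian u x = f (u x)"
    and "is_stable f u"
    and "(DIM('a) \<ge> 3 \<and> q0_lower f > ereal (real DIM('a) / 2))
       \<or> (1 \<le> DIM('a) \<and> DIM('a) \<le> 6 \<and> q0_upper f < \<infinity>)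
       \<or> (DIM('a) \<ge> 1 \<and>
          four_over_N_minus_2 DIM('a) * (1 + 1 / sqrt_ereal (q0_upper f)) > 1 / q0_lower f)"
  shows "\<forall>x. u x = 0"
proof (rule ccontr)
  assume nonzero: "\<not> (\<forall>x. u x = 0)"
  define F where "F = deriv f"
  define F2 where "F2 = deriv F"
  define H where "H x h = (\<Sum>b\<in>Basis. (gradient (partial_deriv b u) x \<bullet> h) *\<^sub>R b)" for x h
  note hess = C2_hessian[OF \<open>C2 u\<close>, folded H_def]
  have f_deriv: "(f has_real_derivative F v) (at v)" if "0 < v" for v
    using assms(2) that DERIV_deriv_iff_real_differentiable by (auto simp: C2_on_pos_def F_def)
  have F_deriv: "(F has_real_derivative F2 v) (at v)" if "0 < v" for v
    using assms(2) that DERIV_deriv_iff_real_differentiable by (auto simp: C2_on_pos_def F_def F2_def)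
  have F2_cont: "continuous_on {0<..} F2" using assms(2) by (simp add: C2_on_pos_def F_def F2_def)
  have F_cont: "continuous_on {0<..} F"
    by (rule continuous_on_if_has_real_derivative[of _ F F2]) (use F_deriv in auto)
  have f_lim': "(f \<longlongrightarrow> f 0) (at_right 0)"
  proof -
    have "(f \<longlongrightarrow> f 0) (at 0 within {0..})" using assms(1) by (simp add: continuous_on)
    then show ?thesis by (simp add: at_within_Ici_at_right)
  qed
  have f0: "0 \<le> f 0"
  proof (rule tendsto_lowerbound[OF f_lim'])
    show "\<forall>\<^sub>F v in at_right 0. 0 \<le> f v"
      unfolding eventually_at_right_field using assms(5) by (auto intro!: exI[of _ 1] less_imp_le)
  qed simp
  obtain M where M: "\<And>x. \<bar>u x\<bar> \<le> M" using assms(7) by (auto simp: bounded_iff)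
  have f_nonneg: "0 \<le> f (u x)" for x
    using f0 assms(5)[of "u x"] assms(8)[of x] by (cases "u x = 0") (auto intro: less_imp_le)
  interpret bounded_superharmonic u "gradient u" "\<lambda>x. f (u x)" M
  proof
    show "has_div (gradient u) (\<lambda>x. - f (u x))"
      unfolding has_div_def using hess assms(9) by (intro exI[of _ H]) (auto simp: minus_equation_iff)
    show "u x \<le> M" for x using M[of x] by simp
  qed (use hess f_nonneg assms(8) in auto)
  \<comment> \<open>A single zero of \<open>u\<close> would make it vanish identically.\<close>
  have u_pos: "0 < u x" for x
    using positive_or_zero[of x] nonzero assms(8)[of x] by (metis order_le_less)
  have M_pos: "0 < M" using u_pos[of 0] u_le[of 0] by linarith
  interpret stable_solution_C2 u "gradient u" f M F H
  proof
    show "(LINT x|lborel. F (u x) * (\<phi> x)\<^sup>2) \<le> (LINT x|lborel. (norm (g x))\<^sup>2)"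
      if "has_grad \<phi> g" "bounded_support \<phi>" for \<phi> g
    proof -
      \<comment> \<open>By positivity of \<open>u\<close> the branch at 0 of
        \<open>deriv_halfline\<close> never occurs.\<close>
      have "deriv_halfline f (u x) = F (u x)" for x
        using u_pos[of x] by (simp add: deriv_halfline_def F_def)
      then show ?thesis
        using assms(10) has_grad_C1_compact_support[OF that] has_grad_imp(2)[OF that(1)]
        unfolding is_stable_def by (metis (no_types, lifting) Bochner_Integration.integral_cong)
    qed
    show "(\<Sum>b\<in>Basis. H x b \<bullet> b) = - f (u x)" for x
      using hess(4)[of x] assms(9)[of x] by simp
  qed (use u_pos f_deriv F_cont hess in auto)
  show False
  proof (cases "DIM('a) \<le> 9")
    case True
    \<comment> \<open>\<open>u\<close> is constant, so shifting by \<open>m = u 0\<close>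
      annihilates the right-hand side of \<open>integral_fu_xi\<close>; but \<open>f\<close> is
      positive at \<open>u 0\<close>.\<close>
    have "(LINT x|lborel. f (u x) * xi (0::'a) 1 x) = 0"
    proof -
      have d: "u x - u 0 = 0" for x using constant_if_dim_le_9[OF True, of x] by simp
      show ?thesis unfolding integral_fu_xi[OF zero_less_one, of 0 "u 0"] d by simp
    qed
    moreover have "(LINT x|lborel. f (u x) * xi (0::'a) 1 x) = (LINT x|lborel. f (u 0) * xi (0::'a) 1 x)"
      by (rule Bochner_Integration.integral_cong[OF refl]) (use constant_if_dim_le_9[OF True] in metis)
    ultimately have "f (u 0) * (LINT x|lborel. xi (0::'a) 1 x) = 0" by simp
    then show False using assms(5)[OF u_pos[of 0]] integral_xi_pos[where 'a = 'a] by simp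
  next
    case False
    then have N: "10 \<le> DIM('a)" by simp
    have "f 0 = 0"
    proof (rule ccontr)
      assume "f 0 \<noteq> 0"
      then have "0 < f 0" using f0 by simp
      moreover have "f 0 \<le> f (u x)" for x
        using assms(3,8) by (auto simp: mono_on_def)
      ultimately show False by (rule fu_no_lower_bound)
    qed
    then have f_lim: "(f \<longlongrightarrow> 0) (at_right 0)" using f_lim' by simp
    have tangent: "F a * (b - a) \<le> f b - f a" if "0 < a" "0 \<le> b" for a b
    proof (rule convex_on_imp_above_tangent[OF assms(4)])
      show "(f has_real_derivative F a) (at a within {0..})"
        using f_deriv[OF that(1)] by (rule has_field_derivative_at_within)
    qed (use that in auto)
    have f_le: "f v \<le> v * F v" if "0 < v" for v
      using tangent[OF that, of 0] \<open>f 0 = 0\<close> by (simp add: mult.commute)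
    have F_pos: "0 < F v" if "0 < v" for v
      using f_le[OF that] assms(5)[OF that] that by (metis less_le_trans zero_less_mult_pos)
    have F_mono: "F a \<le> F b" if "0 < a" "a \<le> b" for a b
    proof (cases "a = b")
      case False
      then have "F a * (b - a) \<le> F b * (b - a)"
        using tangent[of a b] tangent[of b a] that by (simp add: algebra_simps)
      then show ?thesis using False that by simp
    qed simp
    have F2_nonneg: "0 \<le> F2 v" if "0 < v" for v
      by (rule mono_on_imp_deriv_nonneg[of "{0<..}" F, OF _ F_deriv[OF that]])
        (use F_mono that in \<open>auto intro!: mono_onI simp: interior_open\<close>)
    \<comment> \<open>A positive lower bound of \<open>F\<close> contradicts stability, and
      monotonicity turns one small value into a limit.\<close>
    have F_lim: "(F \<longlongrightarrow> 0) (at_right 0)"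
    proof (rule order_tendstoI)
      fix m :: real assume "m < 0"
      then show "\<forall>\<^sub>F v in at_right 0. m < F v"
        unfolding eventually_at_right_field using F_pos by (intro exI[of _ 1]) (auto intro: less_trans)
    next
      fix m :: real assume "0 < m"
      then obtain v where v: "0 < v" "F v < m" using F_not_bounded_below[of m] not_le by blast
      have "F y < m" if "0 < y" "y < v" for y using F_mono[of y v] v that by linarith
      then show "\<forall>\<^sub>F v in at_right 0. F v < m"
        unfolding eventually_at_right_field using v(1) by blast
    qed
    have q_nonneg: "0 \<le> q_quot f v" if "0 < v" for v
      using assms(5)[OF that] F2_nonneg[OF that] by (auto simp: q_quot_def F2_def F_def)
    have "0 \<le> q0_lower f" "q0_lower f \<le> q0_upper f"
      unfolding q0_lower_def q0_upper_def
      by (intro Liminf_bounded Liminf_le_Limsup; auto simp: eventually_at_right_field intro!: exI[of _ 1] q_nonneg)+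
    from exponents_exist[OF this N] assms(11) N
    obtain Q \<mu> where Q: "ereal Q < q0_lower f" "1 < Q" "0 \<le> \<mu>" "\<mu>\<^sup>2 < Q" "real DIM('a) - 2 < 4 * Q + 4 * \<mu>"
      by auto
    have "\<forall>\<^sub>F v in at_right 0. ereal Q < q_quot f v"
      using less_LiminfD[of "ereal Q" "at_right 0" "q_quot f"] Q(1) by (simp add: q0_lower_def)
    then obtain b where b: "0 < b" "\<And>v. 0 < v \<Longrightarrow> v < b \<Longrightarrow> ereal Q < q_quot f v"
      by (auto simp: eventually_at_right_field)
    \<comment> \<open>Half of \<open>b\<close>, because the estimate holds on an open interval while
      \<open>\<delta>\<close> itself must be admissible.\<close>
    define \<delta> where "\<delta> = min (b / 2) M"
    have \<delta>: "0 < \<delta>" "\<delta> \<le> M" "\<delta> < b" using b(1) M_pos by (auto simp: \<delta>_def)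
    have near_0: "f v * F2 v \<le> 1 / Q * (F v)\<^sup>2" if v: "0 < v" "v \<le> \<delta>" for v
    \<comment> \<open>In the degenerate case \<open>q_quot\<close> is \<open>\<infinity>\<close> by
      convention and has no quotient to unfold, but the left-hand side is then 0.\<close>
    proof (cases "f v * F2 v = 0")
      case False
      then have p: "0 < f v * F2 v" using assms(5)[OF v(1)] F2_nonneg[OF v(1)] by (simp add: less_le)
      have "ereal Q < q_quot f v" using b(2)[of v] v \<delta> by simp
      then have "Q < (F v)\<^sup>2 / (f v * F2 v)" using False by (simp add: q_quot_def F2_def F_def)
      then have "Q * (f v * F2 v) \<le> (F v)\<^sup>2" using p by (simp add: less_divide_eq)
      then show ?thesis using Q(2) by (simp add: field_simps)
    next
      case True
      moreover have "0 \<le> 1 / Q * (F v)\<^sup>2" using Q(2) by simp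
      ultimately show ?thesis by linarith
    qed
    obtain \<rho> C1 z1 c where g: "growth f F F2 M \<rho> C1 \<mu> z1 (\<mu>\<^sup>2 * (1 / Q))" "0 \<le> c"
      "\<And>v. 0 < v \<Longrightarrow> v \<le> \<delta> \<Longrightarrow> growth.X f F \<mu> z1 v \<le> c * F v powr (2 * Q + 2 * \<mu>)"
      using growth_exists[OF f_deriv F_deriv F2_cont F2_nonneg F_pos assms(5) f_le f_lim F_lim \<delta>(1,2) Q(2) near_0 Q(3,4)]
      by blast
    interpret g: stable_growth u "gradient u" f M F F2 \<rho> C1 \<mu> z1 "\<mu>\<^sup>2 * (1 / Q)"
      by (intro stable_growth.intro stable_solution_axioms g(1))
    show False
      by (rule g.no_solution_if_power_bound[OF \<delta>(1) g(2) _ _ g(3)]) (use Q in auto)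
  qed
qed

end
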